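(* For every pseudovariety $\mathsf{H}$ of finite groups, the semigroup pseudovariety $\mathsf{DH}\cap\mathsf{ECom}$ is local.
   Context: A semigroup pseudovariety is a class of finite semigroups closed under subsemigroups, homomorphic images and finite direct products; a pseudovariety of groups is a class of finite groups closed under subgroups, homomorphic images and finite direct products. $\mathsf{DH}$ is the pseudovariety of all finite semigroups whose regular $\mathcal{J}$-classes are subsemigroups that belong to $\mathsf{H}$; $\mathsf{ECom}$ is the pseudovariety of all finite semigroups whose idempotents commute. Locality. A semigroupoid $S$ is a directed graph with vertex set $V(S)$ and edge set $E(S)$, maps $\alpha,\omega\colon E(S)\to V(S)$ (beginning and end), and a partial associative multiplication on edges, $st$ being defined iff $\omega(s)=\alpha(t)$, with $\alpha(st)=\alpha(s)$, $\omega(st)=\omega(t)$. A semigroup is viewed as a one-vertex semigroupoid. The local semigroup of $S$ at a vertex $v$ is the semigroup of loops at $v$ (if there are none, it imposes no condition). A homomorphism is faithful if it is injective on each set of coterminal edges. $S$ divides $T$ if there are a semigroupoid $U$, a faithful homomorphism $U\to T$, and a homomorphism $U\to S$ that is bijective on vertices and surjective on edges. A pseudovariety of semigroupoids is a class of finite semigroupoids closed under divisors and finite direct products. For a semigroup pseudovariety $\mathsf{V}$, $g\mathsf{V}$ is the pseudovariety of semigroupoids generated by $\mathsf{V}$, and $\ell\mathsf{V}$ is the class of finite semigroupoids whose local semigroups belong to $\mathsf{V}$. $\mathsf{V}$ is local if $g\mathsf{V}=\ell\mathsf{V}$. *)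

theory Defs
  imports "HOL-Algebra.Product_Groups"
begin

text \<open>
  A class of finite structures is represented by a set of structures over the type \<^typ>\<open>nat\<close>.
  Every finite structure is isomorphic to one over \<^typ>\<open>nat\<close>, and each kind of pseudovariety
  below is closed under isomorphism, so nothing is lost. A direct product of structures over
  \<^typ>\<open>nat\<close> lives over a function type; closure under products therefore speaks about all
  isomorphic copies of it over \<^typ>\<open>nat\<close>. Operations are unconstrained outside the carriers.
  Products range over finite index sets, including the empty one.
\<close>


section \<open>Pseudovarieties of groups\<close>

definition group_pseudovariety :: "nat monoid set \<Rightarrow> bool" where
  "group_pseudovariety H \<longleftrightarrow>
     (\<forall>G\<in>H. group G \<and> finite (carrier G)) \<and>
     (\<forall>G\<in>H. \<forall>K. subgroup K G \<longrightarrow> G\<lparr>carrier := K\<rparr> \<in> H) \<and>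
     (\<forall>G\<in>H. \<forall>K::nat monoid. \<forall>h. group K \<and> h \<in> epi G K \<longrightarrow> K \<in> H) \<and>
     (\<forall>(I::nat set) G. \<forall>K::nat monoid.
        finite I \<and> (\<forall>i\<in>I. G i \<in> H) \<and> group K \<and> K \<cong> product_group I G \<longrightarrow> K \<in> H)"


section \<open>Semigroups\<close>

record 'a sgrp = "'a partial_object" +
  smul :: "'a \<Rightarrow> 'a \<Rightarrow> 'a"

text \<open>Semigroups are nonempty.\<close>

definition fin_semigroup :: "'a sgrp \<Rightarrow> bool" where
  "fin_semigroup S \<longleftrightarrow>
     finite (carrier S) \<and> carrier S \<noteq> {} \<and>
     (\<forall>x\<in>carrier S. \<forall>y\<in>carrier S. smul S x y \<in> carrier S) \<and>
     (\<forall>x\<in>carrier S. \<forall>y\<in>carrier S. \<forall>z\<in>carrier S.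
        smul S (smul S x y) z = smul S x (smul S y z))"

definition subsemigroup :: "'a set \<Rightarrow> 'a sgrp \<Rightarrow> bool" where
  "subsemigroup A S \<longleftrightarrow>
     A \<noteq> {} \<and> A \<subseteq> carrier S \<and> (\<forall>x\<in>A. \<forall>y\<in>A. smul S x y \<in> A)"

definition sgrp_hom :: "'a sgrp \<Rightarrow> 'b sgrp \<Rightarrow> ('a \<Rightarrow> 'b) set" where
  "sgrp_hom S T = {h. h ` carrier S \<subseteq> carrier T \<and>
     (\<forall>x\<in>carrier S. \<forall>y\<in>carrier S. h (smul S x y) = smul T (h x) (h y))}"

definition sgrp_iso :: "'a sgrp \<Rightarrow> 'b sgrp \<Rightarrow> bool" where
  "sgrp_iso S T \<longleftrightarrow> (\<exists>h \<in> sgrp_hom S T. bij_betw h (carrier S) (carrier T))"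

definition sgrp_product :: "'i set \<Rightarrow> ('i \<Rightarrow> 'a sgrp) \<Rightarrow> ('i \<Rightarrow> 'a) sgrp" where
  "sgrp_product I S =
     \<lparr>carrier = (\<Pi>\<^sub>E i\<in>I. carrier (S i)), smul = (\<lambda>x y. \<lambda>i\<in>I. smul (S i) (x i) (y i))\<rparr>"

definition semigroup_pseudovariety :: "nat sgrp set \<Rightarrow> bool" where
  "semigroup_pseudovariety V \<longleftrightarrow>
     (\<forall>S\<in>V. fin_semigroup S) \<and>
     (\<forall>S\<in>V. \<forall>A. subsemigroup A S \<longrightarrow> S\<lparr>carrier := A\<rparr> \<in> V) \<and>
     (\<forall>S\<in>V. \<forall>T::nat sgrp. \<forall>h \<in> sgrp_hom S T.
        fin_semigroup T \<and> h ` carrier S = carrier T \<longrightarrow> T \<in> V) \<and>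
     (\<forall>(I::nat set) S. \<forall>T::nat sgrp.
        finite I \<and> (\<forall>i\<in>I. S i \<in> V) \<and> fin_semigroup T \<and> sgrp_iso T (sgrp_product I S)
        \<longrightarrow> T \<in> V)"

text \<open>The ideal \<open>S\<^sup>1 a S\<^sup>1\<close>, written without adjoining an identity.\<close>

definition principal_ideal :: "'a sgrp \<Rightarrow> 'a \<Rightarrow> 'a set" where
  "principal_ideal S a =
     {a} \<union> {smul S s a | s. s \<in> carrier S} \<union> {smul S a t | t. t \<in> carrier S} \<union>
     {smul S (smul S s a) t | s t. s \<in> carrier S \<and> t \<in> carrier S}"

definition J_class :: "'a sgrp \<Rightarrow> 'a \<Rightarrow> 'a set" where
  "J_class S a = {b \<in> carrier S. principal_ideal S b = principal_ideal S a}"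

definition regular_element :: "'a sgrp \<Rightarrow> 'a \<Rightarrow> bool" where
  "regular_element S a \<longleftrightarrow> a \<in> carrier S \<and> (\<exists>x\<in>carrier S. smul S (smul S a x) a = a)"

text \<open>A J-class is regular if it contains a regular element; in a finite semigroup all of its
  elements are then regular.\<close>

definition regular_J_classes :: "'a sgrp \<Rightarrow> 'a set set" where
  "regular_J_classes S = {J_class S a | a. regular_element S a}"

definition DH :: "nat monoid set \<Rightarrow> nat sgrp set" where
  "DH H = {S. fin_semigroup S \<and>
     (\<forall>J \<in> regular_J_classes S. subsemigroup J S \<and>
        (\<exists>G\<in>H. carrier G = J \<and> (\<forall>x\<in>J. \<forall>y\<in>J. x \<otimes>\<^bsub>G\<^esub> y = smul S x y)))}"

definition idempotent_element :: "'a sgrp \<Rightarrow> 'a \<Rightarrow> bool" where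
  "idempotent_element S e \<longleftrightarrow> e \<in> carrier S \<and> smul S e e = e"

definition ECom :: "nat sgrp set" where
  "ECom = {S. fin_semigroup S \<and>
     (\<forall>e f. idempotent_element S e \<and> idempotent_element S f \<longrightarrow> smul S e f = smul S f e)}"


section \<open>Semigroupoids\<close>

text \<open>The partial multiplication is a total function whose value \<open>mul S s t\<close> is meaningful
  only if \<open>tgt S s = src S t\<close>.\<close>

record ('v, 'e) semigroupoid =
  verts :: "'v set"
  edges :: "'e set"
  src :: "'e \<Rightarrow> 'v"
  tgt :: "'e \<Rightarrow> 'v"
  mul :: "'e \<Rightarrow> 'e \<Rightarrow> 'e"

definition is_semigroupoid :: "('v, 'e) semigroupoid \<Rightarrow> bool" where
  "is_semigroupoid S \<longleftrightarrow>
     (\<forall>s\<in>edges S. src S s \<in> verts S \<and> tgt S s \<in> verts S) \<and>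
     (\<forall>s\<in>edges S. \<forall>t\<in>edges S. tgt S s = src S t \<longrightarrow>
        mul S s t \<in> edges S \<and> src S (mul S s t) = src S s \<and> tgt S (mul S s t) = tgt S t) \<and>
     (\<forall>s\<in>edges S. \<forall>t\<in>edges S. \<forall>u\<in>edges S. tgt S s = src S t \<and> tgt S t = src S u \<longrightarrow>
        mul S (mul S s t) u = mul S s (mul S t u))"

definition fin_semigroupoid :: "('v, 'e) semigroupoid \<Rightarrow> bool" where
  "fin_semigroupoid S \<longleftrightarrow> is_semigroupoid S \<and> finite (verts S) \<and> finite (edges S)"

definition one_vertex :: "'e sgrp \<Rightarrow> (nat, 'e) semigroupoid" where
  "one_vertex S =
     \<lparr>verts = {0}, edges = carrier S, src = (\<lambda>_. 0), tgt = (\<lambda>_. 0), mul = smul S\<rparr>"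

definition loops :: "('v, 'e) semigroupoid \<Rightarrow> 'v \<Rightarrow> 'e set" where
  "loops S v = {s \<in> edges S. src S s = v \<and> tgt S s = v}"

definition local_semigroup :: "('v, 'e) semigroupoid \<Rightarrow> 'v \<Rightarrow> 'e sgrp" where
  "local_semigroup S v = \<lparr>carrier = loops S v, smul = mul S\<rparr>"

definition sgd_hom ::
  "('v, 'e) semigroupoid \<Rightarrow> ('w, 'f) semigroupoid \<Rightarrow> (('v \<Rightarrow> 'w) \<times> ('e \<Rightarrow> 'f)) set" where
  "sgd_hom S T = {(p, q).
     p ` verts S \<subseteq> verts T \<and> q ` edges S \<subseteq> edges T \<and>
     (\<forall>s\<in>edges S. src T (q s) = p (src S s) \<and> tgt T (q s) = p (tgt S s)) \<and>
     (\<forall>s\<in>edges S. \<forall>t\<in>edges S. tgt S s = src S t \<longrightarrow> q (mul S s t) = mul T (q s) (q t))}"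

definition faithful :: "('v, 'e) semigroupoid \<Rightarrow> ('e \<Rightarrow> 'f) \<Rightarrow> bool" where
  "faithful S q \<longleftrightarrow>
     (\<forall>s\<in>edges S. \<forall>t\<in>edges S. src S s = src S t \<and> tgt S s = tgt S t \<and> q s = q t \<longrightarrow> s = t)"

text \<open>If \<open>S\<close> and \<open>T\<close> are finite, then so is every witness \<open>U\<close> of division: its vertices
  correspond to those of \<open>S\<close>, and each of its sets of coterminal edges embeds into the edges of
  \<open>T\<close>. So it is enough to look for \<open>U\<close> over \<^typ>\<open>nat\<close>.\<close>

definition divides ::
  "(nat, nat) semigroupoid \<Rightarrow> (nat, nat) semigroupoid \<Rightarrow> bool" where
  "divides S T \<longleftrightarrow>
     (\<exists>U :: (nat, nat) semigroupoid. is_semigroupoid U \<and>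
        (\<exists>(p, q) \<in> sgd_hom U T. faithful U q) \<and>
        (\<exists>(p, q) \<in> sgd_hom U S. bij_betw p (verts U) (verts S) \<and> q ` edges U = edges S))"

definition sgd_iso :: "('v, 'e) semigroupoid \<Rightarrow> ('w, 'f) semigroupoid \<Rightarrow> bool" where
  "sgd_iso S T \<longleftrightarrow>
     (\<exists>(p, q) \<in> sgd_hom S T.
        bij_betw p (verts S) (verts T) \<and> bij_betw q (edges S) (edges T))"

definition sgd_product ::
  "'i set \<Rightarrow> ('i \<Rightarrow> ('v, 'e) semigroupoid) \<Rightarrow> ('i \<Rightarrow> 'v, 'i \<Rightarrow> 'e) semigroupoid" where
  "sgd_product I S =
     \<lparr>verts = (\<Pi>\<^sub>E i\<in>I. verts (S i)), edges = (\<Pi>\<^sub>E i\<in>I. edges (S i)),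
      src = (\<lambda>s. \<lambda>i\<in>I. src (S i) (s i)), tgt = (\<lambda>s. \<lambda>i\<in>I. tgt (S i) (s i)),
      mul = (\<lambda>s t. \<lambda>i\<in>I. mul (S i) (s i) (t i))\<rparr>"

definition semigroupoid_pseudovariety :: "(nat, nat) semigroupoid set \<Rightarrow> bool" where
  "semigroupoid_pseudovariety W \<longleftrightarrow>
     (\<forall>S\<in>W. fin_semigroupoid S) \<and>
     (\<forall>T\<in>W. \<forall>S. fin_semigroupoid S \<and> divides S T \<longrightarrow> S \<in> W) \<and>
     (\<forall>(I::nat set) S. \<forall>T::(nat, nat) semigroupoid.
        finite I \<and> (\<forall>i\<in>I. S i \<in> W) \<and> fin_semigroupoid T \<and> sgd_iso T (sgd_product I S)
        \<longrightarrow> T \<in> W)"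

definition g_pv :: "nat sgrp set \<Rightarrow> (nat, nat) semigroupoid set" where
  "g_pv V = \<Inter>{W. semigroupoid_pseudovariety W \<and> one_vertex ` V \<subseteq> W}"

definition l_pv :: "nat sgrp set \<Rightarrow> (nat, nat) semigroupoid set" where
  "l_pv V = {S. fin_semigroupoid S \<and>
     (\<forall>v\<in>verts S. loops S v \<noteq> {} \<longrightarrow> local_semigroup S v \<in> V)}"

text \<open>Locality is a property of semigroup pseudovarieties, hence the first conjunct.\<close>

definition is_local :: "nat sgrp set \<Rightarrow> bool" where
  "is_local V \<longleftrightarrow> semigroup_pseudovariety V \<and> g_pv V = l_pv V"

end

theory Submission
  imports Defs "HOL-Library.Ramsey"
begin

text \<open>
  Let \<open>V\<close> be the pseudovariety \<open>DH H \<inter> ECom\<close>. A finite semigroup belongs to \<open>V\<close> iff its idempotents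
  commute, each of its regular elements lies in a subgroup, and its maximal subgroups are
  isomorphic to members of \<open>H\<close> (\<open>DH_ECom_iff\<close>). This description makes sense over every type and is
  what the proof works with. One inclusion is formal: the finite semigroupoids whose local
  semigroups lie in \<open>V\<close> form a pseudovariety that contains the one-vertex semigroupoids of \<open>V\<close>.

  For the other one, let \<open>S\<close> be a finite semigroupoid with all local semigroups in \<open>V\<close>, and adjoin
  local identities, so that \<open>S\<close> becomes a category. It is enough to find a semigroup \<open>T\<close> in \<open>V\<close> and
  to send each arrow to an element of \<open>T\<close> in such a way that coterminal paths with the same image
  in \<open>T\<close> have the same value in \<open>S\<close>: the pairs formed by the value of a path and its image in \<open>T\<close> are
  then the edges of a semigroupoid that witnesses that \<open>S\<close> divides \<open>T\<close>.

  The semigroup \<open>T\<close> is a product of semigroups of upper triangular matrices with at most one nonzero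
  entry in each row and column, all of these entries taken from a group. They lie in \<open>V\<close>, since
  they are partial injections decorated with group elements, so that idempotents commute, and
  triangularity forces the regular ones to be diagonal (\<open>dh_ecom_monomial\<close>). A chain
  \<open>B\<^sub>0\<^sup>* a\<^sub>1 B\<^sub>1\<^sup>* \<dots> a\<^sub>n B\<^sub>n\<^sup>*\<close> with \<open>a\<^sub>i \<notin> B\<^sub>i\<^sub>-\<^sub>1 \<union> B\<^sub>i\<close> is an automaton whose transitions are such matrices,
  and one of its blocks can be made to record an element of a group (\<open>run_readings\<close>).

  Why do these automata separate paths with different values? The content of an idempotent \<open>e\<close>
  consists of the arrows \<open>x\<close> with \<open>e = p x q\<close>. On it, multiplication by the idempotents in the
  J-class of \<open>e\<close> is a functor to the maximal subgroup at \<open>e\<close>, and an arrow that is fixed by these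
  idempotents is determined by its ends and its label in the group
  (\<open>unit_label_mult\<close>, \<open>unit_label_recover\<close>). Cut a path into regular blocks and
  single letters, with as few letters as possible. Products of regular arrows are regular since
  idempotents commute, and a regular arrow absorbs the letters of its content; hence no letter lies
  in the contents of the blocks next to it, and the contents form a chain as above. Its length is bounded by a
  Ramsey argument, as a long product contains an idempotent factor (\<open>short_factorization\<close>).

  Now let \<open>z\<close> and \<open>w\<close> be coterminal paths that no bounded chain separates. The chain of \<open>z\<close> also reads
  \<open>w\<close>, and it cuts \<open>w\<close> into blocks \<open>w\<^sub>i\<close> that are again indistinguishable from the blocks \<open>z\<^sub>i\<close> by chains
  that are not too long, because a chain can be inserted into another one in place of a block.
  Let \<open>e\<close> be an idempotent in the R-class of \<open>z\<^sub>i\<close>. If \<open>e\<close> fixes the value of \<open>w\<^sub>i\<close>, then \<open>z\<^sub>i\<close> and \<open>w\<^sub>i\<close>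
  agree because their labels agree. Otherwise the blocks of \<open>w\<^sub>i\<close> have contents strictly inside
  the content of \<open>e\<close>, and induction on the size of the contents applies to \<open>w\<^sub>i\<close> and \<open>z\<^sub>i\<close>, in exchanged
  roles (\<open>regular_block_transfer\<close>, \<open>chain_equiv_separates\<close>).
\<close>

section \<open>Idempotents in long products\<close>

text \<open>The form of Ramsey's theorem that produces idempotents: if \<open>f i j\<close> is the product of the
  factors from \<open>i\<close> to \<open>j\<close> of a long product, then a monochromatic triangle gives \<open>x = x x\<close>.\<close>
lemma Ramsey_triple:
  assumes "finite X"
  shows "\<exists>N::nat. \<forall>f. (\<forall>i j. i < j \<and> j < N \<longrightarrow> f i j \<in> X) \<longrightarrow>
     (\<exists>i j k. i < j \<and> j < k \<and> k < N \<and> f i j = f j k \<and> f i k = f j k)"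
proof -
  obtain c :: "'a \<Rightarrow> nat" and m where c: "inj_on c X" "c ` X = {..<m}"
    using finite_imp_inj_to_nat_seg[OF assms] by (auto simp: lessThan_def)
  obtain N :: nat where N: "partn_lst {..<N} (replicate m 3) 2"
    using ramsey_full[of "replicate m 3" 2] by blast
  have "\<exists>i j k. i < j \<and> j < k \<and> k < N \<and> f i j = f j k \<and> f i k = f j k"
    if f: "\<forall>i j. i < j \<and> j < N \<longrightarrow> f i j \<in> X" for f
  proof -
    let ?g = "\<lambda>P. c (f (Min P) (Max P))"
    have g: "?g {i, j} = c (f i j)" if "i < j" for i j
      using that by simp
    have "?g \<in> [{..<N}]\<^bsup>2\<^esup> \<rightarrow> {..<m}"
    proof
      fix P assume "P \<in> [{..<N}]\<^bsup>2\<^esup>"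
      then obtain a b where ab: "P = {a, b}" "a < N" "b < N" "a \<noteq> b"
        by (auto elim: nsets2_E)
      then obtain i j where "P = {i, j}" "j < N" "i < j"
        by (metis insert_commute linorder_neqE_nat)
      then show "?g P \<in> {..<m}"
        using f g[of i j] c(2) by auto
    qed
    then obtain r where r: "r < m" "monochromatic {..<N} (replicate m 3 ! r) 2 ?g r"
      using N by (auto simp: partn_lst_def)
    then have "monochromatic {..<N} 3 2 ?g r" by simp
    then obtain Y where Y: "Y \<in> [{..<N}]\<^bsup>3\<^esup>" "?g ` ([Y]\<^bsup>2\<^esup>) \<subseteq> {r}"
      unfolding monochromatic_def by blast
    from Y(1) have Yc: "Y \<subseteq> {..<N}" "finite Y" "card Y = 3"
      by (auto simp: nsets_def)
    define l where "l = sorted_list_of_set Y"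
    have l: "length l = 3" "strict_sorted l" "set l = Y"
      using Yc by (auto simp: l_def)
    then obtain i j k where ijk: "l = [i, j, k]"
      by (metis (no_types, lifting) length_0_conv length_Suc_conv numeral_3_eq_3)
    then have lt: "i < j" "j < k" and Ye: "Y = {i, j, k}" using l by auto
    have k: "k < N" using Ye Yc by auto
    have "c (f i j) = r" "c (f j k) = r" "c (f i k) = r"
    proof -
      have *: "c (f a b) = r" if "a < b" "a \<in> Y" "b \<in> Y" for a b
      proof -
        have "{a, b} \<in> [Y]\<^bsup>2\<^esup>" using that by simp
        then show ?thesis using Y(2) g[OF that(1)] by (metis image_subset_iff singletonD)
      qed
      show "c (f i j) = r" "c (f j k) = r" "c (f i k) = r"
        using * lt less_trans[OF lt] Ye by auto
    qed
    then have "f i j = f j k" "f i k = f j k"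
      using c(1) f lt k by (metis inj_on_eq_iff less_trans)+
    then show ?thesis using lt k by blast
  qed
  then show ?thesis by blast
qed

section \<open>Finite categories with local monoids in the pseudovariety\<close>

text \<open>A finite category given by its hom-sets. Composition is extended to a total associative
  operation; adjoining a zero for the missing products always makes this possible, and it removes
  all side conditions from calculations. The last two assumptions are what the proof uses of the
  local monoids. If, moreover, the regular elements of these lie in subgroups, then J-equivalent
  idempotents are equal; \<open>idem_uniq\<close> says this for the idempotents \<open>a b\<close> and \<open>b a\<close>.\<close>
locale local_category =
  fixes V :: "'v set" and Hm :: "'v \<Rightarrow> 'v \<Rightarrow> 'a set"
    and mul :: "'a \<Rightarrow> 'a \<Rightarrow> 'a"  (infixl "\<cdot>" 70)
    and one :: "'v \<Rightarrow> 'a"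
  assumes assoc: "(x \<cdot> y) \<cdot> z = x \<cdot> (y \<cdot> z)"
    and comp: "x \<in> Hm u v \<Longrightarrow> y \<in> Hm v w \<Longrightarrow> x \<cdot> y \<in> Hm u w"
    and disj: "x \<in> Hm u v \<Longrightarrow> x \<in> Hm u' v' \<Longrightarrow> u' = u \<and> v' = v"
    and hom_V: "x \<in> Hm u v \<Longrightarrow> u \<in> V \<and> v \<in> V"
    and one_in: "u \<in> V \<Longrightarrow> one u \<in> Hm u u"
    and one_l: "x \<in> Hm u v \<Longrightarrow> one u \<cdot> x = x"
    and one_r: "x \<in> Hm u v \<Longrightarrow> x \<cdot> one v = x"
    and fin: "finite (\<Union>u\<in>V. \<Union>v\<in>V. Hm u v)"
    and idem_comm: "e \<in> Hm u u \<Longrightarrow> f \<in> Hm u u \<Longrightarrow> e \<cdot> e = e \<Longrightarrow> f \<cdot> f = f \<Longrightarrow> e \<cdot> f = f \<cdot> e"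
    and idem_uniq: "a \<in> Hm u u \<Longrightarrow> b \<in> Hm u u \<Longrightarrow> (a \<cdot> b) \<cdot> (a \<cdot> b) = a \<cdot> b \<Longrightarrow>
       (b \<cdot> a) \<cdot> (b \<cdot> a) = b \<cdot> a \<Longrightarrow> a \<cdot> b = b \<cdot> a"
begin

definition Arr :: "'a set" where "Arr = (\<Union>u\<in>V. \<Union>v\<in>V. Hm u v)"

lemma finite_Arr: "finite Arr" using fin by (simp add: Arr_def)

lemma in_Arr: "x \<in> Arr \<longleftrightarrow> (\<exists>u v. x \<in> Hm u v)"
  unfolding Arr_def using hom_V by blast

definition idem :: "'v \<Rightarrow> 'a \<Rightarrow> bool" where "idem v e \<longleftrightarrow> e \<in> Hm v v \<and> e \<cdot> e = e"

text \<open>The set of all arrows above \<open>x\<close> in the J-order.\<close>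
definition content :: "'a \<Rightarrow> 'a set" where
  "content x = {y. \<exists>u v s t p q. y \<in> Hm s t \<and> p \<in> Hm u s \<and> q \<in> Hm t v \<and> p \<cdot> (y \<cdot> q) = x}"

text \<open>A factorization \<open>e = r l\<close> of the idempotent \<open>e\<close> through another vertex \<open>u\<close>. Then \<open>l r\<close> is
  the idempotent at \<open>u\<close> in the J-class of \<open>e\<close>.\<close>
definition splitting :: "'v \<Rightarrow> 'a \<Rightarrow> 'v \<Rightarrow> 'a \<Rightarrow> 'a \<Rightarrow> bool" where
  "splitting v e u r l \<longleftrightarrow> r \<in> Hm v u \<and> l \<in> Hm u v \<and> r \<cdot> l = e \<and> e \<cdot> r = r \<and> l \<cdot> e = l"

definition out_arrow :: "'v \<Rightarrow> 'a \<Rightarrow> 'v \<Rightarrow> 'a" where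
  "out_arrow v e u = (SOME r. \<exists>l. splitting v e u r l)"
definition in_arrow :: "'v \<Rightarrow> 'a \<Rightarrow> 'v \<Rightarrow> 'a" where
  "in_arrow v e u = (SOME l. splitting v e u (out_arrow v e u) l)"
definition local_idem :: "'v \<Rightarrow> 'a \<Rightarrow> 'v \<Rightarrow> 'a" where
  "local_idem v e u = in_arrow v e u \<cdot> out_arrow v e u"
text \<open>The arrow \<open>x\<close> is transported to a loop at \<open>v\<close> along the chosen splittings at its ends.\<close>
definition unit_label :: "'v \<Rightarrow> 'a \<Rightarrow> 'v \<Rightarrow> 'v \<Rightarrow> 'a \<Rightarrow> 'a" where
  "unit_label v e s t x = out_arrow v e s \<cdot> (x \<cdot> in_arrow v e t)"

lemma content_Arr: "content x \<subseteq> Arr"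
proof
  fix y assume "y \<in> content x"
  then show "y \<in> Arr" unfolding content_def in_Arr by blast
qed

lemma contentI: "\<lbrakk>p \<in> Hm u s; y \<in> Hm s t; q \<in> Hm t v; p \<cdot> (y \<cdot> q) = x\<rbrakk> \<Longrightarrow> y \<in> content x"
  unfolding content_def by blast

lemma content_self: assumes "x \<in> Hm u v" shows "x \<in> content x"
proof (rule contentI)
  show "one u \<in> Hm u u" "one v \<in> Hm v v" using assms hom_V one_in by blast+
  show "one u \<cdot> (x \<cdot> one v) = x" using assms one_l one_r by simp
qed (rule assms)

lemma content_trans: assumes "x \<in> content y" "y \<in> content z" shows "x \<in> content z"
proof -
  obtain u v s t p q where 1: "x \<in> Hm s t" "p \<in> Hm u s" "q \<in> Hm t v" "p \<cdot> (x \<cdot> q) = y"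
    using assms(1) unfolding content_def by blast
  obtain u' v' s' t' p' q' where 2: "y \<in> Hm s' t'" "p' \<in> Hm u' s'" "q' \<in> Hm t' v'" "p' \<cdot> (y \<cdot> q') = z"
    using assms(2) unfolding content_def by blast
  have "y \<in> Hm u v" using 1 comp by meson
  then have e: "s' = u" "t' = v" using disj 2(1) by auto
  have "p' \<cdot> p \<in> Hm u' s" "q \<cdot> q' \<in> Hm t v'" using 1 2 e comp by auto
  moreover have "(p' \<cdot> p) \<cdot> (x \<cdot> (q \<cdot> q')) = z" using 1(4) 2(4) by (metis assoc)
  ultimately show ?thesis unfolding content_def using 1(1) by blast
qed

lemma content_factors:
  assumes "x \<in> Hm u v" "y \<in> Hm v w"
  shows "x \<in> content (x \<cdot> y)" "y \<in> content (x \<cdot> y)"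
proof -
  have o: "one u \<in> Hm u u" "one w \<in> Hm w w" using assms hom_V one_in by blast+
  have "one u \<cdot> (x \<cdot> y) = x \<cdot> y" "x \<cdot> (y \<cdot> one w) = x \<cdot> y"
    using one_l[OF comp[OF assms]] one_r[OF assms(2)] by simp_all
  then show "x \<in> content (x \<cdot> y)" "y \<in> content (x \<cdot> y)"
    using contentI[OF o(1) assms] contentI[OF assms o(2)] by simp_all
qed

lemma splittingI_content:
  assumes e: "idem v e" and x: "x \<in> Hm s t" "x \<in> content e"
  obtains p q where "p \<in> Hm v s" "q \<in> Hm t v" "p \<cdot> (x \<cdot> q) = e" "e \<cdot> p = p" "q \<cdot> e = q"
    "splitting v e s p (x \<cdot> q)" "splitting v e t (p \<cdot> x) q"
proof -
  obtain u' v' s' t' p q where 1: "x \<in> Hm s' t'" "p \<in> Hm u' s'" "q \<in> Hm t' v'" "p \<cdot> (x \<cdot> q) = e"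
    using x(2) unfolding content_def by blast
  have eq: "s' = s" "t' = t" using 1(1) x(1) disj by auto
  have "e \<in> Hm u' v'" using 1 comp by meson
  then have eq': "u' = v" "v' = v" using e disj unfolding idem_def by blast+
  have ee: "e \<cdot> e = e" "e \<in> Hm v v" using e by (auto simp: idem_def)
  have a: "e \<cdot> p \<in> Hm v s" "q \<cdot> e \<in> Hm t v" using 1 eq eq' ee comp by auto
  have b: "(e \<cdot> p) \<cdot> (x \<cdot> (q \<cdot> e)) = e" using 1(4) ee by (metis assoc)
  have c: "e \<cdot> (e \<cdot> p) = e \<cdot> p" "(q \<cdot> e) \<cdot> e = q \<cdot> e" using ee by (metis assoc)+
  have d: "splitting v e s (e \<cdot> p) (x \<cdot> (q \<cdot> e))" "splitting v e t ((e \<cdot> p) \<cdot> x) (q \<cdot> e)"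
    unfolding splitting_def using a b c x(1) comp assoc by (metis (no_types, lifting))+
  show ?thesis by (rule that[OF a b c d])
qed

lemma splitting_idem: assumes "splitting v e u r l" shows "(l \<cdot> r) \<cdot> (l \<cdot> r) = l \<cdot> r" "l \<cdot> r \<in> Hm u u" "idem v e"
proof -
  show "(l \<cdot> r) \<cdot> (l \<cdot> r) = l \<cdot> r" using assms unfolding splitting_def by (metis assoc)
  show "l \<cdot> r \<in> Hm u u" using assms comp unfolding splitting_def by blast
  show "idem v e" using assms comp unfolding splitting_def idem_def by (metis assoc)
qed

text \<open>Each vertex carries at most one idempotent of a given J-class: \<open>l r\<close> and \<open>l' r'\<close> are the two
  products of the loops \<open>l r'\<close> and \<open>l' r\<close>. This makes \<open>local_idem\<close> independent of all choices.\<close>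
lemma splitting_unique:
  assumes a: "splitting v e u r l" and b: "splitting v e u r' l'"
  shows "l \<cdot> r = l' \<cdot> r'"
proof -
  have h: "l \<cdot> r' \<in> Hm u u" "l' \<cdot> r \<in> Hm u u" using a b comp unfolding splitting_def by blast+
  have e1: "(l \<cdot> r') \<cdot> (l' \<cdot> r) = l \<cdot> r" using a b unfolding splitting_def by (metis assoc)
  have e2: "(l' \<cdot> r) \<cdot> (l \<cdot> r') = l' \<cdot> r'" using a b unfolding splitting_def by (metis assoc)
  show ?thesis using idem_uniq[OF h] e1 e2 splitting_idem(1)[OF a] splitting_idem(1)[OF b] by simp
qed

lemma splitting_chosen: assumes "splitting v e u r l" shows "splitting v e u (out_arrow v e u) (in_arrow v e u)"
proof -
  have "\<exists>l. splitting v e u (out_arrow v e u) l" unfolding out_arrow_def by (rule someI[where x=r]) (use assms in blast)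
  then show ?thesis unfolding in_arrow_def by (rule someI_ex)
qed

lemma local_idem_splitting: assumes "splitting v e u r l" shows "local_idem v e u = l \<cdot> r"
  unfolding local_idem_def using splitting_unique[OF splitting_chosen[OF assms] assms] .

lemma local_idem_self: assumes "idem v e" shows "local_idem v e v = e"
  using local_idem_splitting[of v e v e e] assms by (auto simp: splitting_def idem_def)

text \<open>If \<open>e = p x q\<close>, then both sides of the claim are equal to \<open>x q p x\<close>, as \<open>e\<close> splits as
  \<open>p (x q)\<close> and as \<open>(p x) q\<close>. This is the crucial consequence of the uniqueness of idempotents: the
  idempotents in the J-class of \<open>e\<close> are central in its content.\<close>
lemma local_idem_comm:
  assumes e: "idem v e" and x: "x \<in> Hm s t" "x \<in> content e"
  shows "local_idem v e s \<cdot> x = x \<cdot> local_idem v e t"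
proof -
  obtain p q where *: "splitting v e s p (x \<cdot> q)" "splitting v e t (p \<cdot> x) q"
    using splittingI_content[OF e x] by metis
  show ?thesis unfolding local_idem_splitting[OF *(1)] local_idem_splitting[OF *(2)] by (simp add: assoc)
qed

lemma splitting_content:
  assumes "idem v e" "x \<in> Hm s t" "x \<in> content e"
  shows "splitting v e s (out_arrow v e s) (in_arrow v e s)" "splitting v e t (out_arrow v e t) (in_arrow v e t)"
  by (rule splittingI_content[OF assms], rule splitting_chosen, assumption)+

definition units_at :: "'v \<Rightarrow> 'a \<Rightarrow> 'a set" where
  "units_at v e = {x \<in> Hm v v. e \<cdot> x = x \<and> x \<cdot> e = x \<and> (\<exists>y\<in>Hm v v. e \<cdot> y = y \<and> y \<cdot> e = y \<and> x \<cdot> y = e \<and> y \<cdot> x = e)}"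

text \<open>With \<open>e = p x q\<close>, the loop \<open>r' q p l\<close> is an inverse of the label \<open>r x l'\<close>.\<close>
lemma unit_label_unit:
  assumes e: "idem v e" and x: "x \<in> Hm s t" "x \<in> content e"
  shows "unit_label v e s t x \<in> units_at v e"
proof -
  obtain p q where pq: "p \<in> Hm v s" "q \<in> Hm t v" "p \<cdot> (x \<cdot> q) = e" "e \<cdot> p = p" "q \<cdot> e = q"
    and sp: "splitting v e s p (x \<cdot> q)" "splitting v e t (p \<cdot> x) q"
    using splittingI_content[OF e x] by metis
  define r l r' l' where d: "r = out_arrow v e s" "l = in_arrow v e s" "r' = out_arrow v e t" "l' = in_arrow v e t"
  have s1: "splitting v e s r l" "splitting v e t r' l'" using sp splitting_chosen d by auto
  have f1: "l \<cdot> r = x \<cdot> q \<cdot> p" using splitting_unique[OF s1(1) sp(1)] by simp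
  have f2: "l' \<cdot> r' = q \<cdot> (p \<cdot> x)" using splitting_unique[OF s1(2) sp(2)] by simp
  have rl: "r \<cdot> l = e" "r' \<cdot> l' = e" "e \<cdot> r = r" "l \<cdot> e = l" "e \<cdot> r' = r'" "l' \<cdot> e = l'"
    and hm: "r \<in> Hm v s" "l \<in> Hm s v" "r' \<in> Hm v t" "l' \<in> Hm t v"
    using s1 unfolding splitting_def by auto
  define g y where g: "g = r \<cdot> (x \<cdot> l')" and y: "y = r' \<cdot> (q \<cdot> (p \<cdot> l))"
  have gh: "g \<in> Hm v v" "y \<in> Hm v v" unfolding g y using hm pq(1,2) x(1) comp by meson+
  have ge: "e \<cdot> g = g" "g \<cdot> e = g" "e \<cdot> y = y" "y \<cdot> e = y"
    unfolding g y using rl by (metis assoc)+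
  have "g \<cdot> y = r \<cdot> x \<cdot> (l' \<cdot> r') \<cdot> q \<cdot> p \<cdot> l" unfolding g y by (simp add: assoc)
  also have "\<dots> = r \<cdot> (x \<cdot> q \<cdot> p) \<cdot> (x \<cdot> q \<cdot> p) \<cdot> l" unfolding f2 by (simp add: assoc)
  also have "\<dots> = (r \<cdot> l) \<cdot> (r \<cdot> l) \<cdot> (r \<cdot> l)" unfolding f1[symmetric] by (simp add: assoc)
  also have "\<dots> = e" using rl e unfolding idem_def by simp
  finally have gy: "g \<cdot> y = e" .
  have "y \<cdot> g = r' \<cdot> q \<cdot> p \<cdot> (l \<cdot> r) \<cdot> x \<cdot> l'" unfolding g y by (simp add: assoc)
  also have "\<dots> = r' \<cdot> (q \<cdot> (p \<cdot> x)) \<cdot> (q \<cdot> (p \<cdot> x)) \<cdot> l'" unfolding f1 by (simp add: assoc)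
  also have "\<dots> = (r' \<cdot> l') \<cdot> (r' \<cdot> l') \<cdot> (r' \<cdot> l')" unfolding f2[symmetric] by (simp add: assoc)
  also have "\<dots> = e" using rl e unfolding idem_def by simp
  finally have "y \<cdot> g = e" .
  then show ?thesis using gh ge gy unfolding units_at_def unit_label_def d[symmetric] g[symmetric] by blast
qed

text \<open>The factor \<open>l r\<close> in the middle of the product of two labels is a local idempotent. It can be
  moved to the left across \<open>x\<close>, where it is absorbed.\<close>
lemma unit_label_mult:
  assumes e: "idem v e" and x: "x \<in> Hm s t" "x \<in> content e" and y: "y \<in> Hm t w" "y \<in> content e"
  shows "unit_label v e s w (x \<cdot> y) = unit_label v e s t x \<cdot> unit_label v e t w y"
proof -
  have s1: "splitting v e s (out_arrow v e s) (in_arrow v e s)"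
    using splitting_content[OF e x] by blast
  have "unit_label v e s t x \<cdot> unit_label v e t w y = out_arrow v e s \<cdot> (x \<cdot> local_idem v e t) \<cdot> (y \<cdot> in_arrow v e w)"
    unfolding unit_label_def local_idem_def by (simp add: assoc)
  also have "\<dots> = (out_arrow v e s \<cdot> in_arrow v e s) \<cdot> out_arrow v e s \<cdot> x \<cdot> (y \<cdot> in_arrow v e w)"
    unfolding local_idem_comm[OF e x, symmetric] unfolding local_idem_def by (simp add: assoc)
  also have "\<dots> = out_arrow v e s \<cdot> x \<cdot> (y \<cdot> in_arrow v e w)" using s1 unfolding splitting_def by simp
  finally show ?thesis unfolding unit_label_def by (simp add: assoc)
qed

lemma unit_mult:
  assumes "idem v e" "g \<in> units_at v e" "h \<in> units_at v e" shows "g \<cdot> h \<in> units_at v e"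
proof -
  obtain y where y: "y\<in>Hm v v" "e \<cdot> y = y" "y \<cdot> e = y" "g \<cdot> y = e" "y \<cdot> g = e"
     and g: "g \<in> Hm v v" "e \<cdot> g = g" "g \<cdot> e = g" using assms unfolding units_at_def by blast
  obtain z where z: "z\<in>Hm v v" "e \<cdot> z = z" "z \<cdot> e = z" "h \<cdot> z = e" "z \<cdot> h = e"
     and h: "h \<in> Hm v v" "e \<cdot> h = h" "h \<cdot> e = h" using assms unfolding units_at_def by blast
  have "(g \<cdot> h) \<cdot> (z \<cdot> y) = e" using y z g h by (metis assoc)
  moreover have "(z \<cdot> y) \<cdot> (g \<cdot> h) = e" using y z g h by (metis assoc)
  moreover have "g \<cdot> h \<in> Hm v v" "z \<cdot> y \<in> Hm v v" using g h y z comp by auto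
  moreover have "e \<cdot> (g \<cdot> h) = g \<cdot> h" "g \<cdot> h \<cdot> e = g \<cdot> h" "e \<cdot> (z \<cdot> y) = z \<cdot> y" "z \<cdot> y \<cdot> e = z \<cdot> y"
    using y z g h by (metis assoc)+
  ultimately show ?thesis unfolding units_at_def by blast
qed

text \<open>This closure property is special to semigroups whose regular elements lie in subgroups. It
  holds since the label of \<open>x y\<close> is invertible.\<close>
lemma content_mult:
  assumes e: "idem v e" and x: "x \<in> Hm s t" "x \<in> content e" and y: "y \<in> Hm t w" "y \<in> content e"
  shows "x \<cdot> y \<in> content e"
proof -
  have "unit_label v e s w (x \<cdot> y) \<in> units_at v e"
    using unit_label_mult[OF assms] unit_mult[OF e unit_label_unit[OF e x] unit_label_unit[OF e y]] by simp
  then obtain g where g: "g \<in> Hm v v" "unit_label v e s w (x \<cdot> y) \<cdot> g = e"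
    unfolding units_at_def by blast
  have s1: "out_arrow v e s \<in> Hm v s" "in_arrow v e w \<in> Hm w v"
    using splitting_content[OF e x] splitting_content[OF e y] unfolding splitting_def by blast+
  have "out_arrow v e s \<cdot> ((x \<cdot> y) \<cdot> (in_arrow v e w \<cdot> g)) = e" using g(2) unfolding unit_label_def by (simp add: assoc)
  then show ?thesis by (rule contentI[OF s1(1) comp[OF x(1) y(1)] comp[OF s1(2) g(1)]])
qed

text \<open>On the J-class of \<open>e\<close> the labelling is faithful.\<close>
lemma unit_label_recover:
  assumes e: "idem v e" and x: "x \<in> Hm s t" "x \<in> content e" and f: "local_idem v e s \<cdot> x = x"
  shows "x = in_arrow v e s \<cdot> unit_label v e s t x \<cdot> out_arrow v e t"
proof -
  have "in_arrow v e s \<cdot> unit_label v e s t x \<cdot> out_arrow v e t = local_idem v e s \<cdot> x \<cdot> local_idem v e t"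
    unfolding unit_label_def local_idem_def by (simp add: assoc)
  also have "\<dots> = x" using f local_idem_comm[OF e x] by simp
  finally show ?thesis by simp
qed

definition regular :: "'v \<Rightarrow> 'v \<Rightarrow> 'a \<Rightarrow> bool" where
  "regular u v x \<longleftrightarrow> x \<in> Hm u v \<and> (\<exists>y\<in>Hm v u. x \<cdot> (y \<cdot> x) = x)"

text \<open>If \<open>x'\<close> and \<open>y'\<close> are inverses of \<open>x\<close> and \<open>y\<close>, then \<open>x' x\<close> and \<open>y y'\<close> are idempotents at the
  same vertex, and \<open>y' x'\<close> is an inverse of \<open>x y\<close> because they commute.\<close>
lemma regular_mult: assumes "regular u v x" "regular v w y" shows "regular u w (x \<cdot> y)"
proof -
  obtain x' where x: "x \<in> Hm u v" "x' \<in> Hm v u" "x \<cdot> (x' \<cdot> x) = x" using assms unfolding regular_def by blast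
  obtain y' where y: "y \<in> Hm v w" "y' \<in> Hm w v" "y \<cdot> (y' \<cdot> y) = y" using assms unfolding regular_def by blast
  have "(x' \<cdot> x) \<cdot> (x' \<cdot> x) = x' \<cdot> x" "(y \<cdot> y') \<cdot> (y \<cdot> y') = y \<cdot> y'"
    using x(3) y(3) by (metis assoc)+
  moreover have "x' \<cdot> x \<in> Hm v v" "y \<cdot> y' \<in> Hm v v" using x y comp by auto
  ultimately have "(x' \<cdot> x) \<cdot> (y \<cdot> y') = (y \<cdot> y') \<cdot> (x' \<cdot> x)"
    using idem_comm by blast
  then have "(x \<cdot> y) \<cdot> ((y' \<cdot> x') \<cdot> (x \<cdot> y)) = x \<cdot> ((x' \<cdot> x) \<cdot> (y \<cdot> y')) \<cdot> y"
    by (metis assoc)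
  also have "\<dots> = (x \<cdot> (x' \<cdot> x)) \<cdot> (y \<cdot> (y' \<cdot> y))" by (simp add: assoc)
  finally have "(x \<cdot> y) \<cdot> ((y' \<cdot> x') \<cdot> (x \<cdot> y)) = x \<cdot> y" using x y by simp
  then show ?thesis unfolding regular_def using x y comp by blast
qed

lemma regular_idem: "idem v e \<Longrightarrow> regular v v e" unfolding idem_def regular_def by metis

lemma regular_one: "v \<in> V \<Longrightarrow> regular v v (one v)"
  using one_in one_l regular_idem unfolding idem_def by blast

text \<open>The idempotent \<open>e\<close> lies in the R-class of \<open>x\<close> and serves as the base point from which
  regular blocks with value \<open>x\<close> are labelled.\<close>
lemma regular_obtain: assumes "regular u v x"
  obtains e y where "idem u e" "y \<in> Hm v u" "x \<cdot> y = e" "e \<cdot> x = x" "x \<in> content e" "content e = content x"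
proof -
  obtain y where x: "x \<in> Hm u v" "y \<in> Hm v u" "x \<cdot> (y \<cdot> x) = x" using assms unfolding regular_def by blast
  have i: "idem u (x \<cdot> y)" unfolding idem_def using x comp by (metis assoc)
  have c: "x \<in> content (x \<cdot> y)" using content_factors x by blast
  have "x \<cdot> y \<in> content x" using content_factors(1)[of "x \<cdot> y" u u x v] x comp i unfolding idem_def by (simp add: assoc)
  then have "content (x \<cdot> y) = content x" using c content_trans by blast
  then show ?thesis using that[OF i x(2) refl _ c] x by (simp add: assoc)
qed

text \<open>Equality of contents is J-equivalence here, and J-equivalent idempotents at one vertex are
  equal.\<close>
lemma idem_content_eq: assumes "idem u e" "idem u f" "content e = content f" shows "e = f"
proof -
  have *: "g \<cdot> h = g" if g: "idem u g" and h: "idem u h" and c: "content g = content h" for g h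
  proof -
    have hc: "h \<in> Hm u u" "h \<in> content g" using h c content_self unfolding idem_def by auto
    have hh: "g \<in> Hm u u" "g \<cdot> g = g" "h \<cdot> h = h" using g h unfolding idem_def by auto
    have com: "g \<cdot> h = h \<cdot> g" using idem_comm hc hh by blast
    obtain p q where pq: "p \<in> Hm u u" "q \<in> Hm u u" "p \<cdot> (h \<cdot> q) = g" "g \<cdot> p = p" "q \<cdot> g = q"
      and s: "splitting u g u p (h \<cdot> q)" using splittingI_content[OF g hc] by metis
    have "g = (h \<cdot> q) \<cdot> p" using local_idem_splitting[OF s] local_idem_self[OF g] by simp
    then have "h \<cdot> g = g" using hh by (metis assoc)
    then show ?thesis using com by simp
  qed
  have "e \<cdot> f = e" "f \<cdot> e = f" using * assms by auto
  moreover have "e \<cdot> f = f \<cdot> e" using assms idem_comm unfolding idem_def by blast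
  ultimately show ?thesis by simp
qed

text \<open>The arrow \<open>x a\<close> is again in the content of the idempotent \<open>e\<close> in the R-class of \<open>x\<close>, say
  \<open>e = p x a q\<close>. The idempotent of this J-class at the source of \<open>x\<close> is unique, so \<open>x a q p = e\<close>.\<close>
lemma regular_absorb_right: assumes x: "regular u v x" and a: "a \<in> Hm v w" "a \<in> content x"
  shows "regular u w (x \<cdot> a)"
proof -
  obtain e y where e: "idem u e" "y \<in> Hm v u" "x \<cdot> y = e" "e \<cdot> x = x" "x \<in> content e" "content e = content x"
    using regular_obtain[OF x] by metis
  have xh: "x \<in> Hm u v" using x unfolding regular_def by blast
  have xa: "x \<cdot> a \<in> content e" "x \<cdot> a \<in> Hm u w" using content_mult[OF e(1) xh e(5) a(1)] a(2) e(6) xh a(1) comp by auto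
  obtain p q where pq: "p \<in> Hm u u" "q \<in> Hm w u" "p \<cdot> ((x \<cdot> a) \<cdot> q) = e"
    and s: "splitting u e u p ((x \<cdot> a) \<cdot> q)"
    using splittingI_content[OF e(1) xa(2,1)] by metis
  have "((x \<cdot> a) \<cdot> q) \<cdot> p = e" using local_idem_splitting[OF s] local_idem_self[OF e(1)] by simp
  then have "(x \<cdot> a) \<cdot> ((q \<cdot> p) \<cdot> (x \<cdot> a)) = x \<cdot> a" using e(4) by (metis assoc)
  then show ?thesis unfolding regular_def using xa(2) pq comp by blast
qed

lemma regular_absorb_left: assumes x: "regular u v x" and a: "a \<in> Hm w u" "a \<in> content x"
  shows "regular w v (a \<cdot> x)"
proof -
  obtain e y where e: "idem u e" "y \<in> Hm v u" "x \<cdot> y = e" "e \<cdot> x = x" "x \<in> content e" "content e = content x"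
    using regular_obtain[OF x] by metis
  have ac: "a \<in> content e" using a e by simp
  obtain p q where pq: "p \<in> Hm u w" "q \<in> Hm u u" "p \<cdot> (a \<cdot> q) = e"
    and s: "splitting u e u (p \<cdot> a) q" "e \<cdot> p = p" "q \<cdot> e = q"
    using splittingI_content[OF e(1) a(1) ac] by metis
  have f: "q \<cdot> (p \<cdot> a) = e" using local_idem_splitting[OF s(1)] local_idem_self[OF e(1)] by simp
  have "(a \<cdot> x) \<cdot> ((y \<cdot> (q \<cdot> p)) \<cdot> (a \<cdot> x)) = a \<cdot> ((x \<cdot> y) \<cdot> ((q \<cdot> (p \<cdot> a)) \<cdot> x))" by (simp add: assoc)
  also have "\<dots> = a \<cdot> x" using e f by simp
  finally show ?thesis unfolding regular_def using x a pq e(2) comp unfolding regular_def by blast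
qed

end

section \<open>Chains and the words that they read\<close>

text \<open>A chain is split at one of its blocks \<open>B\<close> into the parts on its left and on its right, both
  listed from the middle outwards. With \<open>L = [(a\<^sub>l, B\<^sub>l), \<dots>, (a\<^sub>1, B\<^sub>1)]\<close> and
  \<open>R = [(a'\<^sub>1, B'\<^sub>1), \<dots>]\<close> the chain is \<open>B\<^sub>1\<^sup>* a\<^sub>1 \<dots> B\<^sub>l\<^sup>* a\<^sub>l B\<^sup>* a'\<^sub>1 B'\<^sub>1\<^sup>* \<dots>\<close>. This makes the
  condition \<open>separated\<close> the same on both sides.\<close>
fun left_words :: "('a \<times> 'a set) list \<Rightarrow> 'a list set" where
  "left_words [] = {[]}"
| "left_words ((a, B) # L) = {x @ u @ [a] | x u. x \<in> left_words L \<and> set u \<subseteq> B}"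

fun right_words :: "('a \<times> 'a set) list \<Rightarrow> 'a list set" where
  "right_words [] = {[]}"
| "right_words ((a, B) # R) = {a # u @ y | u y. set u \<subseteq> B \<and> y \<in> right_words R}"

fun separated :: "'a set \<Rightarrow> ('a \<times> 'a set) list \<Rightarrow> bool" where
  "separated B [] \<longleftrightarrow> True"
| "separated B ((a, B') # R) \<longleftrightarrow> a \<notin> B \<and> a \<notin> B' \<and> separated B' R"

text \<open>Separated chains are deterministic, so there is at most one reading; collecting the readings
  in a set also covers the words that the chain does not read.\<close>
definition readings :: "('a list \<Rightarrow> 'b) \<Rightarrow> ('a \<times> 'a set) list \<Rightarrow> 'a set \<Rightarrow> ('a \<times> 'a set) list \<Rightarrow> 'a list \<Rightarrow> 'b set" where
  "readings \<phi> L B R w = {\<phi> m | x m y. w = x @ m @ y \<and> x \<in> left_words L \<and> set m \<subseteq> B \<and> y \<in> right_words R}"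

definition over :: "'a set \<Rightarrow> ('a \<times> 'a set) list \<Rightarrow> bool" where
  "over A L \<longleftrightarrow> (\<forall>(a, B) \<in> set L. a \<in> A \<and> B \<subseteq> A)"

lemma first_occurrence:
  "\<lbrakk>u @ a # s = u' @ a # s'; a \<notin> set u; a \<notin> set u'\<rbrakk> \<Longrightarrow> u = u' \<and> s = s'"
proof (induction u arbitrary: u')
  case Nil
  then show ?case by (cases u') auto
next
  case (Cons b u)
  then show ?case by (cases u') auto
qed

text \<open>A letter that ends a block does not occur in the block, so the end of each block is
  recognized from the left.\<close>
lemma left_words_prefix_code:
  "\<lbrakk>x \<in> left_words L; x' \<in> left_words L; separated B L; x @ s = x' @ s'\<rbrakk> \<Longrightarrow> x = x' \<and> s = s'"
proof (induction L arbitrary: x x' B s s')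
  case (Cons p L)
  obtain a C where p: "p = (a, C)" by (cases p)
  obtain x1 u x2 u' where e: "x = x1 @ u @ [a]" "x' = x2 @ u' @ [a]" "x1 \<in> left_words L" "x2 \<in> left_words L" "set u \<subseteq> C" "set u' \<subseteq> C"
    using Cons.prems(1,2) p by auto
  have eq: "x1 @ (u @ a # s) = x2 @ (u' @ a # s')" using Cons.prems(4) e(1,2) by simp
  have "separated C L" using Cons.prems(3) p by simp
  then have 1: "x1 = x2 \<and> u @ a # s = u' @ a # s'" using Cons.IH[OF e(3,4) _ eq] by blast
  have "a \<notin> set u" "a \<notin> set u'" using e(5,6) Cons.prems(3) p by auto
  then have "u = u' \<and> s = s'" using first_occurrence 1 by metis
  then show ?case using e(1,2) 1 by simp
qed simp

lemma block_unique:
  assumes "m @ y = m' @ y'" "set m \<subseteq> B" "set m' \<subseteq> B" "y \<in> right_words R" "y' \<in> right_words R" "separated B R"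
  shows "m = m' \<and> y = y'"
proof (cases R)
  case Nil
  then show ?thesis using assms by simp
next
  case (Cons p R')
  obtain a C where p: "p = (a, C)" by (cases p)
  obtain t t' where "y = a # t" "y' = a # t'" using assms(4,5) Cons p by auto
  moreover have "a \<notin> set m" "a \<notin> set m'" using assms(2,3,6) Cons p by auto
  ultimately show ?thesis using assms(1) first_occurrence by metis
qed

lemma parse_unique:
  assumes "x @ m @ y = x' @ m' @ y'" "x \<in> left_words L" "x' \<in> left_words L" "separated B L" "separated B R"
    "set m \<subseteq> B" "set m' \<subseteq> B" "y \<in> right_words R" "y' \<in> right_words R"
  shows "x = x'" "m = m'" "y = y'"
proof -
  have *: "x = x' \<and> m @ y = m' @ y'" using left_words_prefix_code[OF assms(2-4,1)] .
  then show "x = x'" by simp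
  show "m = m'" "y = y'" using block_unique[of m y m' y'] * assms by blast+
qed

lemma left_words_append: "left_words (L' @ L) = {x @ x' | x x'. x \<in> left_words L \<and> x' \<in> left_words L'}"
proof (induction L')
  case (Cons p L')
  obtain a C where p: "p = (a, C)" by (cases p)
  show ?case
  proof (intro Set.set_eqI iffI)
    fix w assume "w \<in> left_words ((p # L') @ L)"
    then obtain y u where 1: "w = y @ u @ [a]" "y \<in> left_words (L' @ L)" "set u \<subseteq> C" using p by auto
    then obtain x x' where 2: "y = x @ x'" "x \<in> left_words L" "x' \<in> left_words L'" using Cons.IH by blast
    have "w = x @ (x' @ u @ [a])" "x' @ u @ [a] \<in> left_words (p # L')" using 1 2 p by auto
    then show "w \<in> {x @ x' | x x'. x \<in> left_words L \<and> x' \<in> left_words (p # L')}" using 2 by blast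
  next
    fix w assume "w \<in> {x @ x' | x x'. x \<in> left_words L \<and> x' \<in> left_words (p # L')}"
    then obtain x x' u where 1: "w = x @ x' @ u @ [a]" "x \<in> left_words L" "x' \<in> left_words L'" "set u \<subseteq> C" using p by auto
    then have "w = (x @ x') @ u @ [a]" "x @ x' \<in> left_words (L' @ L)" using Cons.IH by auto
    then show "w \<in> left_words ((p # L') @ L)" using 1(4) p by (simp del: append_assoc) blast
  qed
qed simp

lemma right_words_append: "right_words (R' @ R) = {y' @ y | y' y. y' \<in> right_words R' \<and> y \<in> right_words R}"
proof (induction R')
  case (Cons p R')
  obtain a C where p: "p = (a, C)" by (cases p)
  show ?case
  proof (intro Set.set_eqI iffI)
    fix w assume "w \<in> right_words ((p # R') @ R)"
    then obtain y u where 1: "w = a # u @ y" "y \<in> right_words (R' @ R)" "set u \<subseteq> C" using p by auto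
    then obtain x x' where 2: "y = x @ x'" "x \<in> right_words R'" "x' \<in> right_words R" using Cons.IH by blast
    have "w = (a # u @ x) @ x'" "a # u @ x \<in> right_words (p # R')" using 1 2 p by auto
    then show "w \<in> {y' @ y | y' y. y' \<in> right_words (p # R') \<and> y \<in> right_words R}" using 2 by blast
  next
    fix w assume "w \<in> {y' @ y | y' y. y' \<in> right_words (p # R') \<and> y \<in> right_words R}"
    then obtain x x' u where 1: "w = a # u @ x @ x'" "x \<in> right_words R'" "x' \<in> right_words R" "set u \<subseteq> C" using p by auto
    then have "x @ x' \<in> right_words (R' @ R)" using Cons.IH by auto
    then show "w \<in> right_words ((p # R') @ R)" using 1 p by auto
  qed
qed simp

lemma left_words_letters: "x \<in> left_words L \<Longrightarrow> over A L \<Longrightarrow> set x \<subseteq> A"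
  by (induction L arbitrary: x rule: left_words.induct) (auto simp: over_def, blast+)

lemma right_words_letters: "x \<in> right_words L \<Longrightarrow> over A L \<Longrightarrow> set x \<subseteq> A"
  by (induction L arbitrary: x rule: right_words.induct) (auto simp: over_def, blast+)

lemma over_append [simp]: "over A (L @ L') \<longleftrightarrow> over A L \<and> over A L'"
  by (auto simp: over_def)

lemma over_mono: "over A L \<Longrightarrow> A \<subseteq> A' \<Longrightarrow> over A' L"
  by (fastforce simp: over_def)

text \<open>A chain over the alphabet \<open>B\<close> can be inserted in place of the block \<open>B\<close>, since the
  neighbouring letters are not in \<open>B\<close>.\<close>
lemma separated_append: "\<lbrakk>separated B R; separated B' R'; B' \<subseteq> B; over B R'\<rbrakk> \<Longrightarrow> separated B' (R' @ R)"
proof (induction R' arbitrary: B')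
  case Nil
  then show ?case by (cases R) auto
next
  case (Cons p R')
  then show ?case by (cases p) (auto simp: over_def)
qed

text \<open>After insertion of a chain over the alphabet \<open>B\<close>, reading \<open>w\<close> amounts to reading the part of
  \<open>w\<close> that belonged to the block \<open>B\<close>.\<close>
lemma readings_subst:
  assumes w: "w = x @ z @ y" "x \<in> left_words L" "set z \<subseteq> B" "y \<in> right_words R" and s: "separated B L" "separated B R"
    and i: "over B L'" "B' \<subseteq> B" "over B R'"
  shows "readings \<phi> (L' @ L) B' (R' @ R) w = readings \<phi> L' B' R' z"
proof
  show "readings \<phi> L' B' R' z \<subseteq> readings \<phi> (L' @ L) B' (R' @ R) w"
  proof
    fix g assume "g \<in> readings \<phi> L' B' R' z"
    then obtain x' m y' where *: "g = \<phi> m" "z = x' @ m @ y'" "x' \<in> left_words L'" "set m \<subseteq> B'" "y' \<in> right_words R'"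
      unfolding readings_def by blast
    have "w = (x @ x') @ m @ (y' @ y)" using w * by simp
    moreover have "x @ x' \<in> left_words (L' @ L)" "y' @ y \<in> right_words (R' @ R)"
      using w * unfolding left_words_append right_words_append by blast+
    ultimately show "g \<in> readings \<phi> (L' @ L) B' (R' @ R) w" unfolding readings_def using * by blast
  qed
  show "readings \<phi> (L' @ L) B' (R' @ R) w \<subseteq> readings \<phi> L' B' R' z"
  proof
    fix g assume "g \<in> readings \<phi> (L' @ L) B' (R' @ R) w"
    then obtain x1 x' m y' y1 where *: "g = \<phi> m" "w = (x1 @ x') @ m @ (y' @ y1)" "x1 \<in> left_words L" "x' \<in> left_words L'"
       "set m \<subseteq> B'" "y' \<in> right_words R'" "y1 \<in> right_words R"
      unfolding readings_def left_words_append right_words_append by blast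
    have "x1 @ (x' @ m @ y') @ y1 = x @ z @ y" using * w by simp
    moreover have "set (x' @ m @ y') \<subseteq> B" using left_words_letters[OF *(4) i(1)] right_words_letters[OF *(6) i(3)] *(5) i(2) by auto
    ultimately have "x' @ m @ y' = z" using parse_unique(2) * w s by metis
    then show "g \<in> readings \<phi> L' B' R' z" unfolding readings_def using * by blast
  qed
qed

definition flatten :: "('a \<times> 'a list) list \<Rightarrow> 'a list" where "flatten ps = concat (map (\<lambda>(a, z). a # z) ps)"

lemma flatten_simps [simp]: "flatten [] = []" "flatten ((a, z) # ps) = a # z @ flatten ps" "flatten (ps @ qs) = flatten ps @ flatten qs"
  by (auto simp: flatten_def)

section \<open>Paths, labels and chain equivalence\<close>

context local_category begin

inductive path :: "'v \<Rightarrow> 'a list \<Rightarrow> 'v \<Rightarrow> bool" where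
  nil: "u \<in> V \<Longrightarrow> path u [] u"
| cons: "a \<in> Hm u v \<Longrightarrow> path v w t \<Longrightarrow> path u (a # w) t"

definition val :: "'v \<Rightarrow> 'a list \<Rightarrow> 'a" where "val u w = foldl (\<cdot>) (one u) w"

lemma path_Nil_iff [simp]: "path u [] v \<longleftrightarrow> u = v \<and> u \<in> V"
  by (auto elim: path.cases intro: path.nil)

lemma path_Cons_iff: "path u (a # w) t \<longleftrightarrow> (\<exists>v. a \<in> Hm u v \<and> path v w t)"
  by (auto elim: path.cases intro: path.cons)

lemma path_append_iff: "path u (x @ y) t \<longleftrightarrow> (\<exists>v. path u x v \<and> path v y t)"
proof (induction x arbitrary: u)
  case Nil
  have "u \<in> V" if "path u y t" using that by (cases) (use hom_V in blast)+
  then show ?case by auto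
qed (auto simp: path_Cons_iff)

lemma path_det: "path u w v \<Longrightarrow> path u w v' \<Longrightarrow> v = v'"
proof (induction arbitrary: v' rule: path.induct)
  case (cons a u v w t)
  obtain v2 where "a \<in> Hm u v2" "path v2 w v'" using cons.prems by (auto simp: path_Cons_iff)
  then show ?case using cons.IH disj[OF cons.hyps(1)] by blast
qed simp

lemma path_V: "path u w v \<Longrightarrow> u \<in> V \<and> v \<in> V"
  by (induction rule: path.induct) (use hom_V in blast)+

lemma path_Arr: "path u w v \<Longrightarrow> set w \<subseteq> Arr"
  by (induction rule: path.induct) (auto simp: in_Arr)

lemma foldl_mul: "foldl (\<cdot>) (x \<cdot> y) w = x \<cdot> foldl (\<cdot>) y w"
  by (induction w arbitrary: y) (simp_all add: assoc)

lemma foldl_val: "x \<in> Hm s u \<Longrightarrow> foldl (\<cdot>) x w = x \<cdot> val u w"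
  unfolding val_def using foldl_mul[of x "one u" w] one_r by simp

lemma val_Nil [simp]: "val u [] = one u" by (simp add: val_def)

lemma val_Cons: "a \<in> Hm u v \<Longrightarrow> val u (a # w) = a \<cdot> val v w"
  using foldl_val one_l by (simp add: val_def)

lemma val_hom: "path u w v \<Longrightarrow> val u w \<in> Hm u v"
  by (induction rule: path.induct) (auto simp: val_Cons one_in intro: comp)

lemma val_append: "path u x v \<Longrightarrow> val u (x @ y) = val u x \<cdot> val v y"
  using foldl_val[OF val_hom, of u x v y] by (simp add: val_def)

lemma letters_in_content: "path u w v \<Longrightarrow> set w \<subseteq> content (val u w)"
proof (induction rule: path.induct)
  case (cons a u v w t)
  have "a \<in> content (a \<cdot> val v w)" "val v w \<in> content (a \<cdot> val v w)"
    using content_factors cons.hyps val_hom by blast+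
  then show ?case using cons content_trans by (auto simp: val_Cons)
qed simp

text \<open>The hypothesis on \<open>one u\<close> says that the J-class of \<open>e\<close> has an idempotent at \<open>u\<close>, so that the
  value of the empty path at \<open>u\<close> is in the content of \<open>e\<close>.\<close>
lemma val_in_content:
  assumes "idem x e"
  shows "path u w v \<Longrightarrow> set w \<subseteq> content e \<Longrightarrow> one u \<in> content e \<Longrightarrow> val u w \<in> content e \<and> one v \<in> content e"
proof (induction rule: path.induct)
  case (cons a u v w t)
  have v: "one v \<in> Hm v v" using cons hom_V one_in by blast
  have "one v \<in> content (a \<cdot> one v)" using content_factors cons v by blast
  then have "one v \<in> content a" using one_r cons by simp
  then have "one v \<in> content e" using content_trans cons by auto
  then have *: "val v w \<in> content e \<and> one t \<in> content e" using cons by auto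
  then have "a \<cdot> val v w \<in> content e" using content_mult[OF assms cons(1) _ val_hom[OF cons(2)]] cons.prems by auto
  then show ?case using * cons by (simp add: val_Cons)
qed simp

definition arr_src :: "'a \<Rightarrow> 'v" where "arr_src a = (THE u. \<exists>v. a \<in> Hm u v)"
definition arr_tgt :: "'a \<Rightarrow> 'v" where "arr_tgt a = (THE v. \<exists>u. a \<in> Hm u v)"

lemma arr_src_tgt: "a \<in> Hm u v \<Longrightarrow> arr_src a = u \<and> arr_tgt a = v"
  unfolding arr_src_def arr_tgt_def using disj by blast

text \<open>Letters outside the content of \<open>e\<close> receive the identity so that every label is in the group
  at \<open>e\<close>.\<close>
definition letter_label :: "'v \<Rightarrow> 'a \<Rightarrow> 'a \<Rightarrow> 'a" where
  "letter_label v e a = (if a \<in> content e then unit_label v e (arr_src a) (arr_tgt a) a else e)"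

definition word_label :: "'v \<Rightarrow> 'a \<Rightarrow> 'a list \<Rightarrow> 'a" where
  "word_label v e w = foldr (\<lambda>a g. letter_label v e a \<cdot> g) w e"

text \<open>The label of the value can be computed letter by letter, which is what an automaton does.\<close>
lemma word_label_val:
  assumes e: "idem x e"
  shows "path s w t \<Longrightarrow> set w \<subseteq> content e \<Longrightarrow> one s \<in> content e \<Longrightarrow> word_label x e w = unit_label x e s t (val s w)"
proof (induction rule: path.induct)
  case (nil u)
  have s: "splitting x e u (out_arrow x e u) (in_arrow x e u)" using splitting_content[OF e one_in] nil by blast
  then have "one u \<cdot> in_arrow x e u = in_arrow x e u" using one_l unfolding splitting_def by blast
  then show ?case using s unfolding word_label_def unit_label_def splitting_def by simp
next
  case (cons a u v w t)
  have a: "a \<in> content e" using cons by simp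
  have "path u [a] v" using cons by (simp add: path_Cons_iff path_V)
  then have v: "one v \<in> content e" using val_in_content[OF e] a cons.prems by auto
  then have w: "val v w \<in> content e" "word_label x e w = unit_label x e v t (val v w)" using cons val_in_content[OF e cons(2)] by auto
  have "word_label x e (a # w) = unit_label x e u v a \<cdot> unit_label x e v t (val v w)"
    using w(2) a arr_src_tgt[OF cons(1)] by (simp add: word_label_def letter_label_def)
  also have "\<dots> = unit_label x e u t (a \<cdot> val v w)"
    using unit_label_mult[OF e cons(1) a val_hom[OF cons(2)] w(1)] by simp
  finally show ?case using cons by (simp add: val_Cons)
qed

text \<open>Chains serve as test languages; the bound \<open>K\<close> on the number of letters between blocks leaves
  finitely many of them. The tests are restricted to an alphabet so that they can be inserted into a
  block.\<close>
definition chain_equiv :: "'a set \<Rightarrow> nat \<Rightarrow> 'a list \<Rightarrow> 'a list \<Rightarrow> bool" where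
  "chain_equiv A K w w' \<longleftrightarrow> (\<forall>L B R v e. idem v e \<and> separated B L \<and> separated B R \<and> length L + length R \<le> K \<and>
     B \<subseteq> A \<and> over A L \<and> over A R \<longrightarrow> readings (word_label v e) L B R w = readings (word_label v e) L B R w')"

lemma chain_equiv_sym: "chain_equiv A K w w' \<Longrightarrow> chain_equiv A K w' w" by (simp add: chain_equiv_def)

text \<open>Chain equivalence of two words passes to the parts that are read by one block of a chain,
  with a loss in length equal to the length of the chain.\<close>
lemma chain_equiv_subst:
  assumes q: "chain_equiv A K W W'" and A: "B \<subseteq> A" "over A L" "over A R"
    and W: "W = x @ z @ y" "x \<in> left_words L" "set z \<subseteq> B" "y \<in> right_words R" and s: "separated B L" "separated B R"
    and W': "W' = x' @ z' @ y'" "x' \<in> left_words L" "set z' \<subseteq> B" "y' \<in> right_words R"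
    and K: "length L + length R + k \<le> K"
  shows "chain_equiv B k z z'"
  unfolding chain_equiv_def
proof (intro allI impI)
  fix L' B' R' v e
  assume a: "idem v e \<and> separated B' L' \<and> separated B' R' \<and> length L' + length R' \<le> k \<and> B' \<subseteq> B \<and> over B L' \<and> over B R'"
  have "readings (word_label v e) (L' @ L) B' (R' @ R) W = readings (word_label v e) (L' @ L) B' (R' @ R) W'"
    using q a A K s separated_append[of B L B' L'] separated_append[of B R B' R'] over_mono[of B _ A] unfolding chain_equiv_def by auto
  then show "readings (word_label v e) L' B' R' z = readings (word_label v e) L' B' R' z'"
    using readings_subst[OF W s, where \<phi>="word_label v e"] readings_subst[OF W' s, where \<phi>="word_label v e"] a by simp
qed

lemma chain_equiv_parse:
  assumes q: "chain_equiv A K W W'" and A: "B \<subseteq> A" "over A L" "over A R"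
    and W: "W = x @ z @ y" "x \<in> left_words L" "set z \<subseteq> B" "y \<in> right_words R" and s: "separated B L" "separated B R"
    and K: "length L + length R \<le> K" and u: "u \<in> V"
  shows "\<exists>x' z' y'. W' = x' @ z' @ y' \<and> x' \<in> left_words L \<and> set z' \<subseteq> B \<and> y' \<in> right_words R"
proof -
  \<comment> \<open>Any label will do; only the existence of a reading matters.\<close>
  have i: "idem u (one u)" unfolding idem_def using one_in[OF u] one_l by blast
  have "word_label u (one u) z \<in> readings (word_label u (one u)) L B R W"
    unfolding readings_def using W by blast
  moreover have "readings (word_label u (one u)) L B R W = readings (word_label u (one u)) L B R W'"
    using q i A s K unfolding chain_equiv_def by blast
  ultimately show ?thesis unfolding readings_def by blast
qed

text \<open>The path \<open>z\<close> is the first block and \<open>C\<close> its content. The list contains the other blocks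
  together with their contents, each preceded by the letter that separates it from the block
  before.\<close>
inductive canonical :: "'v \<Rightarrow> 'a list \<Rightarrow> 'a set \<Rightarrow> ('a \<times> 'a list \<times> 'a set) list \<Rightarrow> 'v \<Rightarrow> bool" where
  canonical_nil: "\<lbrakk>path u z v; regular u v (val u z); C = content (val u z)\<rbrakk> \<Longrightarrow> canonical u z C [] v"
| canonical_cons: "\<lbrakk>path u z s; regular u s (val u z); C = content (val u z); a \<in> Hm s t; a \<notin> C; a \<notin> C'; canonical t z' C' ps v\<rbrakk>
    \<Longrightarrow> canonical u z C ((a, z', C') # ps) v"

abbreviation canonical_word :: "('a \<times> 'a list \<times> 'a set) list \<Rightarrow> 'a list" where
  "canonical_word ps \<equiv> flatten (map (\<lambda>(a, z, C). (a, z)) ps)"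

abbreviation chain :: "'a set \<Rightarrow> ('a \<times> 'a list \<times> 'a set) list \<Rightarrow> ('a \<times> 'a set) list" where
  "chain A ps \<equiv> map (\<lambda>(a, z, C). (a, C \<inter> A)) ps"

lemma canonical_head: "canonical u z C ps v \<Longrightarrow> set z \<subseteq> C"
  by (erule canonical.cases) (auto dest: letters_in_content)

lemma canonical_chain: "canonical u z C ps v \<Longrightarrow> set (canonical_word ps) \<subseteq> A \<Longrightarrow> separated (C \<inter> A) (chain A ps) \<and> canonical_word ps \<in> right_words (chain A ps) \<and> over A (chain A ps)"
proof (induction rule: canonical.induct)
  case (canonical_cons u z s C a t C' z' ps v)
  have "set z' \<subseteq> C'" using canonical_head canonical_cons by blast
  then show ?case using canonical_cons by (auto simp: over_def)
qed (simp add: over_def)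

text \<open>Suppose that regular blocks determine the values of equivalent paths. The chain of a
  canonical factorization of one path then transfers equality of values to the whole path. The proof
  moves the first block from the right part of the chain to its left part \<open>L\<close>, one block at a time.\<close>
lemma canonical_transfer:
  assumes hyp: "\<And>u z v w C. \<lbrakk>regular u v (val u z); path u z v; path u w v; C = content (val u z); card C < m;
       set z \<subseteq> C \<inter> A; set w \<subseteq> C \<inter> A; chain_equiv (C \<inter> A) k z w\<rbrakk> \<Longrightarrow> val u w = val u z"
  shows "canonical u z C ps v \<Longrightarrow> card C < m \<Longrightarrow> (\<forall>(a, z, C) \<in> set ps. card C < m) \<Longrightarrow>
    W = x @ z @ canonical_word ps \<Longrightarrow> W' = x' @ w \<Longrightarrow> x \<in> left_words L \<Longrightarrow> x' \<in> left_words L \<Longrightarrow> separated (C \<inter> A) L \<Longrightarrow> over A L \<Longrightarrow>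
    path u w v \<Longrightarrow> set (z @ canonical_word ps) \<subseteq> A \<Longrightarrow> chain_equiv A K W W' \<Longrightarrow> length L + length ps + k \<le> K \<Longrightarrow>
    val u w = val u (z @ canonical_word ps)"
proof (induction arbitrary: x x' L w rule: canonical.induct)
  case (canonical_nil u z v C)
  note p = canonical_nil.prems
  have z: "set z \<subseteq> C \<inter> A" using letters_in_content canonical_nil by auto
  have W: "W = x @ z @ []" using canonical_nil by simp
  have n: "over A []" "[] \<in> right_words []" "separated (C \<inter> A) []" by (auto simp: over_def)
  have u: "u \<in> V" using path_V canonical_nil by blast
  have K: "length L + length [] \<le> K" "length L + length [] + k \<le> K" using p(12) by auto
  obtain x1 z1 y1 where 1: "W' = x1 @ z1 @ y1" "x1 \<in> left_words L" "set z1 \<subseteq> C \<inter> A" "y1 \<in> right_words []"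
    using chain_equiv_parse[OF p(11) Int_lower2 p(8) n(1) W p(5) z n(2) p(7) n(3) K(1) u] by blast
  have "x1 @ z1 = x' @ w" using 1 p(4) by simp
  then have "w = z1" using left_words_prefix_code[OF 1(2) p(6,7)] by blast
  then have w: "set w \<subseteq> C \<inter> A" using 1 by simp
  have W': "W' = x' @ w @ []" using canonical_nil by simp
  have "chain_equiv (C \<inter> A) k z w"
    by (rule chain_equiv_subst[OF p(11) Int_lower2 p(8) n(1) W p(5) z n(2) p(7) n(3) W' p(6) w n(2) K(2)])
  then show ?case using hyp[OF canonical_nil.hyps(2,1) p(9) canonical_nil.hyps(3) p(1) z w] by simp
next
  case (canonical_cons u z s C a t C' z' ps v)
  note p = canonical_cons.prems
  let ?ps = "(a, z', C') # ps"
  have f: "canonical u z C ?ps v" using canonical_cons.hyps canonical.canonical_cons by blast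
  have ch: "separated (C \<inter> A) (chain A ?ps)" "canonical_word ?ps \<in> right_words (chain A ?ps)" "over A (chain A ?ps)"
    using canonical_chain[OF f, of A] p(10) by auto
  have z: "set z \<subseteq> C \<inter> A" using canonical_head[OF f] p(10) by auto
  have u: "u \<in> V" using path_V p(9) by blast
  have K: "length L + length (chain A ?ps) \<le> K" "length L + length (chain A ?ps) + k \<le> K" using p(12) by auto
  obtain x1 m y where 1: "W' = x1 @ m @ y" "x1 \<in> left_words L" "set m \<subseteq> C \<inter> A" "y \<in> right_words (chain A ?ps)"
    using chain_equiv_parse[OF p(11) Int_lower2 p(8) ch(3) p(3,5) z ch(2) p(7) ch(1) K(1) u] by blast
  obtain y0 where y0: "y = a # y0" using 1(4) by auto
  have "x1 @ (m @ y) = x' @ w" using 1 p(4) by simp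
  then have w: "w = m @ y" using left_words_prefix_code[OF 1(2) p(6,7)] by blast
  have W': "W' = x' @ m @ y" using p(4) w by simp
  have ez: "chain_equiv (C \<inter> A) k z m"
    by (rule chain_equiv_subst[OF p(11) Int_lower2 p(8) ch(3) p(3,5) z ch(2) p(7) ch(1) W' p(6) 1(3,4) K(2)])
  obtain s1 t1 where p1: "path u m s1" "a \<in> Hm s1 t1" "path t1 y0 v"
    using p(9) w y0 by (auto simp: path_append_iff path_Cons_iff)
  then have s1: "s1 = s" "t1 = t" using disj canonical_cons.hyps(4) by blast+
  have pm: "path u m s" using p1 s1 by simp
  have m: "val u m = val u z"
    by (rule hyp[OF canonical_cons.hyps(2,1) pm canonical_cons.hyps(3) p(1) z 1(3) ez])
  have "val t y0 = val t (z' @ canonical_word ps)"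
  proof (rule canonical_cons.IH[of "x @ z @ [a]" "x' @ m @ [a]" _ "(a, C \<inter> A) # L"])
    show "x @ z @ [a] \<in> left_words ((a, C \<inter> A) # L)" "x' @ m @ [a] \<in> left_words ((a, C \<inter> A) # L)"
      using p(5,6) z 1(3) by auto
    show "separated (C' \<inter> A) ((a, C \<inter> A) # L)" using canonical_cons.hyps p(7) by simp
    show "over A ((a, C \<inter> A) # L)" using p(8,10) by (auto simp: over_def)
  qed (use p W' y0 p1 s1 in auto)
  then have "val u (m @ a # y0) = val u z \<cdot> (a \<cdot> val t (z' @ canonical_word ps))"
    using m pm canonical_cons.hyps(4) by (simp add: val_append val_Cons)
  also have "\<dots> = val u (z @ canonical_word ?ps)"
    using canonical_cons.hyps by (simp add: val_append val_Cons)
  finally show ?case using w y0 by simp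
qed

end

section \<open>Canonical factorizations\<close>

context local_category begin

text \<open>Pieces are blocks preceded by a letter. The first piece starts with an identity in place of
  a letter, so that every block starts at the end of an arrow.\<close>
definition regular_pieces :: "('a \<times> 'a list) list \<Rightarrow> bool" where
  "regular_pieces ps \<longleftrightarrow> (\<forall>(a, z) \<in> set ps. \<exists>v. path (arr_tgt a) z v \<and> regular (arr_tgt a) v (val (arr_tgt a) z))"

lemma regular_pieces_simps [simp]:
  "regular_pieces []"
  "regular_pieces ((a, z) # ps) \<longleftrightarrow> (\<exists>v. path (arr_tgt a) z v \<and> regular (arr_tgt a) v (val (arr_tgt a) z)) \<and> regular_pieces ps"
  "regular_pieces (ps @ qs) \<longleftrightarrow> regular_pieces ps \<and> regular_pieces qs"
  unfolding regular_pieces_def by (simp_all add: ball_Un)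

lemma regular_path_append:
  assumes "path s z t" "regular s t (val s z)" "path t z' v" "regular t v (val t z')"
  shows "path s (z @ z') v" "regular s v (val s (z @ z'))"
  using assms regular_mult path_append_iff val_append by metis+

text \<open>A factorization in which no two neighbouring blocks can be merged into one regular block is
  canonical: a letter in the content of the block before or after it would be absorbed by that
  block, and the product with the other block is regular.\<close>
lemma canonical_of_pieces:
  assumes merge: "\<And>p1 a z b z' p3 v. ps0 = p1 @ (a, z) # (b, z') # p3 \<Longrightarrow> path (arr_tgt a) (z @ b # z') v
      \<Longrightarrow> regular (arr_tgt a) v (val (arr_tgt a) (z @ b # z')) \<Longrightarrow> False"
    and r: "regular_pieces ps0"
  shows "ps0 = p1 @ (a, z) # ps \<Longrightarrow> path t (z @ flatten ps) v \<Longrightarrow> a \<in> Hm s t \<Longrightarrow>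
    \<exists>C ps'. canonical t z C ps' v \<and> map (\<lambda>(a, z, C). (a, z)) ps' = ps"
proof (induction ps arbitrary: p1 a z s t)
  case Nil
  obtain v' where "path (arr_tgt a) z v'" "regular (arr_tgt a) v' (val (arr_tgt a) z)" using r Nil(1) unfolding regular_pieces_def by auto
  then have "path t z v" "regular t v (val t z)" using arr_src_tgt[OF Nil(3)] Nil(2) path_det[of t z v v'] by auto
  then show ?case using canonical.canonical_nil by fastforce
next
  case (Cons p ps)
  obtain b z' where p: "p = (b, z')" by (cases p)
  have ta: "arr_tgt a = t" using arr_src_tgt[OF Cons.prems(3)] by simp
  obtain x where x: "path t z x" "regular t x (val t z)" using r Cons.prems(1) ta unfolding regular_pieces_def by auto
  obtain x1 y where "path t z x1" and 1: "b \<in> Hm x1 y" "path y (z' @ flatten ps) v"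
    using Cons.prems(2) p by (auto simp: path_append_iff path_Cons_iff)
  then have b: "b \<in> Hm x y" using path_det x(1) by metis
  have tb: "arr_tgt b = y" using arr_src_tgt[OF b] by simp
  obtain w where w: "path y z' w" "regular y w (val y z')" using r Cons.prems(1) p tb unfolding regular_pieces_def by auto
  obtain C' ps' where f: "canonical y z' C' ps' v" "map (\<lambda>(a, z, C). (a, z)) ps' = ps"
    using Cons.IH[of "p1 @ [(a, z)]" b z' y x] Cons.prems(1) p 1(2) b by auto
  have C': "C' = content (val y z')" using f(1) by (auto elim: canonical.cases)
  have pth: "path t (z @ b # z') w" using x(1) b w(1) by (auto simp: path_append_iff path_Cons_iff)
  have eq: "ps0 = p1 @ (a, z) # (b, z') # ps" using Cons.prems(1) p by simp
  have nr: "\<not> regular t w (val t (z @ b # z'))" using merge[OF eq] pth ta by blast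
  have v: "val t (z @ b # z') = val t z \<cdot> (b \<cdot> val y z')"
    using x(1) b by (simp add: val_append val_Cons)
  have n1: "b \<notin> content (val t z)"
  proof
    assume "b \<in> content (val t z)"
    then have "regular t y (val t z \<cdot> b)" using regular_absorb_right[OF x(2) b] by blast
    then have "regular t w ((val t z \<cdot> b) \<cdot> val y z')" using regular_mult w(2) by blast
    then show False using nr v by (simp add: assoc)
  qed
  have n2: "b \<notin> C'"
  proof
    assume "b \<in> C'"
    then have "regular x w (b \<cdot> val y z')" using regular_absorb_left[OF w(2) b] C' by blast
    then have "regular t w (val t z \<cdot> (b \<cdot> val y z'))" using regular_mult x(2) by blast
    then show False using nr v by simp
  qed
  have "canonical t z (content (val t z)) ((b, z', C') # ps') v"
    by (rule canonical.canonical_cons[OF x refl b n1 n2 f(1)])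
  then show ?case using f(2) p by fastforce
qed

text \<open>Choose a factorization into regular blocks with the least number of letters. If it had many
  letters, some segment \<open>a\<^sub>i z\<^sub>i \<dots> a\<^sub>j z\<^sub>j\<close> would be idempotent and could be merged with the block
  before it.\<close>
lemma short_factorization:
  obtains N where "\<And>u w v. path u w v \<Longrightarrow> \<exists>z C ps. canonical u z C ps v \<and> w = z @ canonical_word ps \<and> length ps \<le> N"
proof -
  obtain N :: nat where N: "\<forall>f. (\<forall>i j. i < j \<and> j < N \<longrightarrow> f i j \<in> Arr) \<longrightarrow>
     (\<exists>i j k. i < j \<and> j < k \<and> k < N \<and> f i j = f j k \<and> f i k = f j k)"
    using Ramsey_triple[OF finite_Arr] by auto
  have "\<exists>z C ps. canonical u z C ps v \<and> w = z @ canonical_word ps \<and> length ps \<le> N" if w: "path u w v" for u w v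
  proof -
    let ?P = "\<lambda>ps. regular_pieces ps \<and> flatten ps = one u # w"
    have uV: "u \<in> V" using path_V w by blast
    have ou: "one u \<in> Hm u u" using one_in uV .
    have pw: "path u (one u # w) v" using w ou by (auto simp: path_Cons_iff)
    \<comment> \<open>Initially each letter is followed by an empty block.\<close>
    have "\<exists>ps. ?P ps"
    proof -
      have "regular_pieces (map (\<lambda>a::'a. (a, []::'a list)) (one u # w))"
        unfolding regular_pieces_def
      proof clarify
        fix a z assume "(a, z) \<in> set (map (\<lambda>a::'a. (a, []::'a list)) (one u # w))"
        then have "z = []" "a \<in> Arr" using path_Arr[OF pw] by auto
        then have "arr_tgt a \<in> V" using arr_src_tgt hom_V unfolding in_Arr by metis
        then show "\<exists>v. path (arr_tgt a) z v \<and> regular (arr_tgt a) v (val (arr_tgt a) z)"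
          using \<open>z = []\<close> regular_one by auto
      qed
      moreover have "flatten (map (\<lambda>a::'a. (a, []::'a list)) l) = l" for l :: "'a list" by (induction l) auto
      ultimately show ?thesis by metis
    qed
    then obtain ps where ps: "?P ps" and mn: "\<And>qs. ?P qs \<Longrightarrow> length ps \<le> length qs"
      using ex_has_least_nat[of ?P _ length] by blast
    have merge: False if eq: "ps = p1 @ (a, z) # p2 @ p3" and ne: "p2 \<noteq> []"
      and pth: "path (arr_tgt a) (z @ flatten p2) x" and rg: "regular (arr_tgt a) x (val (arr_tgt a) (z @ flatten p2))" for p1 a z p2 p3 x
    proof -
      have "?P (p1 @ (a, z @ flatten p2) # p3)" using ps pth rg unfolding eq by auto
      then have "length ps \<le> length (p1 @ (a, z @ flatten p2) # p3)" by (rule mn)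
      then show False using ne unfolding eq by simp
    qed
    have "ps \<noteq> []" using ps by auto
    then obtain a z ps1 where ps1: "ps = (a, z) # ps1" by (cases ps) auto
    have a: "a = one u" "z @ flatten ps1 = w" using ps ps1 by auto
    have "\<exists>C ps'. canonical u z C ps' v \<and> map (\<lambda>(a, z, C). (a, z)) ps' = ps1"
    proof (rule canonical_of_pieces[of ps])
      show "False" if "ps = p1 @ (a, z) # (b, z') # p3" "path (arr_tgt a) (z @ b # z') v"
        "regular (arr_tgt a) v (val (arr_tgt a) (z @ b # z'))" for p1 a z b z' p3 v
        using merge[of p1 a z "[(b, z')]" p3 v] that by simp
      show "regular_pieces ps" using ps by blast
      show "ps = [] @ (a, z) # ps1" using ps1 by simp
      show "path u (z @ flatten ps1) v" using a w by simp
      show "a \<in> Hm u u" using a ou by simp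
    qed
    then obtain C ps' where f: "canonical u z C ps' v" "map (\<lambda>(a, z, C). (a, z)) ps' = ps1" by blast
    have "length ps' \<le> N"
    proof (rule ccontr)
      assume "\<not> length ps' \<le> N"
      then have len: "N < length ps1" using f(2) by auto
      have parts: "\<exists>s t. path s (flatten q) t" if "ps1 = q0 @ q @ q1" for q0 q q1
      proof -
        have "path u (z @ flatten q0 @ flatten q @ flatten q1) v" using w a(2) that by simp
        then show ?thesis unfolding path_append_iff by blast
      qed
      let ?seg = "\<lambda>i j. take (j - i) (drop i ps1)"
      \<comment> \<open>The value of a nonempty segment, without reference to the vertex at which it starts.\<close>
      define F where "F i j = foldl (\<cdot>) (hd (flatten (?seg i j))) (tl (flatten (?seg i j)))" for i j
      have dec: "ps1 = take i ps1 @ ?seg i j @ drop j ps1" if "i < j" for i j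
        using that by (metis append_take_drop_id drop_drop le_add_diff_inverse2 less_imp_le)
      have seg_ne: "flatten (?seg i j) \<noteq> []" if "i < j" "j < length ps1" for i j
      proof -
        have "?seg i j \<noteq> []" using that by auto
        then obtain b y qs where "?seg i j = (b, y) # qs" by (metis list.exhaust surj_pair)
        then show ?thesis by simp
      qed
      have Fval: "F i j = val s (flatten (?seg i j))" if ij: "i < j" "j < length ps1" and pth: "path s (flatten (?seg i j)) t" for i j s t
      proof -
        obtain b y where fb: "flatten (?seg i j) = b # y" using seg_ne[OF ij] by (metis list.exhaust)
        then obtain t' where "b \<in> Hm s t'" using pth fb by (auto simp: path_Cons_iff)
        then show ?thesis unfolding F_def fb by (simp add: val_def one_l)
      qed
      have "\<forall>i j. i < j \<and> j < N \<longrightarrow> F i j \<in> Arr"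
      proof (intro allI impI)
        fix i j assume ij: "i < j \<and> j < N"
        then obtain s t where st: "path s (flatten (?seg i j)) t" using parts[OF dec] by blast
        then show "F i j \<in> Arr" using Fval[of i j s t] ij len val_hom[OF st] unfolding in_Arr by auto
      qed
      then obtain i j k where ijk: "i < j" "j < k" "k < N" "F i j = F j k" "F i k = F j k" using N by blast
      have sk: "?seg i k = ?seg i j @ ?seg j k"
      proof -
        have "take (k - i) (drop i ps1) = take ((j - i) + (k - j)) (drop i ps1)" using ijk by simp
        also have "\<dots> = ?seg i j @ take (k - j) (drop (j - i) (drop i ps1))" by (simp only: take_add)
        also have "drop (j - i) (drop i ps1) = drop j ps1" using ijk by (simp add: drop_drop)
        finally show ?thesis .
      qed
      have "ps1 = take i ps1 @ ?seg i k @ drop k ps1" using dec ijk by simp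
      then obtain s t where st: "path s (flatten (?seg i k)) t" "path u (z @ flatten (take i ps1)) s"
        using w a(2) by (metis flatten_simps(3) append.assoc path_append_iff)
      then obtain r where r: "path s (flatten (?seg i j)) r" "path r (flatten (?seg j k)) t"
        unfolding sk by (auto simp: path_append_iff)
      have v: "F i j = val s (flatten (?seg i j))" "F j k = val r (flatten (?seg j k))" "F i k = val s (flatten (?seg i k))"
        using Fval r st ijk len by auto
      have "F i j \<in> Hm s r" "F i j \<in> Hm r t" using v val_hom[OF r(1)] val_hom[OF r(2)] ijk by auto
      then have e: "r = s" "t = s" using disj by blast+
      have "F i k = F i j \<cdot> F j k" using v sk val_append[OF r(1)] by simp
      then have "idem s (F i j)" using ijk \<open>F i j \<in> Hm s r\<close> e unfolding idem_def by auto
      then have rs: "regular s s (val s (flatten (?seg i j)))" using regular_idem v(1) by simp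
      have "ps = take (Suc i) ps @ ?seg i j @ drop j ps1" using dec[OF ijk(1)] ps1 by simp
      moreover obtain p1 b y where pb: "take (Suc i) ps = p1 @ [(b, y)]"
        using ps1 by (metis rev_exhaust surj_pair take_Suc_Cons list.distinct(1))
      ultimately have d: "ps = p1 @ (b, y) # ?seg i j @ drop j ps1" by simp
      have "(b, y) \<in> set ps" using d by (metis in_set_conv_decomp)
      then obtain x where x: "path (arr_tgt b) y x" "regular (arr_tgt b) x (val (arr_tgt b) y)"
        using ps unfolding regular_pieces_def by blast
      have "flatten p1 @ b # y = one u # z @ flatten (take i ps1)"
        using arg_cong[OF pb, of flatten] ps1 a by simp
      moreover have "path u (one u # z @ flatten (take i ps1)) s" using st(2) ou by (auto simp: path_Cons_iff)
      ultimately obtain c c' where "b \<in> Hm c c'" "path c' y s"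
        by (metis path_append_iff path_Cons_iff)
      then have "path (arr_tgt b) y s" using arr_src_tgt by metis
      then have xs: "x = s" using x(1) path_det by metis
      have ne: "?seg i j \<noteq> []" using ijk len by auto
      show False
        using merge[OF d ne] regular_path_append[OF x[unfolded xs]] r(1) rs e(1) by metis
    qed
    then show ?thesis using f a(2) by auto
  qed
  then show ?thesis using that by blast
qed

end

section \<open>Chain-equivalent paths have equal values\<close>

context local_category begin

lemma content_mono: "x \<in> content y \<Longrightarrow> content x \<subseteq> content y" using content_trans by blast

lemma target_in_content:
  assumes "a \<in> Hm s t" "a \<in> content e" shows "one t \<in> content e"
proof -
  have t: "one t \<in> Hm t t" using assms hom_V one_in by blast
  have "one t \<in> content (a \<cdot> one t)" using content_factors assms t by blast
  then show ?thesis using one_r content_trans assms by auto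
qed

text \<open>Each block avoids a letter from the content of \<open>e\<close>, namely a letter next to it, unless it is
  the only block.\<close>
lemma canonical_contents:
  assumes e: "idem x e"
  shows "canonical u z C ps v \<Longrightarrow> set (z @ canonical_word ps) \<subseteq> content e \<Longrightarrow> one u \<in> content e \<Longrightarrow>
    C \<subseteq> content e \<and> (ps \<noteq> [] \<longrightarrow> C \<noteq> content e) \<and> (\<forall>(a, z, C) \<in> set ps. C \<subset> content e)"
proof (induction rule: canonical.induct)
  case (canonical_nil u z v C)
  then show ?case using val_in_content[OF e] content_mono by auto
next
  case (canonical_cons u z s C a t C' z' ps v)
  have a: "a \<in> content e" using canonical_cons.prems by simp
  have "C \<subseteq> content e" using val_in_content[OF e canonical_cons.hyps(1)] content_mono canonical_cons by auto
  moreover have "C' \<subseteq> content e \<and> (\<forall>(a, z, C) \<in> set ps. C \<subset> content e)"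
    using canonical_cons.IH target_in_content[OF canonical_cons.hyps(4) a] canonical_cons.prems by auto
  ultimately show ?case using a canonical_cons.hyps(5,6) by auto
qed

text \<open>The induction hypothesis \<open>IH\<close> is about paths with a canonical factorization in which all
  contents have fewer than \<open>m\<close> elements. It is applied to \<open>w\<close> in the first place and to the regular
  path \<open>z\<close> in the second, because it is the factorization of \<open>w\<close> whose contents are small if \<open>w\<close> is
  not in the J-class of \<open>z\<close>.\<close>
lemma regular_block_transfer:
  assumes IH: "\<And>A u v z w C ps y. \<lbrakk>path u w v; canonical u y C ps v; z = y @ canonical_word ps; length ps \<le> N; set z \<subseteq> A; set w \<subseteq> A;
      chain_equiv A (m * N) z w; card C < m; \<forall>(a, z, C) \<in> set ps. card C < m\<rbrakk> \<Longrightarrow> val u z = val u w"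
    and N: "\<And>u w v. path u w v \<Longrightarrow> \<exists>z C ps. canonical u z C ps v \<and> w = z @ canonical_word ps \<and> length ps \<le> N"
    and r: "regular u v (val u z)" and pz: "path u z v" and pw: "path u w v" and C: "C = content (val u z)" "card C \<le> m"
    and s: "set z \<subseteq> C \<inter> A" "set w \<subseteq> C \<inter> A" and q: "chain_equiv (C \<inter> A) (m * N) z w"
  shows "val u w = val u z"
proof -
  obtain e y where e: "idem u e" "e \<cdot> val u z = val u z" "content e = C"
    using regular_obtain[OF r] C(1) by metis
  have eh: "e \<in> Hm u u" using e unfolding idem_def by blast
  have ou: "one u \<in> content e"
  proof -
    have "one u \<in> Hm u u" using one_in hom_V eh by blast
    then have "one u \<in> content (one u \<cdot> e)" using content_factors eh by blast
    then show ?thesis using one_l eh by simp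
  qed
  have cw: "val u w \<in> content e" using val_in_content[OF e(1) pw _ ou] s(2) e(3) by auto
  have cz: "val u z \<in> content e" using val_in_content[OF e(1) pz _ ou] s(1) e(3) by auto
  have Fe: "local_idem u e u = e" using local_idem_self e(1) by blast
  show ?thesis
  proof (cases "e \<cdot> val u w = val u w")
    case True
    \<comment> \<open>Both values are fixed by \<open>e\<close>, so they are determined by their labels.\<close>
    have "readings (word_label u e) [] (C \<inter> A) [] z = readings (word_label u e) [] (C \<inter> A) [] w"
      using q e(1) unfolding chain_equiv_def by (auto simp: over_def)
    then have "word_label u e z = word_label u e w" using s unfolding readings_def by auto
    then have "unit_label u e u v (val u z) = unit_label u e u v (val u w)"
      using word_label_val[OF e(1) pz _ ou] word_label_val[OF e(1) pw _ ou] s e(3) by auto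
    then show ?thesis
      using unit_label_recover[OF e(1) val_hom[OF pz] cz] unit_label_recover[OF e(1) val_hom[OF pw] cw] True e(2) Fe by metis
  next
    case False
    \<comment> \<open>If one of the blocks of \<open>w\<close> had the content of \<open>e\<close>, it would be all of \<open>w\<close> and fixed by \<open>e\<close>.\<close>
    obtain w0 C0 ps where f: "canonical u w0 C0 ps v" "w = w0 @ canonical_word ps" "length ps \<le> N" using N[OF pw] by blast
    have cts: "C0 \<subseteq> content e" "ps \<noteq> [] \<Longrightarrow> C0 \<noteq> content e" "\<forall>(a, z, C) \<in> set ps. C \<subset> content e"
      using canonical_contents[OF e(1) f(1) _ ou] s(2) f(2) e(3) by auto
    have "C0 \<noteq> content e"
    proof
      assume a: "C0 = content e"
      then have "ps = []" using cts by blast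
      then have "regular u v (val u w)" "C0 = content (val u w)" using f by (auto elim: canonical.cases)
      then obtain e' where "idem u e'" "e' \<cdot> val u w = val u w" "content e' = C0" using regular_obtain by metis
      then show False using idem_content_eq[OF e(1)] a False by metis
    qed
    then have "C0 \<subset> C" using cts e(3) by blast
    have fC: "finite C" using finite_Arr content_Arr C(1) finite_subset by blast
    have "card C0 < m" using psubset_card_mono[OF fC \<open>C0 \<subset> C\<close>] C(2) by simp
    moreover have "\<forall>(a, z, C) \<in> set ps. card C < m"
    proof clarify
      fix a y D assume "(a, y, D) \<in> set ps"
      then have "D \<subset> C" using cts(3) e(3) by auto
      then have "card D < card C" by (rule psubset_card_mono[OF fC])
      then show "card D < m" using C(2) by linarith
    qed
    ultimately show ?thesis by (rule IH[OF pz f s(2,1) chain_equiv_sym[OF q]])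
  qed
qed

text \<open>Each step of the induction on the size of contents consumes the length of one canonical
  chain, which is at most \<open>N\<close>; so chains of length \<open>(card Arr + 1) N\<close> are enough.\<close>
lemma chain_equiv_separates:
  obtains K where "\<And>u v z w. path u z v \<Longrightarrow> path u w v \<Longrightarrow> chain_equiv Arr K z w \<Longrightarrow> val u z = val u w"
proof -
  obtain N where N: "\<And>u w v. path u w v \<Longrightarrow> \<exists>z C ps. canonical u z C ps v \<and> w = z @ canonical_word ps \<and> length ps \<le> N"
    using short_factorization by blast
  have main: "val u z = val u w" if "path u w v" "canonical u y C ps v" "z = y @ canonical_word ps" "length ps \<le> N"
      "set z \<subseteq> A" "set w \<subseteq> A" "chain_equiv A (m * N) z w" "card C < m" "\<forall>(a, z, C) \<in> set ps. card C < m"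
    for m A u v z w C ps y
    using that
  proof (induction m arbitrary: A u v z w C ps y)
    case (Suc m)
    note p = Suc.prems
    have "val u w = val u (y @ canonical_word ps)"
    proof (rule canonical_transfer[OF _ p(2) p(8,9), where A = A and W = z and W' = w and x = "[]" and x' = "[]"
          and L = "[]" and k = "m * N" and K = "Suc m * N"])
      fix u' z' v' w' C'
      assume h: "regular u' v' (val u' z')" "path u' z' v'" "path u' w' v'" "C' = content (val u' z')" "card C' < Suc m"
       "set z' \<subseteq> C' \<inter> A" "set w' \<subseteq> C' \<inter> A" "chain_equiv (C' \<inter> A) (m * N) z' w'"
      have C': "card C' \<le> m" using h(5) by simp
      show "val u' w' = val u' z'"
        by (rule regular_block_transfer[OF _ _ h(1-4) C' h(6-8)]) (fact Suc.IH, fact N)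
    qed (use p in \<open>auto simp: over_def\<close>)
    then show ?case using p(3) by simp
  qed simp
  show ?thesis
  proof (rule that)
    fix u v z w assume a: "path u z v" "path u w v" "chain_equiv Arr (Suc (card Arr) * N) z w"
    obtain y C ps where f: "canonical u y C ps v" "z = y @ canonical_word ps" "length ps \<le> N" using N[OF a(1)] by blast
    have *: "card C < Suc (card Arr)" if "C \<subseteq> Arr" for C using card_mono[OF finite_Arr that] by simp
    have **: "C \<subseteq> Arr \<and> (\<forall>(a, z, C) \<in> set ps. C \<subseteq> Arr)" using f(1)
      by (induction rule: canonical.induct) (use content_Arr in auto)
    show "val u z = val u w"
      by (rule main[OF a(2) f path_Arr[OF a(1)] path_Arr[OF a(2)] a(3)]) (use * ** in auto)
  qed
qed

end

section \<open>Groups isomorphic to members of a pseudovariety\<close>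

text \<open>The pseudovariety consists of groups over the natural numbers, whereas the maximal subgroups
  below have other types.\<close>
definition pv_group :: "nat monoid set \<Rightarrow> 'a monoid \<Rightarrow> bool" where
  "pv_group H K \<longleftrightarrow> group K \<and> (\<exists>G\<in>H. G \<cong> K)"

lemma group_nat_copy:
  assumes "group (K :: 'a monoid)" "finite (carrier K)"
  shows "\<exists>G :: nat monoid. group G \<and> K \<cong> G"
proof -
  interpret group K by fact
  obtain f :: "'a \<Rightarrow> nat" where f: "inj_on f (carrier K)"
    using finite_imp_inj_to_nat_seg[OF assms(2)] by blast
  define g where "g = inv_into (carrier K) f"
  define G :: "nat monoid" where "G = \<lparr>carrier = f ` carrier K, monoid.mult = (\<lambda>x y. f (g x \<otimes>\<^bsub>K\<^esub> g y)), one = f \<one>\<^bsub>K\<^esub>\<rparr>"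
  have g: "g (f x) = x" if "x \<in> carrier K" for x using f that by (simp add: g_def)
  have h: "f \<in> hom K G" by (auto simp: hom_def G_def g)
  have "group G"
  proof (rule groupI)
    show "\<exists>y\<in>carrier G. y \<otimes>\<^bsub>G\<^esub> x = \<one>\<^bsub>G\<^esub>" if x: "x \<in> carrier G" for x
    proof -
      obtain z where z: "x = f z" "z \<in> carrier K" using x by (auto simp: G_def)
      then have "f (inv\<^bsub>K\<^esub> z) \<otimes>\<^bsub>G\<^esub> x = \<one>\<^bsub>G\<^esub>" by (simp add: G_def g)
      then show ?thesis using z by (force simp: G_def)
    qed
  qed (auto simp: G_def g m_assoc)
  moreover have "f \<in> iso K G" using h f by (auto simp: iso_def bij_betw_def G_def)
  ultimately show ?thesis by (auto simp: is_iso_def)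
qed

context
  fixes H :: "nat monoid set"
  assumes H: "group_pseudovariety H"
begin

lemma pv_member_group: "G \<in> H \<Longrightarrow> group G \<and> finite (carrier G)"
  using H[unfolded group_pseudovariety_def, THEN conjunct1] by blast

lemma pv_member_subgroup: "G \<in> H \<Longrightarrow> subgroup B G \<Longrightarrow> G\<lparr>carrier := B\<rparr> \<in> H"
  using H[unfolded group_pseudovariety_def, THEN conjunct2, THEN conjunct1] by blast

lemma pv_member_epi: "G \<in> H \<Longrightarrow> group (K :: nat monoid) \<Longrightarrow> h \<in> epi G K \<Longrightarrow> K \<in> H"
  using H[unfolded group_pseudovariety_def, THEN conjunct2, THEN conjunct2, THEN conjunct1] by blast

lemma pv_member_product:
  "finite (I :: nat set) \<Longrightarrow> (\<And>i. i \<in> I \<Longrightarrow> G i \<in> H) \<Longrightarrow> group (K :: nat monoid) \<Longrightarrow>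
    K \<cong> product_group I G \<Longrightarrow> K \<in> H"
  using H[unfolded group_pseudovariety_def, THEN conjunct2, THEN conjunct2, THEN conjunct2] by blast

lemma pv_group_nat: assumes "pv_group H (K :: nat monoid)" shows "K \<in> H"
proof -
  obtain G f where G: "G \<in> H" "f \<in> iso G K" "group K" using assms by (auto simp: pv_group_def is_iso_def)
  then have "f \<in> epi G K" by (auto simp: iso_def epi_def bij_betw_def)
  then show ?thesis using pv_member_epi G by blast
qed

lemma pv_group_finite: assumes "pv_group H K" shows "finite (carrier K)"
proof -
  obtain G f where "G \<in> H" "f \<in> iso G K" using assms by (auto simp: pv_group_def is_iso_def)
  then have "bij_betw f (carrier G) (carrier K)" "finite (carrier G)" using pv_member_group by (auto simp: iso_def)
  then show ?thesis using bij_betw_finite by metis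
qed

lemma pv_group_image:
  assumes "pv_group H K" "group K'" "h \<in> epi K K'"
  shows "pv_group H K'"
proof -
  obtain G f where G: "G \<in> H" "f \<in> iso G K" using assms by (auto simp: pv_group_def is_iso_def)
  have hs: "h \<in> hom K K'" "h ` carrier K = carrier K'" using assms by (auto simp: epi_def)
  have "finite (carrier K')" using pv_group_finite[OF assms(1)] hs finite_imageI by metis
  then obtain G' :: "nat monoid" where G': "group G'" "K' \<cong> G'" using group_nat_copy assms(2) by blast
  then obtain k where k: "k \<in> iso K' G'" by (auto simp: is_iso_def)
  have fk: "f \<in> epi G K" "k \<in> epi K' G'" using G k by (auto simp: iso_def epi_def bij_betw_def)
  have "k \<circ> (h \<circ> f) \<in> epi G G'" by (rule epi_compose[OF epi_compose[OF fk(1) assms(3)] fk(2)])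
  then have "G' \<in> H" using pv_member_epi G G' by blast
  moreover have "G' \<cong> K'" using G'(2) group.iso_sym assms(2) by blast
  ultimately show ?thesis using assms(2) unfolding pv_group_def by blast
qed

lemma pv_group_sub: assumes "pv_group H K" "subgroup A K" shows "pv_group H (K\<lparr>carrier := A\<rparr>)"
proof -
  have gK: "group K" using assms by (simp add: pv_group_def)
  obtain G f where G: "G \<in> H" "f \<in> iso G K" using assms by (auto simp: pv_group_def is_iso_def)
  have gG: "group G" using G pv_member_group by blast
  have fh: "f \<in> hom G K" and fb: "bij_betw f (carrier G) (carrier K)" using G(2) by (auto simp: iso_def)
  define B where "B = {x \<in> carrier G. f x \<in> A}"
  interpret group_hom G K f using gG gK fh by (simp add: group_hom_def group_hom_axioms_def)
  have sB: "subgroup B G"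
    by (rule G.subgroupI) (use subgroup.one_closed[OF assms(2)] subgroup.m_closed[OF assms(2)] subgroup.m_inv_closed[OF assms(2)]
      in \<open>auto simp: B_def intro!: exI[of _ "\<one>\<^bsub>G\<^esub>"]\<close>)
  have "G\<lparr>carrier := B\<rparr> \<in> H" using pv_member_subgroup G(1) sB by blast
  moreover have "f \<in> iso (G\<lparr>carrier := B\<rparr>) (K\<lparr>carrier := A\<rparr>)"
  proof -
    have fi: "inj_on f (carrier G)" "f ` carrier G = carrier K" using fb by (simp_all add: bij_betw_def)
    have "A \<subseteq> carrier K" using subgroup.subset[OF assms(2)] .
    then have "f ` B = A" unfolding B_def fi(2)[symmetric] by auto
    moreover have "inj_on f B" using fi(1) by (rule inj_on_subset) (simp add: B_def)
    moreover have "f \<in> hom (G\<lparr>carrier := B\<rparr>) (K\<lparr>carrier := A\<rparr>)"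
      using hom_mult by (auto simp: hom_def B_def)
    ultimately show ?thesis by (simp add: iso_def bij_betw_def)
  qed
  ultimately show ?thesis using group.subgroup_imp_group[OF gK assms(2)] unfolding pv_group_def is_iso_def by blast
qed

text \<open>The product closure of \<open>H\<close> is restricted to index sets of natural numbers, which is why \<open>I\<close>
  is enumerated first.\<close>
lemma pv_group_product:
  fixes I :: "'i set"
  assumes "finite I" "\<And>i. i \<in> I \<Longrightarrow> pv_group H (K i)"
  shows "pv_group H (product_group I K)"
proof -
  have g: "group (product_group I K)" by (rule product_group) (use assms in \<open>simp add: pv_group_def\<close>)
  obtain b :: "nat \<Rightarrow> 'i" and n where b: "bij_betw b {..<n} I"
    using ex_bij_betw_nat_finite[OF assms(1)] lessThan_atLeast0 by metis
  have "\<forall>i\<in>I. \<exists>G f. G \<in> H \<and> f \<in> iso G (K i)"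
    using assms(2) unfolding pv_group_def is_iso_def by blast
  then obtain G f where Gf: "\<And>i. i \<in> I \<Longrightarrow> G i \<in> H \<and> f i \<in> iso (G i) (K i)" by metis
  have bI: "b j \<in> I" if "j < n" for j using b that by (auto simp: bij_betw_def)
  define P where "P = product_group {..<n} (\<lambda>j. G (b j))"
  have Gb: "group (G (b j))" "finite (carrier (G (b j)))" if "j < n" for j using Gf[OF bI[OF that]] pv_member_group by auto
  have gP: "group P" unfolding P_def by (rule product_group) (use Gb in auto)
  have fP: "finite (carrier P)" unfolding P_def using Gb by (auto intro!: finite_PiE)
  obtain P' :: "nat monoid" where P': "group P'" "P \<cong> P'" using group_nat_copy gP fP by blast
  have "P' \<cong> P" using P' gP group.iso_sym by blast
  have "P' \<in> H"
    by (rule pv_member_product[OF _ _ P'(1) \<open>P' \<cong> P\<close>[unfolded P_def]]) (use Gf bI in auto)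
  then have iP: "pv_group H P" using gP \<open>P' \<cong> P\<close> unfolding pv_group_def by blast
  define c where "c = inv_into {..<n} b"
  have c: "c i < n" "b (c i) = i" if "i \<in> I" for i
  proof -
    have "i \<in> b ` {..<n}" using that b by (simp add: bij_betw_def)
    then show "c i < n" "b (c i) = i" unfolding c_def using inv_into_into[of i b "{..<n}"] by (simp_all add: f_inv_into_f)
  qed
  have cb: "c (b j) = j" if "j < n" for j using that b unfolding c_def bij_betw_def by simp
  define \<phi> where "\<phi> = (\<lambda>x. \<lambda>i\<in>I. f i (x (c i)))"
  have h: "\<phi> \<in> hom P (product_group I K)"
  proof (rule homI)
    fix x assume x: "x \<in> carrier P"
    have "f i (x (c i)) \<in> carrier (K i)" if "i \<in> I" for i
    proof -
      have "x (c i) \<in> carrier (G i)" using x c[OF that] unfolding P_def by (auto simp: PiE_iff) force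
      then show ?thesis using Gf[OF that] by (auto simp: iso_def hom_def)
    qed
    then show "\<phi> x \<in> carrier (product_group I K)" by (auto simp: \<phi>_def)
  next
    fix x y assume x: "x \<in> carrier P" and y: "y \<in> carrier P"
    have "f i ((x \<otimes>\<^bsub>P\<^esub> y) (c i)) = f i (x (c i)) \<otimes>\<^bsub>K i\<^esub> f i (y (c i))" if "i \<in> I" for i
    proof -
      have "x (c i) \<in> carrier (G i)" "y (c i) \<in> carrier (G i)"
        using x y c[OF that] unfolding P_def by (auto simp: PiE_iff) force+
      then show ?thesis using Gf[OF that] c[OF that] unfolding P_def by (auto simp: iso_def hom_def)
    qed
    then show "\<phi> (x \<otimes>\<^bsub>P\<^esub> y) = \<phi> x \<otimes>\<^bsub>product_group I K\<^esub> \<phi> y"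
      by (auto simp: \<phi>_def restrict_def)
  qed
  have "\<exists>x\<in>carrier P. \<phi> x = y" if y: "y \<in> carrier (product_group I K)" for y
  proof -
    define x where "x = (\<lambda>j\<in>{..<n}. inv_into (carrier (G (b j))) (f (b j)) (y (b j)))"
    have *: "inv_into (carrier (G i)) (f i) (y i) \<in> carrier (G i) \<and> f i (inv_into (carrier (G i)) (f i) (y i)) = y i" if "i \<in> I" for i
    proof -
      have "y i \<in> f i ` carrier (G i)" using y that Gf[OF that] by (auto simp: iso_def bij_betw_def PiE_iff)
      then show ?thesis by (simp add: f_inv_into_f inv_into_into)
    qed
    have "x \<in> carrier P" unfolding P_def x_def using * bI by auto
    moreover have "\<phi> x = y"
    proof
      fix i show "\<phi> x i = y i"
      proof (cases "i \<in> I")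
        case True
        then show ?thesis using * c by (simp add: \<phi>_def x_def)
      next
        case False
        then show ?thesis using y by (auto simp: \<phi>_def PiE_iff extensional_def)
      qed
    qed
    ultimately show ?thesis by blast
  qed
  then have "\<phi> ` carrier P = carrier (product_group I K)" using h unfolding hom_def by blast
  then have "\<phi> \<in> epi P (product_group I K)" using h by (simp add: epi_def)
  then show ?thesis using pv_group_image iP g by blast
qed

end

section \<open>Semigroups with commuting idempotents and regular elements in subgroups\<close>

text \<open>The maximal subgroup at an idempotent \<open>e\<close>.\<close>
definition unit_group :: "'a sgrp \<Rightarrow> 'a \<Rightarrow> 'a monoid" where
  "unit_group S e = \<lparr>carrier = {x \<in> carrier S. smul S e x = x \<and> smul S x e = x \<and>
      (\<exists>y\<in>carrier S. smul S e y = y \<and> smul S y e = y \<and> smul S x y = e \<and> smul S y x = e)},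
     monoid.mult = smul S, one = e\<rparr>"

text \<open>The description of \<open>DH H \<inter> ECom\<close> without J-classes, for semigroups over an arbitrary type.\<close>
definition dh_ecom :: "nat monoid set \<Rightarrow> 'a sgrp \<Rightarrow> bool" where
  "dh_ecom H S \<longleftrightarrow> fin_semigroup S \<and>
     (\<forall>e f. idempotent_element S e \<longrightarrow> idempotent_element S f \<longrightarrow> smul S e f = smul S f e) \<and>
     (\<forall>x. regular_element S x \<longrightarrow> (\<exists>e. idempotent_element S e \<and> x \<in> carrier (unit_group S e))) \<and>
     (\<forall>e. idempotent_element S e \<longrightarrow> pv_group H (unit_group S e))"

lemma dh_ecomD:
  assumes "dh_ecom H S"
  shows "fin_semigroup S"
    "idempotent_element S e \<Longrightarrow> idempotent_element S f \<Longrightarrow> smul S e f = smul S f e"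
    "regular_element S x \<Longrightarrow> \<exists>e. idempotent_element S e \<and> x \<in> carrier (unit_group S e)"
    "idempotent_element S e \<Longrightarrow> pv_group H (unit_group S e)"
  using assms unfolding dh_ecom_def by blast+

lemma mult_unit_group [simp]: "x \<otimes>\<^bsub>unit_group S e\<^esub> y = smul S x y" "one (unit_group S e) = e"
  by (simp_all add: unit_group_def)

lemma in_unit_group:
  "x \<in> carrier (unit_group S e) \<longleftrightarrow> x \<in> carrier S \<and> smul S e x = x \<and> smul S x e = x \<and>
      (\<exists>y\<in>carrier S. smul S e y = y \<and> smul S y e = y \<and> smul S x y = e \<and> smul S y x = e)"
  by (simp add: unit_group_def)

text \<open>The exponent is shifted by one, \<open>spow S x n\<close> is \<open>x\<^sup>n\<^sup>+\<^sup>1\<close>, as there is no identity.\<close>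
definition spow :: "'a sgrp \<Rightarrow> 'a \<Rightarrow> nat \<Rightarrow> 'a" where "spow S x n = (smul S x ^^ n) x"

locale finite_semigroup =
  fixes S :: "'a sgrp" (structure)
  assumes fs: "fin_semigroup S"
begin

abbreviation smult (infixl "\<odot>" 70) where "x \<odot> y \<equiv> smul S x y"

lemma fin: "finite (carrier S)" using fs by (simp add: fin_semigroup_def)
lemma closed [intro, simp]: "x \<in> carrier S \<Longrightarrow> y \<in> carrier S \<Longrightarrow> x \<odot> y \<in> carrier S"
  using fs by (simp add: fin_semigroup_def)
lemma assoc: "x \<in> carrier S \<Longrightarrow> y \<in> carrier S \<Longrightarrow> z \<in> carrier S \<Longrightarrow> (x \<odot> y) \<odot> z = x \<odot> (y \<odot> z)"
  using fs by (simp add: fin_semigroup_def)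

lemma spow_simps [simp]: "spow S x 0 = x" "spow S x (Suc n) = x \<odot> spow S x n"
  by (simp_all add: spow_def)

lemma spow_closed [simp]: "x \<in> carrier S \<Longrightarrow> spow S x n \<in> carrier S"
  by (induction n) auto

lemma spow_add: "x \<in> carrier S \<Longrightarrow> spow S x m \<odot> spow S x n = spow S x (Suc (m + n))"
  by (induction m) (auto simp: assoc)

lemma spow_idem: assumes "x \<in> carrier S" shows "\<exists>n. idempotent_element S (spow S x n)"
proof -
  obtain N :: nat where N: "\<forall>f. (\<forall>i j. i < j \<and> j < N \<longrightarrow> f i j \<in> carrier S) \<longrightarrow>
     (\<exists>i j k. i < j \<and> j < k \<and> k < N \<and> f i j = f j k \<and> f i k = f j k)"
    using Ramsey_triple[OF fin] by blast
  let ?f = "\<lambda>i j. spow S x (j - Suc i)"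
  obtain i j k where ijk: "i < j" "j < k" "?f i j = ?f j k" "?f i k = ?f j k"
    using N[rule_format, of ?f] assms by auto
  have "Suc ((j - Suc i) + (k - Suc j)) = k - Suc i" using ijk by simp
  then have "?f i j \<odot> ?f j k = ?f i k" using spow_add[OF assms, of "j - Suc i" "k - Suc j"] by metis
  then have "?f j k \<odot> ?f j k = ?f j k" using ijk by simp
  then show ?thesis using assms unfolding idempotent_element_def by auto
qed

lemma unit_group_group: assumes "idempotent_element S e" shows "group (unit_group S e)"
proof (rule groupI)
  have e: "e \<in> carrier S" "e \<odot> e = e" using assms by (auto simp: idempotent_element_def)
  fix x y z assume x: "x \<in> carrier (unit_group S e)" and y: "y \<in> carrier (unit_group S e)" and z: "z \<in> carrier (unit_group S e)"
  have xS: "x \<in> carrier S" "e \<odot> x = x" "x \<odot> e = x" and yS: "y \<in> carrier S" "e \<odot> y = y" "y \<odot> e = y" and zS: "z \<in> carrier S"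
    using x y z by (simp_all add: in_unit_group)
  obtain x' where x': "x' \<in> carrier S" "e \<odot> x' = x'" "x' \<odot> e = x'" "x \<odot> x' = e" "x' \<odot> x = e" using x by (auto simp: in_unit_group)
  obtain y' where y': "y' \<in> carrier S" "e \<odot> y' = y'" "y' \<odot> e = y'" "y \<odot> y' = e" "y' \<odot> y = e" using y by (auto simp: in_unit_group)
  have 1: "(x \<odot> y) \<odot> (y' \<odot> x') = x \<odot> ((y \<odot> y') \<odot> x')" using xS yS x'(1) y'(1) by (simp add: assoc)
  have 2: "(y' \<odot> x') \<odot> (x \<odot> y) = y' \<odot> ((x' \<odot> x) \<odot> y)" using xS yS x'(1) y'(1) by (simp add: assoc)
  have 3: "e \<odot> (x \<odot> y) = x \<odot> y" "e \<odot> (y' \<odot> x') = y' \<odot> x'"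
    using e xS yS x' y' by (simp_all add: assoc[symmetric])
  have 4: "(x \<odot> y) \<odot> e = x \<odot> y" "(y' \<odot> x') \<odot> e = y' \<odot> x'"
    using e xS yS x' y' by (simp_all add: assoc)
  have "(x \<odot> y) \<odot> (y' \<odot> x') = e" "(y' \<odot> x') \<odot> (x \<odot> y) = e"
    unfolding 1 2 using x' y' yS by simp_all
  then show "x \<otimes>\<^bsub>unit_group S e\<^esub> y \<in> carrier (unit_group S e)"
    using 3 4 xS yS x' y' closed unfolding mult_unit_group in_unit_group by blast
  show "x \<otimes>\<^bsub>unit_group S e\<^esub> y \<otimes>\<^bsub>unit_group S e\<^esub> z = x \<otimes>\<^bsub>unit_group S e\<^esub> (y \<otimes>\<^bsub>unit_group S e\<^esub> z)"
    using xS yS zS by (simp add: assoc)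
  show "\<one>\<^bsub>unit_group S e\<^esub> \<otimes>\<^bsub>unit_group S e\<^esub> x = x" using xS by simp
  have "x' \<in> carrier (unit_group S e)" using x' xS unfolding in_unit_group by blast
  then show "\<exists>y\<in>carrier (unit_group S e). y \<otimes>\<^bsub>unit_group S e\<^esub> x = \<one>\<^bsub>unit_group S e\<^esub>"
    using x' by auto
next
  show "\<one>\<^bsub>unit_group S e\<^esub> \<in> carrier (unit_group S e)"
    using assms by (auto simp: in_unit_group idempotent_element_def)
qed

lemma unit_group_idem: assumes "x \<in> carrier (unit_group S e)" "idempotent_element S e" "x \<odot> x = x" shows "x = e"
proof -
  interpret group "unit_group S e" using unit_group_group assms by blast
  show ?thesis using assms(1,3) l_cancel_one[of x x] by simp
qed

lemma unit_group_spow: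
  assumes e: "idempotent_element S e" and x: "x \<in> carrier (unit_group S e)" "idempotent_element S (spow S x n)"
  shows "spow S x n = e"
proof -
  interpret group "unit_group S e" using unit_group_group e by blast
  have "spow S x n \<in> carrier (unit_group S e)" using m_closed x(1) by (induction n) auto
  then show ?thesis using unit_group_idem e x(2) by (auto simp: idempotent_element_def)
qed

text \<open>If \<open>x\<^sup>n\<^sup>+\<^sup>1 = e\<close>, then \<open>x\<^sup>2\<^sup>n\<^sup>+\<^sup>1\<close> is an inverse of \<open>x\<close>.\<close>
lemma in_unit_groupI:
  assumes e: "idempotent_element S e" and x: "x \<in> carrier S" "e \<odot> x = x" "x \<odot> e = x" "spow S x n = e"
  shows "x \<in> carrier (unit_group S e)"
proof -
  let ?y = "spow S x (n + n)"
  have y: "?y \<in> carrier S" using x by simp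
  have ee: "e \<in> carrier S" "e \<odot> e = e" using e by (auto simp: idempotent_element_def)
  have "x \<odot> ?y = spow S x n \<odot> spow S x n" using spow_add[OF x(1)] by simp
  then have 1: "x \<odot> ?y = e" using x(4) ee by simp
  have "?y \<odot> x = spow S x n \<odot> spow S x n" using spow_add[OF x(1), of "n + n" 0] spow_add[OF x(1), of n n] by simp
  then have 2: "?y \<odot> x = e" using x(4) ee by simp
  have 3: "e \<odot> spow S x k = spow S x k \<and> spow S x k \<odot> e = spow S x k" for k
  proof (induction k)
    case (Suc k)
    have "e \<odot> (x \<odot> spow S x k) = x \<odot> spow S x k" using x ee by (simp add: assoc[symmetric])
    moreover have "(x \<odot> spow S x k) \<odot> e = x \<odot> spow S x k" using x ee Suc by (simp add: assoc)
    ultimately show ?case by simp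
  qed (use x in simp)
  show ?thesis unfolding in_unit_group using x y 1 2 3 by blast
qed

end

lemma dh_ecom_finite_semigroup: "dh_ecom H S \<Longrightarrow> finite_semigroup S"
  by (simp add: finite_semigroup_def dh_ecom_def)

section \<open>Closure under subsemigroups, images and products\<close>

lemma fin_semigroup_sub: "fin_semigroup S \<Longrightarrow> subsemigroup A S \<Longrightarrow> fin_semigroup (S\<lparr>carrier := A\<rparr>)"
  unfolding fin_semigroup_def subsemigroup_def by (auto intro: finite_subset simp: subset_iff)

text \<open>Idempotents and inverses are powers, so they stay inside a subsemigroup.\<close>
lemma dh_ecom_sub:
  assumes H: "group_pseudovariety H" and S: "dh_ecom H S" and A: "subsemigroup A S"
  shows "dh_ecom H (S\<lparr>carrier := A\<rparr>)"
proof -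
  let ?T = "S\<lparr>carrier := A\<rparr>"
  have fT: "fin_semigroup ?T" using fin_semigroup_sub dh_ecomD(1)[OF S] A by blast
  interpret S: finite_semigroup S using dh_ecom_finite_semigroup S .
  interpret T: finite_semigroup ?T using fT by (simp add: finite_semigroup_def)
  have AS: "A \<subseteq> carrier S" using A by (simp add: subsemigroup_def)
  have idem: "idempotent_element S e" if "idempotent_element ?T e" for e
    using that AS by (auto simp: idempotent_element_def)
  have sp: "spow ?T x n = spow S x n" for x n by (simp add: spow_def)
  show ?thesis unfolding dh_ecom_def
  proof (intro conjI allI impI)
    show "fin_semigroup ?T" by (rule fT)
    show "smul ?T e f = smul ?T f e" if "idempotent_element ?T e" "idempotent_element ?T f" for e f
      using dh_ecomD(2)[OF S idem[OF that(1)] idem[OF that(2)]] by simp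
  next
    fix x assume x: "regular_element ?T x"
    then have xA: "x \<in> A" by (simp add: regular_element_def)
    have "regular_element S x" using x AS by (auto simp: regular_element_def)
    then obtain e where e: "idempotent_element S e" "x \<in> carrier (unit_group S e)" using dh_ecomD(3)[OF S] by blast
    obtain n where n: "idempotent_element ?T (spow ?T x n)" using T.spow_idem[of x] xA by auto
    then have "idempotent_element S (spow S x n)" using idem sp by simp
    then have "spow S x n = e" using S.unit_group_spow e by blast
    then have "idempotent_element ?T e" "spow ?T x n = e" using n sp by auto
    moreover have "smul S e x = x" "smul S x e = x" using e(2) by (simp_all add: in_unit_group)
    ultimately have "x \<in> carrier (unit_group ?T e)" using T.in_unit_groupI[of e x n] xA by simp
    then show "\<exists>e. idempotent_element ?T e \<and> x \<in> carrier (unit_group ?T e)"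
      using \<open>idempotent_element ?T e\<close> by blast
  next
    fix e assume e: "idempotent_element ?T e"
    have gS: "pv_group H (unit_group S e)" using dh_ecomD(4)[OF S idem[OF e]] .
    have eq: "unit_group ?T e = (unit_group S e)\<lparr>carrier := carrier (unit_group ?T e)\<rparr>"
      by (simp add: unit_group_def)
    have "group ((unit_group S e)\<lparr>carrier := carrier (unit_group ?T e)\<rparr>)"
      using T.unit_group_group[OF e] eq by simp
    moreover have "carrier (unit_group ?T e) \<subseteq> carrier (unit_group S e)"
    proof
      fix x assume "x \<in> carrier (unit_group ?T e)"
      then show "x \<in> carrier (unit_group S e)" using AS unfolding in_unit_group by auto
    qed
    moreover have "group (unit_group S e)" using gS by (simp add: pv_group_def)
    ultimately have "subgroup (carrier (unit_group ?T e)) (unit_group S e)"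
      using group.group_incl_imp_subgroup by blast
    then show "pv_group H (unit_group ?T e)" using pv_group_sub[OF H gS] eq by metis
  qed
qed

text \<open>Idempotents and regular elements lift along surjections of finite semigroups. For the
  maximal subgroups, choose the least idempotent \<open>e\<close> over \<open>f\<close>; it exists because idempotents
  commute. If \<open>x\<close> is a preimage of a unit at \<open>f\<close>, then a power of \<open>e x e\<close> is an idempotent over \<open>f\<close>
  below \<open>e\<close>, hence equal to \<open>e\<close>. So the maximal subgroup at \<open>e\<close> is mapped onto the one at \<open>f\<close>.\<close>
lemma dh_ecom_image:
  assumes H: "group_pseudovariety H" and S: "dh_ecom H S" and T: "fin_semigroup T"
    and h: "h \<in> sgrp_hom S T" "h ` carrier S = carrier T"
  shows "dh_ecom H T"
proof -
  interpret S: finite_semigroup S using dh_ecom_finite_semigroup S .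
  interpret T: finite_semigroup T using T by (simp add: finite_semigroup_def)
  have hm: "h (smul S x y) = smul T (h x) (h y)" if "x \<in> carrier S" "y \<in> carrier S" for x y
    using h(1) that by (simp add: sgrp_hom_def)
  have hc: "h x \<in> carrier T" if "x \<in> carrier S" for x using that h(2) by blast
  have pre: "\<exists>x\<in>carrier S. h x = y" if "y \<in> carrier T" for y
    using that unfolding h(2)[symmetric] by auto
  have hp: "h (spow S x n) = spow T (h x) n" if "x \<in> carrier S" for x n
    using that by (induction n) (auto simp: hm)
  have hid: "idempotent_element T (h e)" if "idempotent_element S e" for e
    using that hc hm[of e e] by (auto simp: idempotent_element_def)
  have Tsp: "spow T y n = y" if "idempotent_element T y" for y n
    using that by (induction n) (auto simp: idempotent_element_def)
  have hun: "h x \<in> carrier (unit_group T (h e))" if x: "x \<in> carrier (unit_group S e)" and e: "e \<in> carrier S" for x e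
  proof -
    obtain y where y: "y \<in> carrier S" "smul S e y = y" "smul S y e = y" "smul S x y = e" "smul S y x = e"
      and x': "x \<in> carrier S" "smul S e x = x" "smul S x e = x" using x unfolding in_unit_group by blast
    show ?thesis unfolding in_unit_group
      by (intro conjI bexI[of _ "h y"]) (simp_all add: y x' hc e flip: hm)
  qed
  have lift: "\<exists>e. idempotent_element S e \<and> h e = f" if f: "idempotent_element T f" for f
  proof -
    obtain x where x: "x \<in> carrier S" "h x = f" using f pre[of f] by (auto simp: idempotent_element_def)
    obtain n where n: "idempotent_element S (spow S x n)" using S.spow_idem x by blast
    have "h (spow S x n) = f" using hp[OF x(1)] x(2) Tsp[OF f] by simp
    then show ?thesis using n by blast
  qed
  show ?thesis unfolding dh_ecom_def
  proof (intro conjI allI impI)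
    show "fin_semigroup T" by (rule T)
  next
    fix e f assume "idempotent_element T e" "idempotent_element T f"
    then obtain e' f' where ef: "idempotent_element S e'" "h e' = e" "idempotent_element S f'" "h f' = f"
      using lift by metis
    then have "smul S e' f' = smul S f' e'" using dh_ecomD(2)[OF S] by blast
    then show "smul T e f = smul T f e"
      using hm[of e' f'] hm[of f' e'] ef by (simp add: idempotent_element_def)
  next
    fix y assume "regular_element T y"
    then obtain z where yz: "y \<in> carrier T" "z \<in> carrier T" "smul T (smul T y z) y = y"
      by (auto simp: regular_element_def)
    obtain x w where xw: "x \<in> carrier S" "h x = y" "w \<in> carrier S" "h w = z" using pre[OF yz(1)] pre[OF yz(2)] by auto
    define p where "p = smul S x w"
    have p: "p \<in> carrier S" "h p = smul T y z" using xw hm by (auto simp: p_def)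
    have pyz: "idempotent_element T (smul T y z)" using yz by (simp add: idempotent_element_def T.assoc[symmetric])
    obtain n where n: "idempotent_element S (spow S p n)" using S.spow_idem p by blast
    define e where "e = spow S p n"
    define a where "a = smul S e x"
    have e: "e \<in> carrier S" "smul S e e = e" "h e = smul T y z"
      using n hp[OF p(1)] p(2) Tsp[OF pyz] by (auto simp: e_def idempotent_element_def)
    have a: "a \<in> carrier S" "h a = y" "smul S e a = a" using e xw hm[OF e(1) xw(1)] yz
      by (auto simp: a_def S.assoc[symmetric])
    have "smul S a (smul S w (spow S p (n + n))) = smul S e (smul S p (spow S p (n + n)))"
      using e xw p by (simp add: a_def p_def S.assoc)
    also have "smul S p (spow S p (n + n)) = smul S e e" unfolding e_def using S.spow_add[OF p(1)] by simp
    finally have "smul S a (smul S w (spow S p (n + n))) = e" using e by simp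
    then have "regular_element S a" unfolding regular_element_def using a xw p by auto
    then obtain g where g: "idempotent_element S g" "a \<in> carrier (unit_group S g)" using dh_ecomD(3)[OF S] by blast
    then have "h a \<in> carrier (unit_group T (h g))" using hun by (simp add: idempotent_element_def)
    then show "\<exists>e. idempotent_element T e \<and> y \<in> carrier (unit_group T e)" using a(2) hid[OF g(1)] by blast
  next
    fix f assume f: "idempotent_element T f"
    define E where "E = {e. idempotent_element S e}"
    have fE: "finite E" using S.fin by (rule finite_subset[rotated]) (auto simp: E_def idempotent_element_def)
    \<comment> \<open>Counting the idempotents below an idempotent finds the least one over \<open>f\<close>.\<close>
    define below where "below e = {g \<in> E. smul S e g = g}" for e
    obtain e where e: "idempotent_element S e" "h e = f"
      and mn: "\<And>g. idempotent_element S g \<Longrightarrow> h g = f \<Longrightarrow> card (below e) \<le> card (below g)"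
      using ex_has_least_nat[of "\<lambda>e. idempotent_element S e \<and> h e = f" _ "\<lambda>e. card (below e)"] lift[OF f] by blast
    have eS: "e \<in> carrier S" "smul S e e = e" using e by (auto simp: idempotent_element_def)
    have fT: "f \<in> carrier T" "smul T f f = f" using f by (auto simp: idempotent_element_def)
    have min: "g = e" if g: "idempotent_element S g" "h g = f" "smul S e g = g" for g
    proof (rule ccontr)
      assume ne: "g \<noteq> e"
      have gS: "g \<in> carrier S" using g by (simp add: idempotent_element_def)
      have "smul S g e = g" using dh_ecomD(2)[OF S g(1) e(1)] g(3) by simp
      then have "e \<notin> below g" using ne by (simp add: below_def)
      moreover have "e \<in> below e" using e eS by (simp add: below_def E_def)
      moreover have "below g \<subseteq> below e"
      proof
        fix k assume k: "k \<in> below g"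
        then have kS: "k \<in> carrier S" "smul S g k = k" by (auto simp: below_def E_def idempotent_element_def)
        have "smul S e k = smul S (smul S e g) k" using kS gS eS by (simp add: S.assoc)
        then show "k \<in> below e" using k g(3) kS by (simp add: below_def)
      qed
      ultimately have "below g \<subset> below e" by blast
      moreover have "finite (below e)" using fE by (simp add: below_def)
      ultimately show False using psubset_card_mono mn[OF g(1,2)] by (meson not_le)
    qed
    have gS: "pv_group H (unit_group S e)" using dh_ecomD(4)[OF S e(1)] .
    have "h \<in> hom (unit_group S e) (unit_group T f)"
    proof (rule homI)
      fix x y assume "x \<in> carrier (unit_group S e)" "y \<in> carrier (unit_group S e)"
      then show "h (x \<otimes>\<^bsub>unit_group S e\<^esub> y) = h x \<otimes>\<^bsub>unit_group T f\<^esub> h y" using hm by (simp add: in_unit_group)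
    qed (use hun eS e in blast)
    moreover have "y \<in> h ` carrier (unit_group S e)" if y: "y \<in> carrier (unit_group T f)" for y
    proof -
      have yT: "y \<in> carrier T" "smul T f y = y" "smul T y f = y" using y by (simp_all add: in_unit_group)
      obtain x where x: "x \<in> carrier S" "h x = y" using pre[OF yT(1)] by auto
      define a where "a = smul S (smul S e x) e"
      have a: "a \<in> carrier S" "smul S e a = a" "smul S a e = a" using x eS by (auto simp: a_def S.assoc) (auto simp: S.assoc[symmetric])
      have ha: "h a = y" using x eS e yT by (simp add: a_def hm)
      obtain n where n: "idempotent_element S (spow S a n)" using S.spow_idem a by blast
      have "h (spow S a n) = spow T y n" using hp a ha by simp
      also have "\<dots> = f" using hid[OF n] T.unit_group_spow[OF f y] hp[OF a(1)] ha by simp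
      finally have "h (spow S a n) = f" .
      moreover have "smul S e (spow S a n) = spow S a n"
        using a eS by (cases n) (simp_all add: S.assoc[symmetric])
      ultimately have "spow S a n = e" using min[OF n] by blast
      then have "a \<in> carrier (unit_group S e)" using S.in_unit_groupI[OF e(1) a] by blast
      then show ?thesis using ha by blast
    qed
    ultimately have "h \<in> epi (unit_group S e) (unit_group T f)"
      unfolding epi_def using hom_in_carrier[of h "unit_group S e" "unit_group T f"] by auto
    then show "pv_group H (unit_group T f)" using pv_group_image[OF H gS T.unit_group_group[OF f]] by blast
  qed
qed

lemma dh_ecom_embed:
  assumes H: "group_pseudovariety H" and T: "dh_ecom H T" and X: "fin_semigroup X"
    and h: "h \<in> sgrp_hom X T" "inj_on h (carrier X)"
  shows "dh_ecom H X"
proof -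
  interpret X: finite_semigroup X using X by (simp add: finite_semigroup_def)
  let ?A = "h ` carrier X"
  have hm: "h (smul X x y) = smul T (h x) (h y)" if "x \<in> carrier X" "y \<in> carrier X" for x y
    using h(1) that by (simp add: sgrp_hom_def)
  have A: "subsemigroup ?A T"
    unfolding subsemigroup_def
  proof (intro conjI ballI)
    show "?A \<noteq> {}" using X by (auto simp: fin_semigroup_def)
    show "?A \<subseteq> carrier T" using h(1) by (simp add: sgrp_hom_def)
    fix x y assume "x \<in> ?A" "y \<in> ?A"
    then obtain a b where "x = h a" "y = h b" "a \<in> carrier X" "b \<in> carrier X" by blast
    then show "smul T x y \<in> ?A" using hm[of a b] by (auto intro!: image_eqI[of _ _ "smul X a b"])
  qed
  let ?g = "inv_into (carrier X) h"
  have g: "?g (h x) = x" if "x \<in> carrier X" for x using h(2) that by simp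
  have "?g \<in> sgrp_hom (T\<lparr>carrier := ?A\<rparr>) X"
    unfolding sgrp_hom_def using g by (auto simp flip: hm)
  moreover have "?g ` carrier (T\<lparr>carrier := ?A\<rparr>) = carrier X" using g by (auto simp: image_image)
  ultimately show ?thesis using dh_ecom_image[OF H dh_ecom_sub[OF H T A] X] by blast
qed

lemma smul_product: "smul (sgrp_product I S) x y = (\<lambda>i\<in>I. smul (S i) (x i) (y i))"
  by (simp add: sgrp_product_def)

lemma carrier_product: "carrier (sgrp_product I S) = (\<Pi>\<^sub>E i\<in>I. carrier (S i))"
  by (simp add: sgrp_product_def)

text \<open>Idempotents, regular elements and maximal subgroups of a product are formed componentwise.\<close>
lemma dh_ecom_product:
  fixes I :: "'i set"
  assumes H: "group_pseudovariety H" and I: "finite I" and S: "\<And>i. i \<in> I \<Longrightarrow> dh_ecom H (S i)"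
  shows "dh_ecom H (sgrp_product I S)"
proof -
  let ?P = "sgrp_product I S"
  have fs: "finite_semigroup (S i)" if "i \<in> I" for i using dh_ecom_finite_semigroup S[OF that] .
  note fin = finite_semigroup.fin[OF fs] and cl = finite_semigroup.closed[OF fs] and as = finite_semigroup.assoc[OF fs]
  have ne: "carrier (S i) \<noteq> {}" if "i \<in> I" for i using dh_ecomD(1)[OF S[OF that]] by (simp add: fin_semigroup_def)
  have xi: "x i \<in> carrier (S i)" if "x \<in> carrier ?P" "i \<in> I" for x i using that by (auto simp: carrier_product)
  have xe: "x \<in> extensional I" if "x \<in> carrier ?P" for x using that by (auto simp: carrier_product PiE_def)
  have fP: "fin_semigroup ?P"
    unfolding fin_semigroup_def
  proof (intro conjI ballI)
    show "finite (carrier ?P)" unfolding carrier_product using I fin by (intro finite_PiE)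
    show "carrier ?P \<noteq> {}" unfolding carrier_product using ne by (simp add: PiE_eq_empty_iff)
    fix x y assume x: "x \<in> carrier ?P" and y: "y \<in> carrier ?P"
    show "smul ?P x y \<in> carrier ?P" unfolding carrier_product smul_product using cl xi[OF x] xi[OF y] by auto
    fix z assume z: "z \<in> carrier ?P"
    show "smul ?P (smul ?P x y) z = smul ?P x (smul ?P y z)"
      unfolding smul_product using as xi[OF x] xi[OF y] xi[OF z] by (auto intro!: restrict_ext)
  qed
  have id: "idempotent_element ?P e \<longleftrightarrow> e \<in> extensional I \<and> (\<forall>i\<in>I. idempotent_element (S i) (e i))" for e
  proof -
    have "((\<lambda>i\<in>I. smul (S i) (e i) (e i)) = e) \<longleftrightarrow> (\<forall>i\<in>I. smul (S i) (e i) (e i) = e i)" if "e \<in> extensional I"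
      using that by (auto intro!: extensionalityI[of _ I] dest: fun_cong[of _ e] simp: fun_eq_iff restrict_def extensional_def)
    then show ?thesis unfolding idempotent_element_def carrier_product smul_product by (auto simp: PiE_iff)
  qed
  have un: "carrier (unit_group ?P e) = (\<Pi>\<^sub>E i\<in>I. carrier (unit_group (S i) (e i)))" if e: "idempotent_element ?P e" for e
  proof (intro subset_antisym subsetI)
    fix x assume "x \<in> carrier (unit_group ?P e)"
    then obtain y where x: "x \<in> carrier ?P" "smul ?P e x = x" "smul ?P x e = x"
       and y: "y \<in> carrier ?P" "smul ?P e y = y" "smul ?P y e = y" "smul ?P x y = e" "smul ?P y x = e"
      unfolding in_unit_group by blast
    have "x i \<in> carrier (unit_group (S i) (e i))" if i: "i \<in> I" for i
      unfolding in_unit_group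
    proof (intro conjI bexI[of _ "y i"])
      show "x i \<in> carrier (S i)" "y i \<in> carrier (S i)" using xi x y i by auto
      show "smul (S i) (e i) (x i) = x i" using fun_cong[OF x(2), of i] i by (simp add: smul_product)
      show "smul (S i) (x i) (e i) = x i" using fun_cong[OF x(3), of i] i by (simp add: smul_product)
      show "smul (S i) (e i) (y i) = y i" using fun_cong[OF y(2), of i] i by (simp add: smul_product)
      show "smul (S i) (y i) (e i) = y i" using fun_cong[OF y(3), of i] i by (simp add: smul_product)
      show "smul (S i) (x i) (y i) = e i" using fun_cong[OF y(4), of i] i by (simp add: smul_product)
      show "smul (S i) (y i) (x i) = e i" using fun_cong[OF y(5), of i] i by (simp add: smul_product)
    qed
    then show "x \<in> (\<Pi>\<^sub>E i\<in>I. carrier (unit_group (S i) (e i)))" using xe[OF x(1)] by (auto simp: PiE_iff)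
  next
    fix x assume x: "x \<in> (\<Pi>\<^sub>E i\<in>I. carrier (unit_group (S i) (e i)))"
    have ee: "e \<in> extensional I" using e id by blast
    have "\<exists>y. \<forall>i\<in>I. y i \<in> carrier (S i) \<and> smul (S i) (e i) (y i) = y i \<and> smul (S i) (y i) (e i) = y i \<and> smul (S i) (x i) (y i) = e i
        \<and> smul (S i) (y i) (x i) = e i"
      by (intro bchoice ballI) (use x in \<open>auto simp: PiE_iff in_unit_group\<close>)
    then obtain y where y: "\<And>i. i \<in> I \<Longrightarrow> y i \<in> carrier (S i) \<and> smul (S i) (e i) (y i) = y i \<and> smul (S i) (y i) (e i) = y i \<and> smul (S i) (x i) (y i) = e i
        \<and> smul (S i) (y i) (x i) = e i" by blast
    have xx: "x i \<in> carrier (S i)" "smul (S i) (e i) (x i) = x i" "smul (S i) (x i) (e i) = x i" if "i \<in> I" for i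
      using x that by (auto simp: PiE_iff in_unit_group)
    have xE: "x \<in> extensional I" using x by (simp add: PiE_iff)
    show "x \<in> carrier (unit_group ?P e)" unfolding in_unit_group
    proof (intro conjI bexI[of _ "\<lambda>i\<in>I. y i"])
      show "x \<in> carrier ?P" "(\<lambda>i\<in>I. y i) \<in> carrier ?P" using xx y xE by (auto simp: carrier_product PiE_iff)
    qed (use xx y xE ee in \<open>auto simp: smul_product intro!: extensionalityI[of _ I]\<close>)
  qed
  show ?thesis unfolding dh_ecom_def
  proof (intro conjI allI impI)
    show "fin_semigroup ?P" by (rule fP)
    fix e f assume "idempotent_element ?P e" "idempotent_element ?P f"
    then show "smul ?P e f = smul ?P f e"
      unfolding id smul_product using dh_ecomD(2)[OF S] by (auto intro!: restrict_ext)
  next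
    fix x assume "regular_element ?P x"
    then obtain y where x: "x \<in> carrier ?P" "y \<in> carrier ?P" "smul ?P (smul ?P x y) x = x"
      by (auto simp: regular_element_def)
    have "\<exists>e. idempotent_element (S i) e \<and> x i \<in> carrier (unit_group (S i) e)" if i: "i \<in> I" for i
    proof -
      have "smul (S i) (smul (S i) (x i) (y i)) (x i) = x i" using fun_cong[OF x(3), of i] i by (simp add: smul_product)
      then have "regular_element (S i) (x i)" using xi[OF x(1) i] xi[OF x(2) i] by (auto simp: regular_element_def)
      then show ?thesis by (rule dh_ecomD(3)[OF S[OF i]])
    qed
    then obtain e where e: "\<And>i. i \<in> I \<Longrightarrow> idempotent_element (S i) (e i) \<and> x i \<in> carrier (unit_group (S i) (e i))"
      by metis
    have i: "idempotent_element ?P (\<lambda>i\<in>I. e i)" unfolding id using e by auto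
    have "x \<in> carrier (unit_group ?P (\<lambda>i\<in>I. e i))" unfolding un[OF i] using e xe[OF x(1)] by (auto simp: PiE_iff)
    then show "\<exists>e. idempotent_element ?P e \<and> x \<in> carrier (unit_group ?P e)" using i by blast
  next
    fix e assume e: "idempotent_element ?P e"
    have ee: "e \<in> extensional I" "\<And>i. i \<in> I \<Longrightarrow> idempotent_element (S i) (e i)" using e id by auto
    have "pv_group H (product_group I (\<lambda>i. unit_group (S i) (e i)))"
      by (rule pv_group_product[OF H I]) (use dh_ecomD(4)[OF S] ee in auto)
    also have "product_group I (\<lambda>i. unit_group (S i) (e i)) = unit_group ?P e"
    proof (rule monoid.equality)
      show "carrier (product_group I (\<lambda>i. unit_group (S i) (e i))) = carrier (unit_group ?P e)"
        using un[OF e] by simp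
      show "(\<otimes>\<^bsub>product_group I (\<lambda>i. unit_group (S i) (e i))\<^esub>) = (\<otimes>\<^bsub>unit_group ?P e\<^esub>)"
        by (simp add: fun_eq_iff smul_product restrict_def)
      show "\<one>\<^bsub>product_group I (\<lambda>i. unit_group (S i) (e i))\<^esub> = \<one>\<^bsub>unit_group ?P e\<^esub>"
        using ee(1) by (simp add: extensional_restrict)
    qed simp
    finally show "pv_group H (unit_group ?P e)" .
  qed
qed

lemma semigroup_nat_copy:
  assumes "fin_semigroup (S :: 'a sgrp)"
  shows "\<exists>(T :: nat sgrp) h. fin_semigroup T \<and> h \<in> sgrp_hom S T \<and> bij_betw h (carrier S) (carrier T)"
proof -
  interpret finite_semigroup S using assms by (simp add: finite_semigroup_def)
  obtain f :: "'a \<Rightarrow> nat" where f: "inj_on f (carrier S)"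
    using finite_imp_inj_to_nat_seg[OF fin] by blast
  define g where "g = inv_into (carrier S) f"
  define T :: "nat sgrp" where "T = \<lparr>carrier = f ` carrier S, smul = (\<lambda>x y. f (smul S (g x) (g y)))\<rparr>"
  have g: "g (f x) = x" if "x \<in> carrier S" for x using f that by (simp add: g_def)
  have "fin_semigroup T" using assms by (auto simp: fin_semigroup_def T_def g)
  moreover have "f \<in> sgrp_hom S T" by (auto simp: sgrp_hom_def T_def g)
  moreover have "bij_betw f (carrier S) (carrier T)" using f by (simp add: bij_betw_def T_def)
  ultimately show ?thesis by blast
qed

section \<open>The description by J-classes\<close>

context finite_semigroup begin

lemma principal_ideal_right:
  assumes "x \<in> carrier S" "y \<in> carrier S" shows "principal_ideal S (x \<odot> y) \<subseteq> principal_ideal S x"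
proof
  fix z assume "z \<in> principal_ideal S (x \<odot> y)"
  then consider "z = x \<odot> y" | s where "s \<in> carrier S" "z = s \<odot> (x \<odot> y)" | t where "t \<in> carrier S" "z = (x \<odot> y) \<odot> t"
    | s t where "s \<in> carrier S" "t \<in> carrier S" "z = (s \<odot> (x \<odot> y)) \<odot> t"
    unfolding principal_ideal_def by blast
  then show "z \<in> principal_ideal S x"
  proof cases
    case 1 then show ?thesis unfolding principal_ideal_def using assms by blast
  next
    case 2
    then have "z = (s \<odot> x) \<odot> y" using assms by (simp add: assoc)
    then show ?thesis unfolding principal_ideal_def using assms 2 by blast
  next
    case 3
    then have "z = x \<odot> (y \<odot> t)" using assms by (simp add: assoc)
    then show ?thesis unfolding principal_ideal_def using assms 3 closed by blast
  next
    case 4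
    then have "z = (s \<odot> x) \<odot> (y \<odot> t)" using assms by (simp add: assoc)
    then show ?thesis unfolding principal_ideal_def using assms 4 closed by blast
  qed
qed

lemma unit_principal_ideal:
  assumes "x \<in> carrier (unit_group S e)" "e \<in> carrier S"
  shows "principal_ideal S x = principal_ideal S e"
proof -
  obtain y where y: "y \<in> carrier S" "x \<odot> y = e" and x: "x \<in> carrier S" "e \<odot> x = x"
    using assms(1) unfolding in_unit_group by blast
  show ?thesis
    using principal_ideal_right[OF x(1) y(1)] principal_ideal_right[OF assms(2) x(1)] x(2) y(2) by simp
qed

text \<open>The element \<open>c\<close> is regular, so it lies in the maximal subgroup at some idempotent \<open>f\<close>. As
  \<open>c\<close> is L-equivalent to both \<open>e\<close> and \<open>f\<close>, these are L-equivalent commuting idempotents, hence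
  equal.\<close>
lemma unit_of_left_factor:
  assumes com: "\<And>e f. idempotent_element S e \<Longrightarrow> idempotent_element S f \<Longrightarrow> e \<odot> f = f \<odot> e"
    and r: "\<And>x. regular_element S x \<Longrightarrow> \<exists>e. idempotent_element S e \<and> x \<in> carrier (unit_group S e)"
    and e: "idempotent_element S e"
    and c: "c \<in> carrier S" "m \<in> carrier S" "m \<odot> c = e" "c \<odot> e = c"
  shows "c \<in> carrier (unit_group S e)"
proof -
  have eS: "e \<in> carrier S" "e \<odot> e = e" using e by (auto simp: idempotent_element_def)
  have "(c \<odot> m) \<odot> c = c" using c by (simp add: assoc)
  then have "regular_element S c" unfolding regular_element_def using c by blast
  then obtain f where f: "idempotent_element S f" "c \<in> carrier (unit_group S f)" using r by blast
  obtain c' where c': "c' \<in> carrier S" "c' \<odot> c = f" "c \<odot> f = c" using f(2) unfolding in_unit_group by blast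
  have fS: "f \<in> carrier S" using f by (simp add: idempotent_element_def)
  have "e \<odot> f = m \<odot> (c \<odot> f)" using c fS by (simp add: assoc flip: c(3))
  then have ef: "e \<odot> f = e" using c' c by simp
  have "f \<odot> e = c' \<odot> (c \<odot> e)" using c' c eS by (simp add: assoc flip: c'(2))
  then have "f \<odot> e = f" using c' c by simp
  then have "e = f" using ef com[OF e f(1)] by simp
  then show ?thesis using f by simp
qed

lemma unit_of_right_factor:
  assumes com: "\<And>e f. idempotent_element S e \<Longrightarrow> idempotent_element S f \<Longrightarrow> e \<odot> f = f \<odot> e"
    and r: "\<And>x. regular_element S x \<Longrightarrow> \<exists>e. idempotent_element S e \<and> x \<in> carrier (unit_group S e)"
    and e: "idempotent_element S e"
    and c: "c \<in> carrier S" "m \<in> carrier S" "c \<odot> m = e" "e \<odot> c = c"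
  shows "c \<in> carrier (unit_group S e)"
proof -
  have eS: "e \<in> carrier S" "e \<odot> e = e" using e by (auto simp: idempotent_element_def)
  have "(c \<odot> m) \<odot> c = c" using c by simp
  then have "regular_element S c" unfolding regular_element_def using c by blast
  then obtain f where f: "idempotent_element S f" "c \<in> carrier (unit_group S f)" using r by blast
  obtain c' where c': "c' \<in> carrier S" "c \<odot> c' = f" "f \<odot> c = c" using f(2) unfolding in_unit_group by blast
  have fS: "f \<in> carrier S" using f by (simp add: idempotent_element_def)
  have "f \<odot> e = (f \<odot> c) \<odot> m" using c fS by (simp add: assoc flip: c(3))
  then have fe: "f \<odot> e = e" using c' c by simp
  have "e \<odot> f = (e \<odot> c) \<odot> c'" unfolding c'(2)[symmetric] using c(1) c'(1) eS(1) by (simp only: assoc)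
  then have "e \<odot> f = f" using c' c by simp
  then have "e = f" using fe com[OF e f(1)] by simp
  then show ?thesis using f by simp
qed

text \<open>The element \<open>a b a\<close> is R-equivalent to \<open>a b\<close> and L-equivalent to \<open>b a\<close>, so it is in the
  maximal subgroups at both idempotents.\<close>
lemma conjugate_idempotents_eq:
  assumes com: "\<And>e f. idempotent_element S e \<Longrightarrow> idempotent_element S f \<Longrightarrow> e \<odot> f = f \<odot> e"
    and r: "\<And>x. regular_element S x \<Longrightarrow> \<exists>e. idempotent_element S e \<and> x \<in> carrier (unit_group S e)"
    and a: "a \<in> carrier S" and b: "b \<in> carrier S"
    and ab: "(a \<odot> b) \<odot> (a \<odot> b) = a \<odot> b" and ba: "(b \<odot> a) \<odot> (b \<odot> a) = b \<odot> a"
  shows "a \<odot> b = b \<odot> a"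
proof -
  let ?e = "a \<odot> b" and ?f = "b \<odot> a" and ?c = "(a \<odot> b) \<odot> a"
  have i: "idempotent_element S ?e" "idempotent_element S ?f" using a b ab ba by (auto simp: idempotent_element_def)
  have c: "?c \<in> carrier S" using a b by simp
  have 1: "?c \<odot> b = ?e" "b \<odot> ?c = ?f" using a b ab ba by (simp_all add: assoc)
  have 2: "?e \<odot> ?c = ?c" using a b ab by (simp add: assoc[symmetric])
  have 3: "?c \<odot> ?f = ?c" using a b ba ab by (metis assoc closed)
  have u: "?c \<in> carrier (unit_group S ?e)" "?c \<in> carrier (unit_group S ?f)"
    using unit_of_right_factor[OF com r i(1) c b 1(1) 2] unit_of_left_factor[OF com r i(2) c b 1(2) 3] by blast+
  obtain y where y: "y \<in> carrier S" "?c \<odot> y = ?e" using u(1) unfolding in_unit_group by blast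
  obtain z where z: "z \<in> carrier S" "?c \<odot> z = ?f" using u(2) unfolding in_unit_group by blast
  have fc: "?f \<odot> ?c = ?c" using u(2) unfolding in_unit_group by blast
  have "?f \<odot> ?e = (?f \<odot> ?c) \<odot> y" using y a b c by (metis assoc closed)
  then have "?f \<odot> ?e = ?e" using fc y by simp
  moreover have "?e \<odot> ?f = (?e \<odot> ?c) \<odot> z" using z a b c by (metis assoc closed)
  then have "?e \<odot> ?f = ?f" using 2 z by simp
  ultimately show ?thesis using com[OF i] by simp
qed

text \<open>An element \<open>b\<close> of the J-class of \<open>e\<close> has the form \<open>s' e t'\<close> with \<open>e = s b t\<close>. Finiteness, in
  the form of idempotent powers of \<open>s s'\<close> and \<open>t' t\<close>, shows that \<open>s' e\<close> is L-equivalent and \<open>e t'\<close>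
  is R-equivalent to \<open>e\<close>. Both are then units at \<open>e\<close>, and so is their product \<open>b\<close>.\<close>
lemma J_class_units:
  assumes com: "\<And>e f. idempotent_element S e \<Longrightarrow> idempotent_element S f \<Longrightarrow> e \<odot> f = f \<odot> e"
    and r: "\<And>x. regular_element S x \<Longrightarrow> \<exists>e. idempotent_element S e \<and> x \<in> carrier (unit_group S e)"
    and e: "idempotent_element S e"
  shows "J_class S e = carrier (unit_group S e)"
proof (intro subset_antisym subsetI)
  have eS: "e \<in> carrier S" "e \<odot> e = e" using e by (auto simp: idempotent_element_def)
  {
    fix x assume x: "x \<in> carrier (unit_group S e)"
    have "x \<in> carrier S" using x by (simp add: in_unit_group)
    then show "x \<in> J_class S e" using unit_principal_ideal[OF x eS(1)] by (simp add: J_class_def)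
  }
  fix b assume "b \<in> J_class S e"
  then have b: "b \<in> carrier S" "principal_ideal S b = principal_ideal S e" by (auto simp: J_class_def)
  have "b \<in> principal_ideal S e" unfolding b(2)[symmetric] by (simp add: principal_ideal_def)
  then have "\<exists>s'\<in>carrier S. \<exists>t'\<in>carrier S. b = (s' \<odot> e) \<odot> (e \<odot> t')"
    unfolding principal_ideal_def
  proof (elim UnE CollectE exE conjE)
    assume "b \<in> {e}" then show ?thesis using eS by (intro bexI[of _ e]) auto
  next
    fix s assume "b = s \<odot> e" "s \<in> carrier S" then show ?thesis using eS by (intro bexI[of _ s] bexI[of _ e]) (auto simp: assoc)
  next
    fix t assume "b = e \<odot> t" "t \<in> carrier S" then show ?thesis using eS by (intro bexI[of _ e] bexI[of _ t]) (auto simp: assoc[symmetric])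
  next
    fix s t assume st: "b = s \<odot> e \<odot> t" "s \<in> carrier S" "t \<in> carrier S"
    then have "(s \<odot> e) \<odot> (e \<odot> t) = s \<odot> (e \<odot> e) \<odot> t" using eS(1) by (simp add: assoc)
    then show ?thesis using st eS by (intro bexI[of _ s] bexI[of _ t]) auto
  qed
  then obtain s' t' where st': "s' \<in> carrier S" "t' \<in> carrier S" "b = (s' \<odot> e) \<odot> (e \<odot> t')" by blast
  have "e \<in> principal_ideal S b" unfolding b(2) by (simp add: principal_ideal_def)
  then have "\<exists>s\<in>carrier S. \<exists>t\<in>carrier S. e = s \<odot> (b \<odot> t)"
    unfolding principal_ideal_def
  proof (elim UnE CollectE exE conjE)
    assume "e \<in> {b}" then show ?thesis using eS by (intro bexI[of _ e]) auto
  next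
    fix s assume s: "e = s \<odot> b" "s \<in> carrier S"
    then have "s \<odot> (b \<odot> e) = (s \<odot> b) \<odot> e" using b eS by (simp add: assoc)
    then show ?thesis using s eS by (intro bexI[of _ s] bexI[of _ e]) auto
  next
    fix t assume t: "e = b \<odot> t" "t \<in> carrier S"
    then show ?thesis using eS by (intro bexI[of _ e] bexI[of _ t]) auto
  next
    fix s t assume st: "e = s \<odot> b \<odot> t" "s \<in> carrier S" "t \<in> carrier S"
    then show ?thesis using b by (intro bexI[of _ s] bexI[of _ t]) (auto simp: assoc)
  qed
  then obtain s t where st: "s \<in> carrier S" "t \<in> carrier S" "e = s \<odot> (b \<odot> t)" by blast
  define p q where "p = s \<odot> s'" and "q = t' \<odot> t"
  have pq: "p \<in> carrier S" "q \<in> carrier S" using st st' by (auto simp: p_def q_def)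
  have "e = p \<odot> (e \<odot> e) \<odot> q" using st st' eS(1) by (simp add: p_def q_def assoc)
  then have epq: "e = p \<odot> (e \<odot> q)" using eS pq by (simp add: assoc)
  \<comment> \<open>This is \<open>p\<^sup>n\<^sup>+\<^sup>1 e q\<^sup>n\<^sup>+\<^sup>1 = e\<close>.\<close>
  have iter: "spow S p n \<odot> (e \<odot> spow S q n) = e" for n
  proof (induction n)
    case 0 then show ?case using epq by simp
  next
    case (Suc n)
    have "spow S q n \<odot> q = q \<odot> spow S q n" using spow_add[OF pq(2), of n 0] by simp
    then have "spow S p (Suc n) \<odot> (e \<odot> spow S q (Suc n)) = p \<odot> ((spow S p n \<odot> (e \<odot> spow S q n)) \<odot> q)"
      using pq eS by (simp add: assoc)
    then show ?case using Suc epq by simp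
  qed
  note key = unit_of_left_factor[OF com r e] and key' = unit_of_right_factor[OF com r e]
  have c1: "s' \<odot> e \<in> carrier (unit_group S e)"
  proof -
    obtain n where n: "idempotent_element S (spow S p n)" using spow_idem pq by blast
    let ?P = "spow S p n"
    have P: "?P \<in> carrier S" "?P \<odot> ?P = ?P" using n by (auto simp: idempotent_element_def)
    have "?P \<odot> e = ?P \<odot> (?P \<odot> (e \<odot> spow S q n))" using iter by simp
    also have "\<dots> = (?P \<odot> ?P) \<odot> (e \<odot> spow S q n)" using P(1) pq eS(1) by (simp only: assoc closed spow_closed)
    also have "\<dots> = e" unfolding P(2) by (rule iter)
    finally have Pe: "?P \<odot> e = e" .
    have "?P = spow S p (n + n) \<odot> p" using P(2) spow_add[OF pq(1), of n n] spow_add[OF pq(1), of "n + n" 0] by simp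
    moreover have "(X \<odot> s) \<odot> (s' \<odot> e) = (X \<odot> p) \<odot> e" if "X \<in> carrier S" for X
      unfolding p_def using that st st' eS(1) by (simp add: assoc)
    ultimately have "(spow S p (n + n) \<odot> s) \<odot> (s' \<odot> e) = e" using Pe pq(1) spow_closed by metis
    moreover have "s' \<odot> e \<in> carrier S" "spow S p (n + n) \<odot> s \<in> carrier S" using st st' pq eS by simp_all
    moreover have "(s' \<odot> e) \<odot> e = s' \<odot> e" using st' eS by (simp add: assoc)
    ultimately show ?thesis using key by blast
  qed
  have c2: "e \<odot> t' \<in> carrier (unit_group S e)"
  proof -
    obtain n where n: "idempotent_element S (spow S q n)" using spow_idem pq by blast
    let ?Q = "spow S q n"
    have Q: "?Q \<in> carrier S" "?Q \<odot> ?Q = ?Q" using n by (auto simp: idempotent_element_def)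
    have "e \<odot> ?Q = (spow S p n \<odot> (e \<odot> ?Q)) \<odot> ?Q" using iter by simp
    also have "\<dots> = spow S p n \<odot> (e \<odot> (?Q \<odot> ?Q))" using pq eS Q(1) by (simp add: assoc)
    also have "\<dots> = e" using Q iter by simp
    finally have Qe: "e \<odot> ?Q = e" .
    have "?Q = q \<odot> spow S q (n + n)" using Q(2) spow_add[OF pq(2), of n n] by simp
    moreover have "(e \<odot> t') \<odot> (t \<odot> X) = e \<odot> (q \<odot> X)" if "X \<in> carrier S" for X
      unfolding q_def using that st st' eS(1) by (simp add: assoc)
    ultimately have "(e \<odot> t') \<odot> (t \<odot> spow S q (n + n)) = e" using Qe pq(2) spow_closed by metis
    moreover have "e \<odot> t' \<in> carrier S" "t \<odot> spow S q (n + n) \<in> carrier S" using st st' pq eS by simp_all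
    moreover have "e \<odot> (e \<odot> t') = e \<odot> t'" using st' eS by (simp add: assoc[symmetric])
    ultimately show ?thesis using key' by blast
  qed
  interpret G: group "unit_group S e" using unit_group_group e .
  show "b \<in> carrier (unit_group S e)" using G.m_closed[OF c1 c2] st'(3) by simp
qed

end

lemma DH_ECom_iff:
  assumes H: "group_pseudovariety H"
  shows "S \<in> DH H \<inter> ECom \<longleftrightarrow> dh_ecom H S"
proof
  assume S: "S \<in> DH H \<inter> ECom"
  then have fs: "fin_semigroup S" by (simp add: DH_def)
  interpret finite_semigroup S using fs by (simp add: finite_semigroup_def)
  have com: "smul S e f = smul S f e" if "idempotent_element S e" "idempotent_element S f" for e f
    using S that by (simp add: ECom_def)
  have J: "\<exists>G\<in>H. carrier G = J_class S x \<and> (\<forall>x\<in>carrier G. \<forall>y\<in>carrier G. x \<otimes>\<^bsub>G\<^esub> y = smul S x y)"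
    if "regular_element S x" for x
  proof -
    have "J_class S x \<in> regular_J_classes S" using that by (auto simp: regular_J_classes_def)
    then show ?thesis using S unfolding DH_def by fastforce
  qed
  have Ju: "\<exists>G\<in>H. \<exists>e. idempotent_element S e \<and> carrier G = J_class S x \<and> carrier G \<subseteq> carrier (unit_group S e)
      \<and> (\<forall>x\<in>carrier G. \<forall>y\<in>carrier G. x \<otimes>\<^bsub>G\<^esub> y = smul S x y) \<and> one G = e"
    if x: "regular_element S x" for x
  proof -
    obtain G where G: "G \<in> H" "carrier G = J_class S x" "\<And>x y. x\<in>carrier G \<Longrightarrow> y\<in>carrier G \<Longrightarrow> x \<otimes>\<^bsub>G\<^esub> y = smul S x y"
      using J[OF x] by blast
    interpret G: group G using pv_member_group[OF H G(1)] by simp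
    have sub: "carrier G \<subseteq> carrier S" using G(2) by (auto simp: J_class_def)
    have i: "idempotent_element S (one G)" unfolding idempotent_element_def using sub G(3)[of "one G" "one G"] by auto
    have "carrier G \<subseteq> carrier (unit_group S (one G))"
    proof
      fix z assume z: "z \<in> carrier G"
      show "z \<in> carrier (unit_group S (one G))" unfolding in_unit_group
        by (intro conjI bexI[of _ "inv\<^bsub>G\<^esub> z"]) (use z sub in \<open>auto simp: G.l_inv G.r_inv simp flip: G(3)\<close>)
    qed
    then show ?thesis using G i by blast
  qed
  show "dh_ecom H S"
    unfolding dh_ecom_def
  proof (intro conjI allI impI)
    fix x assume x: "regular_element S x"
    have "x \<in> J_class S x" using x by (auto simp: J_class_def regular_element_def)
    then show "\<exists>e. idempotent_element S e \<and> x \<in> carrier (unit_group S e)" using Ju[OF x] by blast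
  next
    fix e assume e: "idempotent_element S e"
    then have er: "regular_element S e"
      unfolding regular_element_def idempotent_element_def by (intro conjI bexI[of _ e]) auto
    have eJ: "e \<in> J_class S e" using e by (auto simp: J_class_def idempotent_element_def)
    obtain G f where G: "G \<in> H" "carrier G = J_class S e" "carrier G \<subseteq> carrier (unit_group S f)" "idempotent_element S f"
        "\<And>x y. x\<in>carrier G \<Longrightarrow> y\<in>carrier G \<Longrightarrow> x \<otimes>\<^bsub>G\<^esub> y = smul S x y"
      using Ju[OF er] by blast
    have ee: "smul S e e = e" "e \<in> carrier S" using e by (auto simp: idempotent_element_def)
    have "e = f" using unit_group_idem[of e f] eJ G ee by blast
    moreover have "carrier (unit_group S e) \<subseteq> J_class S e"
    proof
      fix x assume x: "x \<in> carrier (unit_group S e)"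
      then show "x \<in> J_class S e" using unit_principal_ideal[OF x ee(2)] by (simp add: J_class_def in_unit_group)
    qed
    ultimately have c: "carrier (unit_group S e) = carrier G" using G by auto
    have "id \<in> iso G (unit_group S e)" using c G(5) by (auto simp: iso_def hom_def bij_betw_def)
    then show "pv_group H (unit_group S e)" using G(1) unit_group_group[OF e] unfolding pv_group_def is_iso_def by blast
  qed (use fs com in auto)
next
  assume S: "dh_ecom H S"
  interpret finite_semigroup S using dh_ecom_finite_semigroup S .
  have "subsemigroup (J_class S a) S \<and> (\<exists>G\<in>H. carrier G = J_class S a \<and> (\<forall>x\<in>J_class S a. \<forall>y\<in>J_class S a. x \<otimes>\<^bsub>G\<^esub> y = smul S x y))"
    if a: "regular_element S a" for a
  proof -
    obtain e where e: "idempotent_element S e" "a \<in> carrier (unit_group S e)" using dh_ecomD(3)[OF S a] by blast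
    have "principal_ideal S a = principal_ideal S e" using unit_principal_ideal e by (simp add: idempotent_element_def)
    then have "J_class S a = J_class S e" by (simp add: J_class_def)
    also have "\<dots> = carrier (unit_group S e)" using J_class_units dh_ecomD(2,3)[OF S] e(1) by blast
    finally have J: "J_class S a = carrier (unit_group S e)" .
    have "unit_group S e \<in> H" using pv_group_nat[OF H dh_ecomD(4)[OF S e(1)]] .
    moreover interpret G: group "unit_group S e" using unit_group_group e(1) .
    have "subsemigroup (J_class S a) S" unfolding J subsemigroup_def
    proof (intro conjI ballI)
      show "carrier (unit_group S e) \<noteq> {}" using e(2) by blast
      show "carrier (unit_group S e) \<subseteq> carrier S" by (auto simp: in_unit_group)
    qed (use G.m_closed in simp)
    ultimately show ?thesis unfolding J by auto
  qed
  then have "S \<in> DH H" unfolding DH_def regular_J_classes_def using dh_ecomD(1)[OF S] by blast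
  moreover have "S \<in> ECom" unfolding ECom_def using dh_ecomD(1,2)[OF S] by blast
  ultimately show "S \<in> DH H \<inter> ECom" by blast
qed

lemma DH_ECom_pseudovariety:
  assumes H: "group_pseudovariety H"
  shows "semigroup_pseudovariety (DH H \<inter> ECom)"
  unfolding semigroup_pseudovariety_def DH_ECom_iff[OF H] Ball_def
proof (intro conjI allI impI, goal_cases)
  case (1 S) then show ?case by (rule dh_ecomD(1))
next
  case (2 S A) then show ?case by (rule dh_ecom_sub[OF H])
next
  case (3 S T h) then show ?case using dh_ecom_image[OF H] by blast
next
  case (4 I S T)
  then obtain h where "h \<in> sgrp_hom T (sgrp_product I S)" "inj_on h (carrier T)"
    unfolding sgrp_iso_def bij_betw_def by blast
  moreover have "dh_ecom H (sgrp_product I S)" by (rule dh_ecom_product[OF H]) (use 4 in auto)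
  ultimately show ?case using dh_ecom_embed[OF H] 4 by blast
qed

section \<open>Semigroupoids generated by the pseudovariety are locally in it\<close>

lemma local_semigroup_simps [simp]:
  "carrier (local_semigroup S v) = loops S v" "smul (local_semigroup S v) = mul S"
  by (simp_all add: local_semigroup_def)

lemma fin_local_semigroup:
  assumes "is_semigroupoid S" "finite (loops S v)" "loops S v \<noteq> {}"
  shows "fin_semigroup (local_semigroup S v)"
  using assms unfolding fin_semigroup_def is_semigroupoid_def by (simp add: loops_def)

lemma finite_loops: "fin_semigroupoid S \<Longrightarrow> finite (loops S v)"
  by (simp add: fin_semigroupoid_def loops_def)

lemma l_pv_iff:
  assumes H: "group_pseudovariety H"
  shows "S \<in> l_pv (DH H \<inter> ECom) \<longleftrightarrow> fin_semigroupoid S \<and> (\<forall>v\<in>verts S. loops S v \<noteq> {} \<longrightarrow> dh_ecom H (local_semigroup S v))"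
  unfolding l_pv_def DH_ECom_iff[OF H] by simp

text \<open>If \<open>S\<close> divides \<open>T\<close>, then each local semigroup of \<open>S\<close> is an image of a local semigroup of the
  witness \<open>U\<close>, which embeds into a local semigroup of \<open>T\<close>. For products, the local semigroup at a
  vertex embeds into the product of the local semigroups at its components.\<close>
lemma l_pv_pseudovariety:
  assumes H: "group_pseudovariety H"
  shows "semigroupoid_pseudovariety (l_pv (DH H \<inter> ECom))"
  unfolding semigroupoid_pseudovariety_def Ball_def l_pv_iff[OF H]
proof (intro conjI allI impI, goal_cases)
  case 1 then show ?case by blast
next
  case 2 then show ?case by blast
next
  case (3 T S v)
  have T: "fin_semigroupoid T" "\<And>v. v \<in> verts T \<Longrightarrow> loops T v \<noteq> {} \<Longrightarrow> dh_ecom H (local_semigroup T v)"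
    and S: "fin_semigroupoid S" and v: "v \<in> verts S" "loops S v \<noteq> {}" using 3 by auto
  obtain U :: "(nat, nat) semigroupoid" and p q p' q' where U: "is_semigroupoid U"
    and pq: "(p, q) \<in> sgd_hom U T" "faithful U q"
    and pq': "(p', q') \<in> sgd_hom U S" "bij_betw p' (verts U) (verts S)" "q' ` edges U = edges S"
    using 3 unfolding divides_def by fast
  have Uv: "src U x \<in> verts U" "tgt U x \<in> verts U" if "x \<in> edges U" for x
    using U that by (auto simp: is_semigroupoid_def)
  have pinj: "inj_on p' (verts U)" and "v \<in> p' ` verts U" using pq'(2) v(1) by (simp_all add: bij_betw_def)
  then obtain u where u: "u \<in> verts U" "p' u = v" by auto
  have qs: "q x \<in> edges T" "src T (q x) = p (src U x)" "tgt T (q x) = p (tgt U x)"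
    "q' x \<in> edges S" "src S (q' x) = p' (src U x)" "tgt S (q' x) = p' (tgt U x)" if "x \<in> edges U" for x
    using pq(1) pq'(1) that by (auto simp: sgd_hom_def)
  have qm: "q (mul U x y) = mul T (q x) (q y)" "q' (mul U x y) = mul S (q' x) (q' y)"
    if "x \<in> edges U" "y \<in> edges U" "tgt U x = src U y" for x y
    using pq(1) pq'(1) that by (auto simp: sgd_hom_def)
  have lp: "q ` loops U u \<subseteq> loops T (p u)" using qs by (auto simp: loops_def)
  have inj: "inj_on q (loops U u)"
    using pq(2) unfolding faithful_def inj_on_def loops_def by auto
  have fU: "finite (loops U u)" using finite_loops[OF T(1)] lp inj by (metis finite_imageD finite_subset)
  have img: "q' ` loops U u = loops S v"
  proof (intro subset_antisym subsetI)
    fix s assume s: "s \<in> loops S v"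
    then have "s \<in> q' ` edges U" using pq'(3) by (simp add: loops_def)
    then obtain x where x: "x \<in> edges U" "q' x = s" by auto
    have "p' (src U x) = p' u" "p' (tgt U x) = p' u" using qs[OF x(1)] x(2) s u by (auto simp: loops_def)
    then have "src U x = u" "tgt U x = u" using inj_onD[OF pinj] Uv[OF x(1)] u(1) by auto
    then show "s \<in> q' ` loops U u" using x by (auto simp: loops_def)
  qed (use qs u in \<open>auto simp: loops_def\<close>)
  have ne: "loops U u \<noteq> {}" using img v(2) by auto
  have fX: "fin_semigroup (local_semigroup U u)" by (rule fin_local_semigroup[OF U fU ne])
  have pu: "p u \<in> verts T" using pq(1) u(1) by (auto simp: sgd_hom_def)
  have "dh_ecom H (local_semigroup T (p u))" using T(2)[OF pu] lp ne by blast
  moreover have "q \<in> sgrp_hom (local_semigroup U u) (local_semigroup T (p u))"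
    unfolding sgrp_hom_def using lp qm by (auto simp: loops_def)
  ultimately have "dh_ecom H (local_semigroup U u)" using dh_ecom_embed[OF H _ fX] inj by auto
  moreover have "q' \<in> sgrp_hom (local_semigroup U u) (local_semigroup S v)"
    unfolding sgrp_hom_def using img qm by (auto simp: loops_def)
  moreover have "fin_semigroup (local_semigroup S v)"
    using fin_local_semigroup[OF _ finite_loops[OF S] v(2)] S by (simp add: fin_semigroupoid_def)
  moreover have "q' ` carrier (local_semigroup U u) = carrier (local_semigroup S v)" using img by simp
  ultimately show ?case using dh_ecom_image[OF H] by blast
next
  case 4 then show ?case by blast
next
  case (5 I S T v)
  have I: "finite I" and S: "\<And>i. i \<in> I \<Longrightarrow> fin_semigroupoid (S i)"
    "\<And>i v. i \<in> I \<Longrightarrow> v \<in> verts (S i) \<Longrightarrow> loops (S i) v \<noteq> {} \<Longrightarrow> dh_ecom H (local_semigroup (S i) v)"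
    and T: "fin_semigroupoid T" and v: "v \<in> verts T" "loops T v \<noteq> {}" using 5 by auto
  obtain p q where pq: "(p, q) \<in> sgd_hom T (sgd_product I S)" "inj_on q (edges T)"
    using 5 unfolding sgd_iso_def bij_betw_def by fast
  have pv: "p v i \<in> verts (S i)" if "i \<in> I" for i using pq(1) v(1) that by (auto simp: sgd_hom_def sgd_product_def)
  have qe: "q x \<in> (\<Pi>\<^sub>E i\<in>I. edges (S i))" "(\<lambda>i\<in>I. src (S i) (q x i)) = p (src T x)" "(\<lambda>i\<in>I. tgt (S i) (q x i)) = p (tgt T x)"
    if "x \<in> edges T" for x using pq(1) that by (auto simp: sgd_hom_def sgd_product_def)
  have qm: "q (mul T x y) = (\<lambda>i\<in>I. mul (S i) (q x i) (q y i))" if "x \<in> edges T" "y \<in> edges T" "tgt T x = src T y" for x y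
    using pq(1) that by (auto simp: sgd_hom_def sgd_product_def)
  have ql: "q x i \<in> loops (S i) (p v i)" if x: "x \<in> loops T v" and i: "i \<in> I" for x i
  proof -
    have xv: "x \<in> edges T" "src T x = v" "tgt T x = v" using x by (auto simp: loops_def)
    have "src (S i) (q x i) = p v i" using fun_cong[OF qe(2)[OF xv(1)], of i] i xv by simp
    moreover have "tgt (S i) (q x i) = p v i" using fun_cong[OF qe(3)[OF xv(1)], of i] i xv by simp
    moreover have "q x i \<in> edges (S i)" using qe(1)[OF xv(1)] i by (auto simp: PiE_iff)
    ultimately show ?thesis by (simp add: loops_def)
  qed
  let ?L = "\<lambda>i. local_semigroup (S i) (p v i)"
  have "dh_ecom H (sgrp_product I ?L)"
  proof (rule dh_ecom_product[OF H I])
    fix i assume i: "i \<in> I"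
    have "loops (S i) (p v i) \<noteq> {}" using ql[OF _ i] v(2) by blast
    then show "dh_ecom H (?L i)" using S(2)[OF i pv[OF i]] by blast
  qed
  moreover have "fin_semigroup (local_semigroup T v)"
    using fin_local_semigroup[OF _ finite_loops[OF T] v(2)] T by (simp add: fin_semigroupoid_def)
  moreover have "q \<in> sgrp_hom (local_semigroup T v) (sgrp_product I ?L)"
  proof -
    have "q x \<in> carrier (sgrp_product I ?L)" if x: "x \<in> loops T v" for x
    proof -
      have "q x \<in> extensional I" using qe(1)[of x] x by (auto simp: loops_def PiE_def)
      then show ?thesis using ql[OF x] by (auto simp: carrier_product PiE_iff)
    qed
    moreover have "q (mul T x y) = smul (sgrp_product I ?L) (q x) (q y)" if "x \<in> loops T v" "y \<in> loops T v" for x y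
      using that qm[of x y] by (simp add: loops_def smul_product)
    ultimately show ?thesis unfolding sgrp_hom_def by auto
  qed
  moreover have "inj_on q (carrier (local_semigroup T v))" using pq(2) by (rule inj_on_subset) (auto simp: loops_def)
  ultimately show ?case using dh_ecom_embed[OF H] by blast
qed

lemma g_pv_subset_l_pv:
  assumes H: "group_pseudovariety H"
  shows "g_pv (DH H \<inter> ECom) \<subseteq> l_pv (DH H \<inter> ECom)"
proof -
  have "one_vertex S \<in> l_pv (DH H \<inter> ECom)" if S: "dh_ecom H (S :: nat sgrp)" for S
  proof -
    interpret finite_semigroup S using dh_ecom_finite_semigroup S .
    have "fin_semigroupoid (one_vertex S)"
      using fin by (auto simp: fin_semigroupoid_def is_semigroupoid_def one_vertex_def assoc)
    moreover have "local_semigroup (one_vertex S) 0 = S"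
      by (simp add: local_semigroup_def loops_def one_vertex_def)
    ultimately show ?thesis unfolding l_pv_iff[OF H] using S by (simp add: one_vertex_def)
  qed
  then have "one_vertex ` (DH H \<inter> ECom) \<subseteq> l_pv (DH H \<inter> ECom)" using DH_ECom_iff[OF H] by blast
  then show ?thesis unfolding g_pv_def using l_pv_pseudovariety[OF H] by blast
qed

section \<open>Triangular monomial matrices over a group\<close>

text \<open>A matrix with at most one nonzero entry in each row is given by the partial function that
  sends the index of a row to the column and the value of its entry.\<close>
definition mat_mul :: "('g, 'c) monoid_scheme \<Rightarrow> (nat \<Rightarrow> (nat \<times> 'g) option) \<Rightarrow> (nat \<Rightarrow> (nat \<times> 'g) option) \<Rightarrow> nat \<Rightarrow> (nat \<times> 'g) option" where
  "mat_mul G m n = (\<lambda>i. case m i of None \<Rightarrow> None | Some (j, g) \<Rightarrow>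
      (case n j of None \<Rightarrow> None | Some (k, h) \<Rightarrow> Some (k, g \<otimes>\<^bsub>G\<^esub> h)))"

text \<open>Upper triangular matrices with rows and columns \<open>0, \<dots>, N\<close> and at most one nonzero entry in
  each row and column.\<close>
definition monomial_mats :: "nat \<Rightarrow> ('g, 'c) monoid_scheme \<Rightarrow> (nat \<Rightarrow> (nat \<times> 'g) option) set" where
  "monomial_mats N G = {m. (\<forall>i j g. m i = Some (j, g) \<longrightarrow> i \<le> j \<and> j \<le> N \<and> g \<in> carrier G) \<and>
     (\<forall>i i' j g g'. m i = Some (j, g) \<longrightarrow> m i' = Some (j, g') \<longrightarrow> i = i')}"

definition monomial :: "nat \<Rightarrow> ('g, 'c) monoid_scheme \<Rightarrow> (nat \<Rightarrow> (nat \<times> 'g) option) sgrp" where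
  "monomial N G = \<lparr>carrier = monomial_mats N G, smul = mat_mul G\<rparr>"

definition diag :: "nat set \<Rightarrow> (nat \<Rightarrow> 'g) \<Rightarrow> nat \<Rightarrow> (nat \<times> 'g) option" where
  "diag D f = (\<lambda>i. if i \<in> D then Some (i, f i) else None)"

lemma monomial_simps [simp]: "carrier (monomial N G) = monomial_mats N G" "smul (monomial N G) = mat_mul G"
  by (simp_all add: monomial_def)

lemma mat_mul_Some: "mat_mul G m n i = Some (k, x) \<longleftrightarrow> (\<exists>j g h. m i = Some (j, g) \<and> n j = Some (k, h) \<and> x = g \<otimes>\<^bsub>G\<^esub> h)"
  by (auto simp: mat_mul_def split: option.splits)

lemma monomial_matsD: "m \<in> monomial_mats N G \<Longrightarrow> m i = Some (j, g) \<Longrightarrow> i \<le> j \<and> j \<le> N \<and> g \<in> carrier G"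
  "m \<in> monomial_mats N G \<Longrightarrow> m i = Some (j, g) \<Longrightarrow> m i' = Some (j, g') \<Longrightarrow> i = i'"
  by (auto simp: monomial_mats_def)

lemma monomial_matsI: "(\<And>i j g. m i = Some (j, g) \<Longrightarrow> i \<le> j \<and> j \<le> N \<and> g \<in> carrier G) \<Longrightarrow>
   (\<And>i i' j g g'. m i = Some (j, g) \<Longrightarrow> m i' = Some (j, g') \<Longrightarrow> i = i') \<Longrightarrow> m \<in> monomial_mats N G"
  unfolding monomial_mats_def by blast

lemma finite_monomial_mats: assumes "finite (carrier G)" shows "finite (monomial_mats N G)"
proof -
  let ?B = "{..N} \<times> carrier G"
  have "monomial_mats N G \<subseteq> (\<Union>D\<in>Pow {..N}. {m. dom m = D \<and> ran m \<subseteq> ?B})"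
  proof
    fix m assume m: "m \<in> monomial_mats N G"
    have "dom m \<subseteq> {..N}" "ran m \<subseteq> ?B" using monomial_matsD(1)[OF m] by (fastforce simp: dom_def ran_def)+
    then show "m \<in> (\<Union>D\<in>Pow {..N}. {m. dom m = D \<and> ran m \<subseteq> ?B})" by blast
  qed
  moreover have "finite {m. dom m = D \<and> ran m \<subseteq> ?B}" if "D \<in> Pow {..N}" for D
    using that assms by (intro finite_set_of_finite_maps) (auto intro: finite_subset)
  ultimately show ?thesis by (meson finite_UN finite_Pow_iff finite_atMost finite_subset)
qed

lemma mat_mul_diag_Int: "mat_mul G (diag D f) (diag D' f') = diag (D \<inter> D') (\<lambda>i. f i \<otimes>\<^bsub>G\<^esub> f' i)"
  by (auto simp: mat_mul_def diag_def fun_eq_iff)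

lemma mat_mul_diag: "mat_mul G (diag D f) (diag D f') = diag D (\<lambda>i. f i \<otimes>\<^bsub>G\<^esub> f' i)"
  by (simp add: mat_mul_diag_Int)

lemma diag_monomial: "D \<subseteq> {..N} \<Longrightarrow> (\<And>i. i \<in> D \<Longrightarrow> f i \<in> carrier G) \<Longrightarrow> diag D f \<in> monomial_mats N G"
  by (rule monomial_matsI) (auto simp: diag_def split: if_splits)

lemma diag_cong: "(\<And>i. i \<in> D \<Longrightarrow> f i = f' i) \<Longrightarrow> diag D f = diag D f'"
  by (auto simp: diag_def)

context group begin

lemma mat_mul_closed: assumes "m \<in> monomial_mats N G" "n \<in> monomial_mats N G" shows "mat_mul G m n \<in> monomial_mats N G"
proof (rule monomial_matsI)
  show "i \<le> j \<and> j \<le> N \<and> g \<in> carrier G" if "mat_mul G m n i = Some (j, g)" for i j g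
    using that monomial_matsD(1)[OF assms(1)] monomial_matsD(1)[OF assms(2)] unfolding mat_mul_Some by (metis le_trans m_closed)
  show "i = i'" if "mat_mul G m n i = Some (j, g)" "mat_mul G m n i' = Some (j, g')" for i i' j g g'
    using that monomial_matsD(2)[OF assms(1)] monomial_matsD(2)[OF assms(2)] unfolding mat_mul_Some by metis
qed

lemma mat_mul_assoc: assumes "m \<in> monomial_mats N G" "n \<in> monomial_mats N G" "p \<in> monomial_mats N G"
  shows "mat_mul G (mat_mul G m n) p = mat_mul G m (mat_mul G n p)"
proof
  fix i show "mat_mul G (mat_mul G m n) p i = mat_mul G m (mat_mul G n p) i"
    using monomial_matsD(1)[OF assms(1)] monomial_matsD(1)[OF assms(2)] monomial_matsD(1)[OF assms(3)]
    by (auto simp: mat_mul_def m_assoc split: option.splits)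
qed

lemma monomial_semigroup: assumes "finite (carrier G)" shows "fin_semigroup (monomial N G)"
proof -
  have "Map.empty \<in> monomial_mats N G" by (rule monomial_matsI) auto
  then show ?thesis unfolding fin_semigroup_def
    using finite_monomial_mats[OF assms] mat_mul_closed mat_mul_assoc by auto
qed

text \<open>If \<open>x = x y x\<close> and \<open>x\<close> has an entry in row \<open>i\<close> and column \<open>j\<close>, then \<open>y\<close> has one in row \<open>j\<close>
  and some column \<open>k\<close>, and \<open>k = i\<close> as \<open>x\<close> has only one entry in column \<open>j\<close>. Triangularity gives
  \<open>i \<le> j \<le> i\<close>.\<close>
lemma regular_diag:
  assumes x: "x \<in> monomial_mats N G" and y: "y \<in> monomial_mats N G" and xyx: "mat_mul G (mat_mul G x y) x = x"
  shows "\<exists>D f. D \<subseteq> {..N} \<and> (\<forall>i\<in>D. f i \<in> carrier G) \<and> x = diag D f"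
proof -
  have d: "j = i" if xi: "x i = Some (j, g)" for i j g
  proof -
    have "mat_mul G (mat_mul G x y) x i = Some (j, g)" using xyx xi by simp
    then obtain k h h' where k: "y j = Some (k, h)" "x k = Some (j, h')" using xi unfolding mat_mul_Some by auto
    then have "k = i" using monomial_matsD(2)[OF x] xi by blast
    then show ?thesis using monomial_matsD(1)[OF x xi] monomial_matsD(1)[OF y k(1)] by simp
  qed
  define f where "f i = snd (the (x i))" for i
  have "x = diag (dom x) f"
  proof
    fix i show "x i = diag (dom x) f i"
      using d[of i] by (cases "x i") (auto simp: diag_def f_def)
  qed
  moreover have "dom x \<subseteq> {..N}" "\<forall>i\<in>dom x. f i \<in> carrier G"
    using monomial_matsD(1)[OF x] d by (fastforce simp: f_def)+
  ultimately show ?thesis by blast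
qed

lemma diag_idem: assumes "idempotent_element (monomial N G) e"
  shows "\<exists>D\<subseteq>{..N}. e = diag D (\<lambda>_. \<one>)"
proof -
  have e: "e \<in> monomial_mats N G" "mat_mul G e e = e" using assms by (auto simp: idempotent_element_def)
  then obtain D f where D: "D \<subseteq> {..N}" "\<forall>i\<in>D. f i \<in> carrier G" "e = diag D f" using regular_diag[OF e(1,1)] by auto
  have "f i = \<one>" if i: "i \<in> D" for i
  proof -
    have "diag D (\<lambda>i. f i \<otimes> f i) i = diag D f i" using e(2) unfolding D(3) mat_mul_diag by simp
    then have "f i \<otimes> f i = f i" using i by (simp add: diag_def)
    then show ?thesis using D(2) i l_cancel_one by blast
  qed
  then have "e = diag D (\<lambda>_. \<one>)" unfolding D(3) by (rule diag_cong)
  then show ?thesis using D(1) by blast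
qed

lemma diag_unit:
  assumes "D \<subseteq> {..N}" "\<And>i. i \<in> D \<Longrightarrow> f i \<in> carrier G"
  shows "diag D f \<in> carrier (unit_group (monomial N G) (diag D (\<lambda>_. \<one>)))"
  unfolding in_unit_group
proof (intro conjI bexI[of _ "diag D (\<lambda>i. inv (f i))"])
  show "diag D f \<in> carrier (monomial N G)" "diag D (\<lambda>i. inv (f i)) \<in> carrier (monomial N G)"
    using assms by (auto intro!: diag_monomial)
qed (use assms in \<open>auto simp: mat_mul_diag intro!: diag_cong\<close>)

lemma unit_diag:
  assumes D: "D \<subseteq> {..N}" and x: "x \<in> carrier (unit_group (monomial N G) (diag D (\<lambda>_. \<one>)))"
  shows "\<exists>f. (\<forall>i\<in>D. f i \<in> carrier G) \<and> x = diag D f"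
proof -
  let ?e = "diag D (\<lambda>_. \<one>)"
  obtain y where x: "x \<in> monomial_mats N G" "mat_mul G ?e x = x" and y: "y \<in> monomial_mats N G" "mat_mul G x y = ?e"
    using x unfolding in_unit_group by auto
  obtain D' f where D': "D' \<subseteq> {..N}" "\<forall>i\<in>D'. f i \<in> carrier G" "x = diag D' f" using regular_diag[OF x(1) y(1)] x y by auto
  have "i \<in> D" if "i \<in> D'" for i
  proof -
    have "mat_mul G ?e x i = Some (i, f i)" using x(2) that D'(3) by (simp add: diag_def)
    then show ?thesis unfolding mat_mul_Some by (auto simp: diag_def split: if_splits)
  qed
  moreover have "i \<in> D'" if "i \<in> D" for i
  proof -
    have "mat_mul G x y i = Some (i, \<one>)" using y(2) that by (simp add: diag_def)
    then show ?thesis unfolding mat_mul_Some D'(3) by (auto simp: diag_def split: if_splits)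
  qed
  ultimately have "D' = D" by blast
  then show ?thesis using D' by blast
qed

end

text \<open>The idempotents are the partial identity matrices, and the maximal subgroup at the one with
  support \<open>D\<close> is a power of \<open>G\<close> with exponent \<open>D\<close>.\<close>
lemma dh_ecom_monomial:
  assumes H: "group_pseudovariety H" and G: "pv_group H (G :: 'g monoid)"
  shows "dh_ecom H (monomial N G)"
proof -
  interpret group G using G by (simp add: pv_group_def)
  have fS: "fin_semigroup (monomial N G)" using monomial_semigroup pv_group_finite[OF H G] .
  then interpret S: finite_semigroup "monomial N G" by (simp add: finite_semigroup_def)
  have di: "idempotent_element (monomial N G) (diag D (\<lambda>_. \<one>\<^bsub>G\<^esub>))" if "D \<subseteq> {..N}" for D
    using that unfolding idempotent_element_def by (simp add: diag_monomial mat_mul_diag)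
  show ?thesis unfolding dh_ecom_def
  proof (intro conjI allI impI)
    show "fin_semigroup (monomial N G)" by (rule fS)
  next
    fix e f assume "idempotent_element (monomial N G) e" "idempotent_element (monomial N G) f"
    then obtain D D' where "e = diag D (\<lambda>_. \<one>\<^bsub>G\<^esub>)" "f = diag D' (\<lambda>_. \<one>\<^bsub>G\<^esub>)" using diag_idem by metis
    then show "smul (monomial N G) e f = smul (monomial N G) f e"
      by (simp add: mat_mul_diag_Int Int_commute)
  next
    fix x assume "regular_element (monomial N G) x"
    then obtain y where y: "x \<in> monomial_mats N G" "y \<in> monomial_mats N G" "mat_mul G (mat_mul G x y) x = x"
      by (auto simp: regular_element_def)
    obtain D f where D: "D \<subseteq> {..N}" "\<forall>i\<in>D. f i \<in> carrier G" "x = diag D f"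
      using regular_diag[OF y] by blast
    then show "\<exists>e. idempotent_element (monomial N G) e \<and> x \<in> carrier (unit_group (monomial N G) e)"
      using di[OF D(1)] diag_unit[OF D(1)] by auto
  next
    fix e assume e: "idempotent_element (monomial N G) e"
    then obtain D where D: "D \<subseteq> {..N}" "e = diag D (\<lambda>_. \<one>\<^bsub>G\<^esub>)" using diag_idem by metis
    let ?P = "product_group D (\<lambda>_. G)"
    have iP: "pv_group H ?P" by (rule pv_group_product[OF H]) (use D G finite_subset in auto)
    have "diag D \<in> hom ?P (unit_group (monomial N G) e)"
    proof (rule homI)
      fix f assume "f \<in> carrier ?P"
      then show "diag D f \<in> carrier (unit_group (monomial N G) e)" unfolding D(2) using D(1) by (intro diag_unit) auto
    next
      fix f f' assume "f \<in> carrier ?P" "f' \<in> carrier ?P"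
      show "diag D (f \<otimes>\<^bsub>?P\<^esub> f') = diag D f \<otimes>\<^bsub>unit_group (monomial N G) e\<^esub> diag D f'"
        by (auto simp: mat_mul_diag intro!: diag_cong)
    qed
    moreover have "x \<in> diag D ` carrier ?P" if x: "x \<in> carrier (unit_group (monomial N G) e)" for x
    proof -
      obtain f where f: "\<forall>i\<in>D. f i \<in> carrier G" "x = diag D f" using unit_diag[OF D(1)] x D(2) by blast
      have "x = diag D (restrict f D)" unfolding f(2) by (rule diag_cong) simp
      then show ?thesis using f(1) by auto
    qed
    ultimately have "diag D \<in> epi ?P (unit_group (monomial N G) e)"
      unfolding epi_def using hom_in_carrier[of "diag D" ?P "unit_group (monomial N G) e"] by auto
    then show "pv_group H (unit_group (monomial N G) e)" using pv_group_image[OF H iP S.unit_group_group[OF e]] by blast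
  qed
qed

section \<open>The automaton of a chain\<close>

text \<open>The states \<open>0, \<dots>, N\<close> are the blocks of the chain from left to right. State \<open>length L\<close> is the
  block \<open>B\<close>, the only one at which a letter acts by its label.\<close>
locale chain_automaton = group G for G :: "'g monoid" (structure) +
  fixes lbl :: "'a \<Rightarrow> 'g" and L :: "('a \<times> 'a set) list" and B :: "'a set" and R :: "('a \<times> 'a set) list"
  assumes lbl: "lbl a \<in> carrier G" and sepL: "separated B L" and sepR: "separated B R"
begin

abbreviation N where "N \<equiv> length L + length R"

definition loopset :: "nat \<Rightarrow> 'a set" where
  "loopset i = (if i < length L then snd (L ! (length L - Suc i)) else if i = length L then B
     else snd (R ! (i - Suc (length L))))"

definition exit :: "nat \<Rightarrow> 'a" where
  "exit i = (if i < length L then fst (L ! (length L - Suc i)) else fst (R ! (i - length L)))"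

definition letter :: "'a \<Rightarrow> nat \<Rightarrow> (nat \<times> 'g) option" where
  "letter a = (\<lambda>i. if i \<le> N \<and> a \<in> loopset i then Some (i, if i = length L then lbl a else \<one>)
     else if i < N \<and> a = exit i then Some (Suc i, \<one>) else None)"

definition run :: "'a list \<Rightarrow> nat \<Rightarrow> (nat \<times> 'g) option" where
  "run w = foldr (\<lambda>a m. mat_mul G (letter a) m) w (diag {..N} (\<lambda>_. \<one>))"

definition label :: "'a list \<Rightarrow> 'g" where "label w = foldr (\<lambda>a g. lbl a \<otimes> g) w \<one>"

end

lemma separated_nth: "separated B R \<Longrightarrow> k < length R \<Longrightarrow>
  fst (R ! k) \<notin> snd (R ! k) \<and> fst (R ! k) \<notin> (if k = 0 then B else snd (R ! (k - 1)))"
proof (induction R arbitrary: B k)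
  case (Cons p R)
  obtain a C where p: "p = (a, C)" by (cases p)
  show ?case
  proof (cases k)
    case 0 then show ?thesis using Cons.prems p by simp
  next
    case (Suc j)
    then have "fst (R ! j) \<notin> snd (R ! j) \<and> fst (R ! j) \<notin> (if j = 0 then C else snd (R ! (j - 1)))"
      using Cons.IH[of C j] Cons.prems p by simp
    then show ?thesis using Suc p by (cases j) auto
  qed
qed simp

context chain_automaton begin

text \<open>Separation means that a letter never leads to or from a state in two ways. So the matrices
  of letters have at most one nonzero entry in each row and column.\<close>
lemma exit_sep: assumes "i < N" shows "exit i \<notin> loopset i" "exit i \<notin> loopset (Suc i)"
proof -
  have "exit i \<notin> loopset i \<and> exit i \<notin> loopset (Suc i)"
  proof (cases "i < length L")
    case True
    define k where "k = length L - Suc i"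
    have k: "k < length L" using True by (simp add: k_def)
    note s = separated_nth[OF sepL k]
    have 1: "exit i = fst (L ! k)" "loopset i = snd (L ! k)" using True by (simp_all add: exit_def loopset_def k_def)
    have 2: "loopset (Suc i) = (if k = 0 then B else snd (L ! (k - 1)))"
      using True by (auto simp: loopset_def k_def)
    show ?thesis using s unfolding 1 2 by simp
  next
    case False
    define k where "k = i - length L"
    have k: "k < length R" using False assms by (simp add: k_def)
    note s = separated_nth[OF sepR k]
    have 1: "exit i = fst (R ! k)" "loopset (Suc i) = snd (R ! k)" using False by (simp_all add: exit_def loopset_def k_def)
    have 2: "loopset i = (if k = 0 then B else snd (R ! (k - 1)))"
      using False by (auto simp: loopset_def k_def)
    show ?thesis using s unfolding 1 2 by simp
  qed
  then show "exit i \<notin> loopset i" "exit i \<notin> loopset (Suc i)" by auto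
qed

lemma letter_monomial: "letter a \<in> monomial_mats N G"
proof (rule monomial_matsI)
  show "i \<le> j \<and> j \<le> N \<and> g \<in> carrier G" if "letter a i = Some (j, g)" for i j g
    using that lbl by (auto simp: letter_def split: if_splits)
  show "i = i'" if "letter a i = Some (j, g)" "letter a i' = Some (j, g')" for i i' j g g'
    using that exit_sep[of i] exit_sep[of i'] by (auto simp: letter_def split: if_splits)
qed

lemma one_monomial: "diag {..N} (\<lambda>_. \<one>) \<in> monomial_mats N G" by (rule diag_monomial) auto

lemma run_monomial: "run w \<in> monomial_mats N G"
  by (induction w) (simp_all add: run_def one_monomial mat_mul_closed letter_monomial)

lemma mat_mul_one: assumes "m \<in> monomial_mats N G" shows "mat_mul G (diag {..N} (\<lambda>_. \<one>)) m = m"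
proof
  fix i show "mat_mul G (diag {..N} (\<lambda>_. \<one>)) m i = m i"
    using monomial_matsD(1)[OF assms, of i] by (cases "m i") (auto simp: mat_mul_def diag_def split: option.splits)
qed

lemma run_append: "run (w @ w') = mat_mul G (run w) (run w')"
proof (induction w)
  case Nil
  then show ?case using mat_mul_one[OF run_monomial] by (simp add: run_def)
next
  case (Cons a w)
  have "run (a # w @ w') = mat_mul G (letter a) (run (w @ w'))" by (simp add: run_def)
  also have "\<dots> = mat_mul G (mat_mul G (letter a) (run w)) (run w')"
    using Cons mat_mul_assoc[OF letter_monomial run_monomial run_monomial] by simp
  finally show ?case by (simp add: run_def)
qed

lemma run_Nil: "run [] i = (if i \<le> N then Some (i, \<one>) else None)"
  by (simp add: run_def diag_def)

lemma run_carrier: "run w i = Some (j, g) \<Longrightarrow> g \<in> carrier G"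
  using monomial_matsD(1)[OF run_monomial] by blast

lemma run_loop:
  assumes "i \<le> N" "a \<in> loopset i"
  shows "run (a # w) i = (case run w i of None \<Rightarrow> None | Some (j, g) \<Rightarrow> Some (j, (if i = length L then lbl a else \<one>) \<otimes> g))"
  using assms by (simp add: run_def letter_def mat_mul_def)

lemma run_exit:
  assumes "i < N"
  shows "run (exit i # w) i = run w (Suc i)"
proof -
  have "run (exit i # w) i = (case run w (Suc i) of None \<Rightarrow> None | Some (j, g) \<Rightarrow> Some (j, \<one> \<otimes> g))"
    using assms exit_sep by (simp add: run_def letter_def mat_mul_def)
  then show ?thesis using run_carrier[of w "Suc i"] by (auto split: option.splits)
qed

lemma run_stuck:
  assumes "a \<notin> loopset i" "\<not> (i < N \<and> a = exit i)"
  shows "run (a # w) i = None"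
  using assms by (auto simp: run_def letter_def mat_mul_def)

lemma run_loops:
  assumes "i \<le> N" "i \<noteq> length L"
  shows "set u \<subseteq> loopset i \<Longrightarrow> run (u @ w) i = run w i"
proof (induction u)
  case (Cons a u)
  then show ?case using run_loop[OF assms(1), of a "u @ w"] assms(2) run_carrier[of "u @ w" i]
    by (auto split: option.splits)
qed simp

lemma run_middle:
  assumes "run w (length L) = Some (j, \<one>)"
  shows "set u \<subseteq> B \<Longrightarrow> run (u @ w) (length L) = Some (j, label u)"
proof (induction u)
  case (Cons a u)
  have "a \<in> loopset (length L)" using Cons.prems by (simp add: loopset_def)
  then show ?case using run_loop[of "length L" a "u @ w"] Cons by (simp add: label_def)
qed (use assms in \<open>simp add: label_def\<close>)

text \<open>State \<open>t\<close> is reached after the first \<open>t\<close> blocks. Since \<open>L\<close> is listed from the middle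
  outwards, they are its last \<open>t\<close> entries.\<close>
lemma run_left:
  "t \<le> length L \<Longrightarrow> x \<in> left_words (drop (length L - t) L) \<Longrightarrow> run (x @ w) 0 = run w t"
proof (induction t arbitrary: x w)
  case (Suc t)
  let ?k = "length L - Suc t"
  have k: "?k < length L" "Suc ?k = length L - t" using Suc.prems(1) by auto
  have d: "drop ?k L = (exit t, loopset t) # drop (length L - t) L"
    using Cons_nth_drop_Suc[OF k(1)] k Suc.prems(1) by (simp add: exit_def loopset_def)
  obtain x1 u where x: "x = x1 @ u @ [exit t]" "x1 \<in> left_words (drop (length L - t) L)" "set u \<subseteq> loopset t"
    using Suc.prems(2) unfolding d by auto
  have "run (x @ w) 0 = run (u @ exit t # w) t" using Suc.IH[OF _ x(2)] Suc.prems(1) x(1) by simp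
  also have "\<dots> = run (exit t # w) t" by (rule run_loops) (use Suc.prems(1) x(3) in auto)
  also have "\<dots> = run w (Suc t)" by (rule run_exit) (use Suc.prems(1) in auto)
  finally show ?case .
qed simp

lemma drop_R: assumes "k < length R"
  shows "drop k R = (exit (length L + k), loopset (Suc (length L + k))) # drop (Suc k) R"
  using Cons_nth_drop_Suc[OF assms] by (simp add: exit_def loopset_def)

lemma run_right: "k \<le> length R \<Longrightarrow> y \<in> right_words (drop (length R - k) R) \<Longrightarrow> run y (N - k) = Some (N, \<one>)"
proof (induction k arbitrary: y)
  case 0 then show ?case by (simp add: run_Nil)
next
  case (Suc k)
  let ?i = "length R - Suc k"
  have i: "?i < length R" "Suc ?i = length R - k" using Suc.prems by auto
  have e: "N - Suc k = length L + ?i" "Suc (length L + ?i) = N - k" using Suc.prems by auto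
  obtain u y' where y: "y = exit (length L + ?i) # u @ y'" "set u \<subseteq> loopset (N - k)" "y' \<in> right_words (drop (length R - k) R)"
    using Suc.prems(2) unfolding drop_R[OF i(1)] i(2) e(2) by auto
  have "run y (N - Suc k) = run (u @ y') (N - k)"
    unfolding e(1) y(1) e(2)[symmetric] by (rule run_exit) (use i(1) in simp)
  also have "\<dots> = run y' (N - k)" by (rule run_loops) (use Suc.prems(1) y(2) in auto)
  finally show ?case using Suc.IH y(3) Suc.prems(1) by simp
qed

lemma run_leave:
  "run w t = Some (N, g) \<Longrightarrow> t < length L \<Longrightarrow>
    \<exists>u w'. w = u @ exit t # w' \<and> set u \<subseteq> loopset t \<and> run w' (Suc t) = Some (N, g)"
proof (induction w arbitrary: g)
  case Nil then show ?case by (simp add: run_Nil split: if_splits)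
next
  case (Cons a w)
  show ?case
  proof (cases "a \<in> loopset t")
    case True
    obtain h where h: "run w t = Some (N, h)" "g = \<one> \<otimes> h"
      using Cons.prems run_loop[OF _ True, of w] by (auto split: option.splits)
    then have "run w t = Some (N, g)" using run_carrier by simp
    then obtain u w' where "w = u @ exit t # w'" "set u \<subseteq> loopset t" "run w' (Suc t) = Some (N, g)"
      using Cons.IH Cons.prems(2) by blast
    then have "a # w = (a # u) @ exit t # w'" "set (a # u) \<subseteq> loopset t" "run w' (Suc t) = Some (N, g)"
      using True by auto
    then show ?thesis by blast
  next
    case False
    then have a: "a = exit t" "t < N" using run_stuck[OF False, of w] Cons.prems(1) by auto
    then have "run w (Suc t) = Some (N, g)" using run_exit Cons.prems(1) by simp
    then have "a # w = [] @ exit t # w" "set [] \<subseteq> loopset t" "run w (Suc t) = Some (N, g)" using a by auto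
    then show ?thesis by blast
  qed
qed

lemma run_left_inv:
  "t \<le> length L \<Longrightarrow> run w 0 = Some (N, g) \<Longrightarrow> \<exists>x w'. w = x @ w' \<and> x \<in> left_words (drop (length L - t) L) \<and> run w' t = Some (N, g)"
proof (induction t)
  case (Suc t)
  let ?k = "length L - Suc t"
  have k: "?k < length L" "Suc ?k = length L - t" using Suc.prems(1) by auto
  have d: "drop ?k L = (exit t, loopset t) # drop (length L - t) L"
    using Cons_nth_drop_Suc[OF k(1)] k Suc.prems(1) by (simp add: exit_def loopset_def)
  obtain x w' where x: "w = x @ w'" "x \<in> left_words (drop (length L - t) L)" "run w' t = Some (N, g)"
    using Suc by auto
  obtain u w'' where u: "w' = u @ exit t # w''" "set u \<subseteq> loopset t" "run w'' (Suc t) = Some (N, g)"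
    using run_leave[OF x(3)] Suc.prems(1) by auto
  have "w = (x @ u @ [exit t]) @ w''" using x u by simp
  moreover have "x @ u @ [exit t] \<in> left_words (drop ?k L)" unfolding d using x u by auto
  ultimately show ?case using u(3) by blast
qed simp

text \<open>The condition on \<open>k\<close> expresses that only the middle block contributes to the group element.\<close>
lemma run_right_inv:
  "run w (length L + k) = Some (N, g) \<Longrightarrow> k \<le> length R \<Longrightarrow>
    \<exists>u y. w = u @ y \<and> set u \<subseteq> loopset (length L + k) \<and> y \<in> right_words (drop k R) \<and> g = (if k = 0 then label u else \<one>)"
proof (induction w arbitrary: k g)
  case Nil
  then have "k = length R" "g = \<one>" by (auto simp: run_Nil split: if_splits)
  then show ?case by (intro exI[of _ "[]"]) (auto simp: label_def)
next
  case (Cons a w)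
  let ?i = "length L + k"
  show ?case
  proof (cases "a \<in> loopset ?i")
    case True
    obtain h where h: "run w ?i = Some (N, h)" "g = (if k = 0 then lbl a else \<one>) \<otimes> h"
      using Cons.prems run_loop[OF _ True, of w] by (auto split: option.splits)
    obtain u y where u: "w = u @ y" "set u \<subseteq> loopset ?i" "y \<in> right_words (drop k R)" "h = (if k = 0 then label u else \<one>)"
      using Cons.IH[OF h(1) Cons.prems(2)] by blast
    have "a # w = (a # u) @ y" "set (a # u) \<subseteq> loopset ?i" using u True by auto
    moreover have "g = (if k = 0 then label (a # u) else \<one>)" using h u by (simp add: label_def)
    ultimately show ?thesis using u(3) by blast
  next
    case False
    then have a: "a = exit ?i" "?i < N" using run_stuck[OF False, of w] Cons.prems(1) by auto
    then have "run w (Suc ?i) = Some (N, g)" using run_exit Cons.prems(1) by simp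
    then obtain u y where u: "w = u @ y" "set u \<subseteq> loopset (Suc ?i)" "y \<in> right_words (drop (Suc k) R)" "g = \<one>"
      using Cons.IH[of "Suc k" g] a by auto
    have "a # w = [] @ (a # w)" by simp
    moreover have "a # w \<in> right_words (drop k R)" unfolding drop_R[of k, OF a(2)[simplified]] using u a by auto
    moreover have "g = (if k = 0 then label [] else \<one>)" using u by (simp add: label_def)
    ultimately show ?thesis by (metis empty_subsetI list.set(1))
  qed
qed

text \<open>The corner entry of the matrix of a word is its reading.\<close>
lemma run_readings: "run w 0 = Some (N, g) \<longleftrightarrow> g \<in> readings label L B R w"
proof
  assume "g \<in> readings label L B R w"
  then obtain x m y where w: "g = label m" "w = x @ m @ y" "x \<in> left_words L" "set m \<subseteq> B" "y \<in> right_words R"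
    unfolding readings_def by blast
  have "run y (length L) = Some (N, \<one>)" using run_right[of "length R" y] w(5) by simp
  then show "run w 0 = Some (N, g)" using run_left[of "length L" x "m @ y"] run_middle w by simp
next
  assume "run w 0 = Some (N, g)"
  then obtain x w' where x: "w = x @ w'" "x \<in> left_words L" "run w' (length L) = Some (N, g)"
    using run_left_inv[of "length L" w g] by auto
  obtain u y where "w' = u @ y" "set u \<subseteq> B" "y \<in> right_words R" "g = label u"
    using run_right_inv[of w' 0 g] x(3) by (auto simp: loopset_def)
  then show "g \<in> readings label L B R w" unfolding readings_def using x by blast
qed

lemma run_eq_readings: "run w = run w' \<Longrightarrow> readings label L B R w = readings label L B R w'"
  using run_readings by (metis subsetI subset_antisym)

end

section \<open>The category of a semigroupoid\<close>

text \<open>Local identities are adjoined, and \<open>Null\<close> is the value of undefined products.\<close>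
datatype ('v, 'e) arr = Null | Ident 'v | Edge 'e

fun arr_mul :: "('v, 'e) semigroupoid \<Rightarrow> ('v, 'e) arr \<Rightarrow> ('v, 'e) arr \<Rightarrow> ('v, 'e) arr" where
  "arr_mul S (Edge s) (Edge t) = (if s \<in> edges S \<and> t \<in> edges S \<and> tgt S s = src S t then Edge (mul S s t) else Null)"
| "arr_mul S (Ident v) (Edge t) = (if t \<in> edges S \<and> src S t = v then Edge t else Null)"
| "arr_mul S (Edge s) (Ident v) = (if s \<in> edges S \<and> tgt S s = v then Edge s else Null)"
| "arr_mul S (Ident u) (Ident v) = (if u = v then Ident v else Null)"
| "arr_mul S Null y = Null"
| "arr_mul S x Null = Null"

definition arr_hom :: "('v, 'e) semigroupoid \<Rightarrow> 'v \<Rightarrow> 'v \<Rightarrow> ('v, 'e) arr set" where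
  "arr_hom S u v = {Edge s | s. s \<in> edges S \<and> src S s = u \<and> tgt S s = v} \<union> (if u = v \<and> u \<in> verts S then {Ident u} else {})"

lemma arr_mul_assoc: assumes "is_semigroupoid S" shows "arr_mul S (arr_mul S x y) z = arr_mul S x (arr_mul S y z)"
  by (cases x; cases y; cases z) (use assms in \<open>auto simp: is_semigroupoid_def\<close>)

lemma arr_hom_cases:
  assumes "x \<in> arr_hom S u v"
  obtains s where "x = Edge s" "s \<in> edges S" "src S s = u" "tgt S s = v" | "x = Ident u" "u = v" "u \<in> verts S"
  using assms by (auto simp: arr_hom_def split: if_splits)

text \<open>Adjoined identities are the only new idempotents, and a product that is an identity has
  identities as factors.\<close>
lemma local_category_of_semigroupoid:
  assumes S: "fin_semigroupoid S" and L: "\<And>v. v \<in> verts S \<Longrightarrow> loops S v \<noteq> {} \<Longrightarrow> dh_ecom H (local_semigroup S v)"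
  shows "local_category (verts S) (arr_hom S) (arr_mul S) Ident"
proof
  have sS: "is_semigroupoid S" using S by (simp add: fin_semigroupoid_def)
  show "arr_mul S (arr_mul S x y) z = arr_mul S x (arr_mul S y z)" for x y z by (rule arr_mul_assoc[OF sS])
  show "arr_mul S x y \<in> arr_hom S u w" if "x \<in> arr_hom S u v" "y \<in> arr_hom S v w" for x y u v w
    using that sS by (elim arr_hom_cases) (auto simp: arr_hom_def is_semigroupoid_def)
  show "u' = u \<and> v' = v" if "x \<in> arr_hom S u v" "x \<in> arr_hom S u' v'" for x u v u' v'
    using that by (elim arr_hom_cases) auto
  show "u \<in> verts S \<and> v \<in> verts S" if "x \<in> arr_hom S u v" for x u v
    using that sS by (elim arr_hom_cases) (auto simp: is_semigroupoid_def)
  show "Ident u \<in> arr_hom S u u" if "u \<in> verts S" for u using that by (simp add: arr_hom_def)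
  show "arr_mul S (Ident u) x = x" "arr_mul S x (Ident v) = x" if "x \<in> arr_hom S u v" for x u v
    using that by (elim arr_hom_cases; auto)+
  have "(\<Union>u\<in>verts S. \<Union>v\<in>verts S. arr_hom S u v) \<subseteq> Edge ` edges S \<union> Ident ` verts S"
    by (auto simp: arr_hom_def split: if_splits)
  then show "finite (\<Union>u\<in>verts S. \<Union>v\<in>verts S. arr_hom S u v)"
    using S unfolding fin_semigroupoid_def by (meson finite_UnI finite_imageI finite_subset)
  have lp: "dh_ecom H (local_semigroup S u)" if "s \<in> edges S" "src S s = u" "tgt S s = u" for s u
    using L[of u] that sS by (auto simp: loops_def is_semigroupoid_def)
  show "arr_mul S e f = arr_mul S f e"
    if h: "e \<in> arr_hom S u u" "f \<in> arr_hom S u u" "arr_mul S e e = e" "arr_mul S f f = f" for e f u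
    using h(1)
  proof (cases rule: arr_hom_cases)
    case e: (1 s)
    show ?thesis using h(2)
    proof (cases rule: arr_hom_cases)
      case f: (1 t)
      then have "mul S s t = mul S t s" using dh_ecomD(2)[OF lp[OF e(2-4)], of s t] e h
        by (auto simp: idempotent_element_def loops_def)
      then show ?thesis using e f by simp
    qed (use e in auto)
  next
    case 2
    then show ?thesis using h(2) by (elim arr_hom_cases) auto
  qed
  show "arr_mul S a b = arr_mul S b a"
    if h: "a \<in> arr_hom S u u" "b \<in> arr_hom S u u" "arr_mul S (arr_mul S a b) (arr_mul S a b) = arr_mul S a b"
      "arr_mul S (arr_mul S b a) (arr_mul S b a) = arr_mul S b a" for a b u
    using h(1)
  proof (cases rule: arr_hom_cases)
    case a: (1 s)
    show ?thesis using h(2)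
    proof (cases rule: arr_hom_cases)
      case b: (1 t)
      note d = lp[OF a(2-4)]
      interpret finite_semigroup "local_semigroup S u" using dh_ecom_finite_semigroup[OF d] .
      have st: "s \<in> loops S u" "t \<in> loops S u" using a b by (auto simp: loops_def)
      have m: "mul S s t \<in> loops S u" "mul S t s \<in> loops S u" using closed st by auto
      have "smul (local_semigroup S u) s t = smul (local_semigroup S u) t s"
        by (rule conjugate_idempotents_eq) (use dh_ecomD(2,3)[OF d] st m h a b in \<open>auto simp: loops_def\<close>)
      then show ?thesis using a b by simp
    qed (use a in auto)
  next
    case 2
    then show ?thesis using h(2) by (elim arr_hom_cases) auto
  qed
qed

section \<open>Division by a product of matrix semigroups\<close>

context local_category begin

definition unit_monoid :: "'v \<Rightarrow> 'a \<Rightarrow> 'a monoid" where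
  "unit_monoid v e = \<lparr>carrier = units_at v e, monoid.mult = (\<cdot>), one = e\<rparr>"

lemma unit_monoid_simps [simp]: "carrier (unit_monoid v e) = units_at v e" "x \<otimes>\<^bsub>unit_monoid v e\<^esub> y = x \<cdot> y" "\<one>\<^bsub>unit_monoid v e\<^esub> = e"
  by (simp_all add: unit_monoid_def)

lemma unit_self: "idem v e \<Longrightarrow> e \<in> units_at v e" unfolding units_at_def idem_def by blast

lemma group_unit_monoid: assumes "idem v e" shows "group (unit_monoid v e)"
proof (rule groupI)
  show "\<exists>y\<in>carrier (unit_monoid v e). y \<otimes>\<^bsub>unit_monoid v e\<^esub> x = \<one>\<^bsub>unit_monoid v e\<^esub>" if "x \<in> carrier (unit_monoid v e)" for x
    using that unfolding unit_monoid_simps units_at_def by blast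
qed (use unit_mult[OF assms] unit_self[OF assms] in \<open>auto simp: assoc units_at_def\<close>)

lemma letter_label_unit: assumes e: "idem v e" shows "letter_label v e a \<in> units_at v e"
proof (cases "a \<in> content e")
  case True
  then obtain s t where "a \<in> Hm s t" using content_Arr in_Arr by blast
  then show ?thesis using unit_label_unit[OF e] True arr_src_tgt unfolding letter_label_def by metis
qed (simp add: letter_label_def unit_self[OF e])

text \<open>The finitely many automata that are used to distinguish paths: a chain with a block that is
  labelled in the maximal subgroup at an idempotent \<open>e\<close>.\<close>
definition chains :: "nat \<Rightarrow> ('v \<times> 'a \<times> ('a \<times> 'a set) list \<times> 'a set \<times> ('a \<times> 'a set) list) set" where
  "chains K = {(v, e, L, B, R). idem v e \<and> separated B L \<and> separated B R \<and> length L + length R \<le> K \<and>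
     B \<subseteq> Arr \<and> over Arr L \<and> over Arr R}"

lemma finite_chains: assumes "finite V" shows "finite (chains K)"
proof -
  let ?X = "{L. set L \<subseteq> Arr \<times> Pow Arr \<and> length L \<le> K}"
  have "finite ?X" using finite_Arr by (intro finite_lists_length_le) auto
  moreover have "chains K \<subseteq> V \<times> Arr \<times> ?X \<times> Pow Arr \<times> ?X"
    unfolding chains_def idem_def in_Arr over_def using hom_V by (auto simp: in_Arr) blast+
  ultimately show ?thesis using assms finite_Arr by (meson finite_SigmaI finite_Pow_iff finite_subset)
qed

definition chain_action :: "'v \<times> 'a \<times> ('a \<times> 'a set) list \<times> 'a set \<times> ('a \<times> 'a set) list \<Rightarrow> 'a list \<Rightarrow> nat \<Rightarrow> (nat \<times> 'a) option" where
  "chain_action = (\<lambda>(v, e, L, B, R). chain_automaton.run (unit_monoid v e) (letter_label v e) L B R)"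

definition chain_target :: "'v \<times> 'a \<times> ('a \<times> 'a set) list \<times> 'a set \<times> ('a \<times> 'a set) list \<Rightarrow> (nat \<Rightarrow> (nat \<times> 'a) option) sgrp" where
  "chain_target = (\<lambda>(v, e, L, B, R). monomial (length L + length R) (unit_monoid v e))"

lemma chain_automaton_chains:
  assumes "(v, e, L, B, R) \<in> chains K" shows "chain_automaton (unit_monoid v e) (letter_label v e) L B R"
proof -
  have "idem v e" "separated B L" "separated B R" using assms by (auto simp: chains_def)
  then show ?thesis unfolding chain_automaton_def chain_automaton_axioms_def
    using group_unit_monoid letter_label_unit by simp
qed

definition chain_image :: "nat \<Rightarrow> 'a list \<Rightarrow> _" where
  "chain_image K w = (\<lambda>ch\<in>chains K. chain_action ch w)"

lemma chain_image_carrier: "chain_image K w \<in> carrier (sgrp_product (chains K) chain_target)"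
  unfolding carrier_product chain_image_def chain_target_def chain_action_def
  using chain_automaton.run_monomial[OF chain_automaton_chains] by auto

lemma chain_image_append:
  "chain_image K (w @ w') = smul (sgrp_product (chains K) chain_target) (chain_image K w) (chain_image K w')"
  unfolding smul_product chain_image_def chain_target_def chain_action_def
  using chain_automaton.run_append[OF chain_automaton_chains] by (auto intro!: restrict_ext)

lemma chain_image_eqv: assumes "chain_image K w = chain_image K w'" shows "chain_equiv Arr K w w'"
  unfolding chain_equiv_def
proof (intro allI impI)
  fix L B R v e
  assume "idem v e \<and> separated B L \<and> separated B R \<and> length L + length R \<le> K \<and> B \<subseteq> Arr \<and> over Arr L \<and> over Arr R"
  then have ch: "(v, e, L, B, R) \<in> chains K" by (simp add: chains_def)
  interpret chain_automaton "unit_monoid v e" "letter_label v e" L B R using chain_automaton_chains ch .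
  have "run w = run w'"
    using fun_cong[OF assms, of "(v, e, L, B, R)"] ch by (simp add: chain_image_def chain_action_def)
  then have "readings label L B R w = readings label L B R w'" by (rule run_eq_readings)
  moreover have "label = word_label v e" by (simp add: label_def word_label_def fun_eq_iff)
  ultimately show "readings (word_label v e) L B R w = readings (word_label v e) L B R w'" by simp
qed

end

text \<open>If \<open>e\<close> is not an adjoined identity, then its maximal subgroup does not change; otherwise it
  is trivial.\<close>
lemma pv_group_unit_monoid:
  assumes H: "group_pseudovariety H" and S: "fin_semigroupoid S"
    and L: "\<And>v. v \<in> verts S \<Longrightarrow> loops S v \<noteq> {} \<Longrightarrow> dh_ecom H (local_semigroup S v)"
    and e: "local_category.idem (arr_hom S) (arr_mul S) v e"
  shows "pv_group H (local_category.unit_monoid (arr_hom S) (arr_mul S) v e)"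
proof -
  interpret C: local_category "verts S" "arr_hom S" "arr_mul S" Ident
    by (rule local_category_of_semigroupoid[OF S L])
  have eh: "e \<in> arr_hom S v v" "arr_mul S e e = e" using e unfolding C.idem_def by auto
  have g: "group (C.unit_monoid v e)" using C.group_unit_monoid[OF e] .
  show ?thesis using eh(1)
  proof (cases rule: arr_hom_cases)
    case s: (1 s)
    have sl: "s \<in> loops S v" using s by (simp add: loops_def)
    have vS: "v \<in> verts S" using C.hom_V[OF eh(1)] by blast
    note d = L[OF vS]
    have i: "idempotent_element (local_semigroup S v) s"
      using eh(2) s sl by (simp add: idempotent_element_def)
    have iK: "pv_group H (unit_group (local_semigroup S v) s)" using dh_ecomD(4)[OF d i] sl by blast
    have loopD: "x \<in> loops S w \<longleftrightarrow> x \<in> edges S \<and> src S x = w \<and> tgt S x = w" for x w by (auto simp: loops_def)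
    have "Edge \<in> hom (unit_group (local_semigroup S v) s) (C.unit_monoid v e)"
    proof (rule homI)
      fix x assume "x \<in> carrier (unit_group (local_semigroup S v) s)"
      then obtain y where xy: "x \<in> loops S v" "mul S s x = x" "mul S x s = x" "y \<in> loops S v" "mul S s y = y" "mul S y s = y"
         "mul S x y = s" "mul S y x = s" unfolding in_unit_group by auto
      show "Edge x \<in> carrier (C.unit_monoid v e)" unfolding C.unit_monoid_simps C.units_at_def
        using xy s by (auto simp: loopD arr_hom_def intro!: bexI[of _ "Edge y"])
    next
      fix x y assume "x \<in> carrier (unit_group (local_semigroup S v) s)" "y \<in> carrier (unit_group (local_semigroup S v) s)"
      then show "Edge (x \<otimes>\<^bsub>unit_group (local_semigroup S v) s\<^esub> y) = Edge x \<otimes>\<^bsub>C.unit_monoid v e\<^esub> Edge y"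
        by (simp add: in_unit_group loopD)
    qed
    moreover have "x \<in> Edge ` carrier (unit_group (local_semigroup S v) s)" if x: "x \<in> C.units_at v e" for x
    proof -
      obtain y where xy: "x \<in> arr_hom S v v" "arr_mul S e x = x" "arr_mul S x e = x" "y \<in> arr_hom S v v" "arr_mul S e y = y" "arr_mul S y e = y"
         "arr_mul S x y = e" "arr_mul S y x = e" using x unfolding C.units_at_def by blast
      have ed: "\<exists>t. z = Edge t \<and> t \<in> loops S v" if "z \<in> arr_hom S v v" "arr_mul S e z = z" for z
        using that(1)
      proof (cases rule: arr_hom_cases)
        case (1 t) then show ?thesis by (simp add: loopD)
      next
        case 2 then show ?thesis using that(2) s by simp
      qed
      obtain x0 y0 where 0: "x = Edge x0" "x0 \<in> loops S v" "y = Edge y0" "y0 \<in> loops S v"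
        using ed xy by blast
      then have "x0 \<in> carrier (unit_group (local_semigroup S v) s)"
        unfolding in_unit_group using xy s by (auto simp: loopD intro!: bexI[of _ y0])
      then show ?thesis using 0 by blast
    qed
    ultimately have "Edge \<in> epi (unit_group (local_semigroup S v) s) (C.unit_monoid v e)"
      unfolding epi_def using hom_in_carrier[of Edge "unit_group (local_semigroup S v) s" "C.unit_monoid v e"] by auto
    then show ?thesis using pv_group_image[OF H iK g] by blast
  next
    case 2
    have "C.units_at v e = {e}"
    proof
      show "{e} \<subseteq> C.units_at v e" using C.unit_self[OF e] by simp
      show "C.units_at v e \<subseteq> {e}"
      proof
        fix x assume "x \<in> C.units_at v e"
        then obtain y where "x \<in> arr_hom S v v" "y \<in> arr_hom S v v" "arr_mul S x y = e" unfolding C.units_at_def by blast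
        then show "x \<in> {e}" using 2 by (elim arr_hom_cases) (auto split: if_splits)
      qed
    qed
    then have c: "carrier (C.unit_monoid v e) = {e}" by simp
    \<comment> \<open>The trivial group is an empty product.\<close>
    have t: "pv_group H (product_group {} (\<lambda>_::nat. undefined :: nat monoid))" by (rule pv_group_product[OF H]) auto
    have "(\<lambda>_. e) \<in> epi (product_group {} (\<lambda>_::nat. undefined :: nat monoid)) (C.unit_monoid v e)"
      unfolding epi_def hom_def using c eh(2) by auto
    then show ?thesis using pv_group_image[OF H t g] by blast
  qed
qed

text \<open>The semigroupoid \<open>U\<close> consists of the pairs of an edge of \<open>S\<close> and the image in \<open>T\<close> of a path
  with this value. Its projection to \<open>T\<close> is faithful because equal images make paths chain
  equivalent.\<close>
lemma l_pv_subset_g_pv: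
  assumes H: "group_pseudovariety H"
  shows "l_pv (DH H \<inter> ECom) \<subseteq> g_pv (DH H \<inter> ECom)"
proof
  fix S assume "S \<in> l_pv (DH H \<inter> ECom)"
  then have S: "fin_semigroupoid S" and L: "\<And>v. v \<in> verts S \<Longrightarrow> loops S v \<noteq> {} \<Longrightarrow> dh_ecom H (local_semigroup S v)"
    unfolding l_pv_iff[OF H] by auto
  have sS: "is_semigroupoid S" and fV: "finite (verts S)" using S by (auto simp: fin_semigroupoid_def)
  interpret C: local_category "verts S" "arr_hom S" "arr_mul S" Ident
    by (rule local_category_of_semigroupoid[OF S L])
  obtain K where K: "\<And>u v z w. C.path u z v \<Longrightarrow> C.path u w v \<Longrightarrow> C.chain_equiv C.Arr K z w \<Longrightarrow> C.val u z = C.val u w"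
    using C.chain_equiv_separates by blast
  define P where "P = sgrp_product (C.chains K) C.chain_target"
  have dP: "dh_ecom H P" unfolding P_def
  proof (rule dh_ecom_product[OF H C.finite_chains[OF fV]])
    fix ch assume "ch \<in> C.chains K"
    then obtain v e L B R where ch: "ch = (v, e, L, B, R)" "C.idem v e" by (auto simp: C.chains_def)
    show "dh_ecom H (C.chain_target ch)" unfolding ch(1) C.chain_target_def
      using dh_ecom_monomial[OF H pv_group_unit_monoid[OF H S L ch(2)]] by simp
  qed
  obtain T :: "nat sgrp" and c where T: "fin_semigroup T" and c: "c \<in> sgrp_hom P T" "bij_betw c (carrier P) (carrier T)"
    using semigroup_nat_copy dh_ecomD(1)[OF dP] by blast
  have dT: "dh_ecom H T" using dh_ecom_image[OF H dP T c(1)] c(2) by (simp add: bij_betw_def)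
  interpret T: finite_semigroup T using T by (simp add: finite_semigroup_def)
  define \<Theta> where "\<Theta> w = c (C.chain_image K w)" for w
  have imP: "C.chain_image K w \<in> carrier P" for w unfolding P_def by (rule C.chain_image_carrier)
  have Th: "\<Theta> w \<in> carrier T" for w using imP c(2) unfolding \<Theta>_def bij_betw_def by blast
  have Tha: "\<Theta> (w @ w') = smul T (\<Theta> w) (\<Theta> w')" for w w'
    using c(1) imP C.chain_image_append[of K w w'] unfolding \<Theta>_def P_def[symmetric] sgrp_hom_def by auto
  have Thi: "C.chain_equiv C.Arr K w w'" if "\<Theta> w = \<Theta> w'" for w w'
  proof -
    have "C.chain_image K w = C.chain_image K w'" using that imP c(2) unfolding \<Theta>_def bij_betw_def inj_on_def by blast
    then show ?thesis by (rule C.chain_image_eqv)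
  qed
  define rel where "rel s t \<longleftrightarrow> s \<in> edges S \<and> (\<exists>w. C.path (src S s) w (tgt S s) \<and> C.val (src S s) w = Edge s \<and> t = \<Theta> w)" for s t
  define fs sn where "fs x = fst (prod_decode x)" and "sn x = snd (prod_decode x)" for x
  define U :: "(nat, nat) semigroupoid" where "U = \<lparr>verts = verts S, edges = {x. rel (fs x) (sn x)},
     src = (\<lambda>x. src S (fs x)), tgt = (\<lambda>x. tgt S (fs x)),
     mul = (\<lambda>x y. prod_encode (mul S (fs x) (fs y), smul T (sn x) (sn y)))\<rparr>"
  have fs_sn [simp]: "fs (prod_encode (s, t)) = s" "sn (prod_encode (s, t)) = t" for s t by (simp_all add: fs_def sn_def)
  have eqx: "x = y" if "fs x = fs y" "sn x = sn y" for x y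
    using that unfolding fs_def sn_def by (metis prod.collapse prod_decode_inverse)
  have relE: "s \<in> edges S" "t \<in> carrier T" if "rel s t" for s t using that Th by (auto simp: rel_def)
  have relm: "rel (mul S s s') (smul T t t')" if r: "rel s t" "rel s' t'" and st: "tgt S s = src S s'" for s t s' t'
  proof -
    obtain w where w: "s \<in> edges S" "C.path (src S s) w (tgt S s)" "C.val (src S s) w = Edge s" "t = \<Theta> w"
      using r(1) unfolding rel_def by blast
    obtain w' where w': "s' \<in> edges S" "C.path (src S s') w' (tgt S s')" "C.val (src S s') w' = Edge s'" "t' = \<Theta> w'"
      using r(2) unfolding rel_def by blast
    have m: "mul S s s' \<in> edges S" "src S (mul S s s') = src S s" "tgt S (mul S s s') = tgt S s'"
      using sS w(1) w'(1) st by (auto simp: is_semigroupoid_def)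
    have "C.path (src S s) (w @ w') (tgt S s')" using w(2) w'(2) st C.path_append_iff by auto
    moreover have "C.val (src S s) (w @ w') = Edge (mul S s s')"
      using C.val_append[OF w(2), of w'] w w' st by simp
    ultimately show ?thesis unfolding rel_def using m Tha w(4) w'(4) by auto
  qed
  have U: "is_semigroupoid U"
    unfolding is_semigroupoid_def
  proof (intro conjI ballI impI)
    fix x assume x: "x \<in> edges U"
    then have "fs x \<in> edges S" using relE by (simp add: U_def)
    then show "src U x \<in> verts U" "tgt U x \<in> verts U" using sS by (auto simp: U_def is_semigroupoid_def)
    fix y assume y: "y \<in> edges U" and xy: "tgt U x = src U y"
    have r: "rel (fs x) (sn x)" "rel (fs y) (sn y)" "tgt S (fs x) = src S (fs y)" using x y xy by (simp_all add: U_def)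
    show "mul U x y \<in> edges U" using relm[OF r] by (simp add: U_def)
    show "src U (mul U x y) = src U x" "tgt U (mul U x y) = tgt U y"
      using sS relE(1)[OF r(1)] relE(1)[OF r(2)] r(3) by (auto simp: U_def is_semigroupoid_def)
  next
    fix x y z assume "x \<in> edges U" "y \<in> edges U" "z \<in> edges U" "tgt U x = src U y \<and> tgt U y = src U z"
    then have r: "rel (fs x) (sn x)" "rel (fs y) (sn y)" "rel (fs z) (sn z)" "tgt S (fs x) = src S (fs y)" "tgt S (fs y) = src S (fs z)"
      by (simp_all add: U_def)
    have "mul S (mul S (fs x) (fs y)) (fs z) = mul S (fs x) (mul S (fs y) (fs z))"
      using sS relE(1)[OF r(1)] relE(1)[OF r(2)] relE(1)[OF r(3)] r(4,5) by (simp add: is_semigroupoid_def)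
    moreover have "smul T (smul T (sn x) (sn y)) (sn z) = smul T (sn x) (smul T (sn y) (sn z))"
      using T.assoc relE(2)[OF r(1)] relE(2)[OF r(2)] relE(2)[OF r(3)] by blast
    ultimately show "mul U (mul U x y) z = mul U x (mul U y z)" by (simp add: U_def)
  qed
  have 1: "((\<lambda>_. 0), sn) \<in> sgd_hom U (one_vertex T)"
    unfolding sgd_hom_def using relE by (auto simp: U_def one_vertex_def)
  have 2: "faithful U sn"
    unfolding faithful_def
  proof (intro ballI impI)
    fix x y assume "x \<in> edges U" "y \<in> edges U" and h: "src U x = src U y \<and> tgt U x = tgt U y \<and> sn x = sn y"
    then have r: "rel (fs x) (sn x)" "rel (fs y) (sn y)" by (simp_all add: U_def)
    have st: "src S (fs y) = src S (fs x)" "tgt S (fs y) = tgt S (fs x)" using h by (simp_all add: U_def)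
    obtain w where w: "C.path (src S (fs x)) w (tgt S (fs x))" "C.val (src S (fs x)) w = Edge (fs x)" "sn x = \<Theta> w"
      using r(1) unfolding rel_def by blast
    obtain w' where w': "C.path (src S (fs x)) w' (tgt S (fs x))" "C.val (src S (fs x)) w' = Edge (fs y)" "sn y = \<Theta> w'"
      using r(2) unfolding rel_def st by blast
    have "C.chain_equiv C.Arr K w w'" by (rule Thi) (use w w' h in simp)
    then have "Edge (fs x) = (Edge (fs y) :: (nat, nat) arr)" using K[OF w(1) w'(1)] w(2) w'(2) by simp
    then show "x = y" using eqx h by simp
  qed
  have 3: "(id, fs) \<in> sgd_hom U S"
    unfolding sgd_hom_def using relE by (auto simp: U_def)
  have 4: "fs ` edges U = edges S"
  proof (intro subset_antisym subsetI)
    fix s assume s: "s \<in> edges S"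
    then have a: "Edge s \<in> arr_hom S (src S s) (tgt S s)" by (simp add: arr_hom_def)
    have "tgt S s \<in> verts S" using s sS by (simp add: is_semigroupoid_def)
    then have p: "C.path (src S s) [Edge s] (tgt S s)" using a by (simp add: C.path_Cons_iff)
    have "C.val (src S s) [Edge s] = Edge s" using C.val_Cons[OF a, of "[]"] s by simp
    then have "rel s (\<Theta> [Edge s])" unfolding rel_def using s p by blast
    then have "prod_encode (s, \<Theta> [Edge s]) \<in> edges U" by (simp add: U_def)
    then show "s \<in> fs ` edges U" by (metis fs_sn(1) image_eqI)
  qed (use relE in \<open>auto simp: U_def\<close>)
  have div: "divides S (one_vertex T)"
    unfolding divides_def
  proof (intro exI conjI)
    show "is_semigroupoid U" by (rule U)
    show "\<exists>(p, q)\<in>sgd_hom U (one_vertex T). faithful U q" using 1 2 by blast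
    have "bij_betw id (verts U) (verts S)" by (simp add: U_def)
    then show "\<exists>(p, q)\<in>sgd_hom U S. bij_betw p (verts U) (verts S) \<and> q ` edges U = edges S" using 3 4 by blast
  qed
  show "S \<in> g_pv (DH H \<inter> ECom)"
    unfolding g_pv_def
  proof (rule InterI)
    fix W assume "W \<in> {W. semigroupoid_pseudovariety W \<and> one_vertex ` (DH H \<inter> ECom) \<subseteq> W}"
    then have W: "semigroupoid_pseudovariety W" "one_vertex ` (DH H \<inter> ECom) \<subseteq> W" by auto
    have "one_vertex T \<in> W" using W(2) dT DH_ECom_iff[OF H] by blast
    then show "S \<in> W" using W(1) S div unfolding semigroupoid_pseudovariety_def by blast
  qed
qed

theorem corollary9p5:
  fixes H :: "nat monoid set"
  assumes "group_pseudovariety H"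
  shows "is_local (DH H \<inter> ECom)"
  unfolding is_local_def
  using DH_ECom_pseudovariety[OF assms] g_pv_subset_l_pv[OF assms] l_pv_subset_g_pv[OF assms] by blast

end
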